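(* Let $p$ be an odd prime, let $n\geq 2$, $m\geq 1$ be integers, let $r$ be an integer with $(r,p^n)=1$ having multiplicative order $p^s$ modulo $p^n$, where $1\leq s\leq\min\{n-1,m\}$, and let $G=\langle a,b\mid a^{p^n}=b^{p^m}=1,\ bab^{-1}=a^r\rangle$ (a finite non-abelian split metacyclic $p$-group). For an integer $\lambda\geq 0$, let $N_\lambda$ denote the number of inequivalent irreducible rational representations of $G$ of degree $\phi(p^\lambda)$. Then: \begin{enumerate} \item If $n-s\geq m$: $N_0=1$; $N_\lambda=p^{\lambda-1}(p+1)$ for $1\leq\lambda\leq m$; $N_\lambda=p^m$ for $m<\lambda\leq n-s$; and $N_{n-s+t}=p^{m-t}$ for $1\leq t\leq s$. \item If $n-s<m$, write $m=(n-s)+k$. \begin{enumerate} \item If $k\leq s$: $N_0=1$; $N_\lambda=p^{\lambda-1}(p+1)$ for $1\leq\lambda\leq n-s$; $N_{n-s+t}=2p^{n-s}+(t-1)\phi(p^{n-s})$ for $1\leq t\leq k-1$; $N_{n-s+k}=p^{n-s}+(k-1)\phi(p^{n-s})+p^{m-k}$; and $N_{n-s+t}=p^{m-t}$ for $k+1\leq t\leq s$. \item If $k>s$: $N_0=1$; $N_\lambda=p^{\lambda-1}(p+1)$ for $1\leq\lambda\leq n-s$; $N_{n-s+t}=2p^{n-s}+(t-1)\phi(p^{n-s})$ for $1\leq t\leq s$; and $N_\lambda=p^{n-s}+s\,\phi(p^{n-s})$ for each $\lambda$ with $n+1\leq\lambda\leq m$. \end{enumerate} \end{enumerate}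
   Context: $\phi$ denotes Euler's totient function. An irreducible rational representation means an irreducible representation over $\mathbb{Q}$. *)

theory Defs
  imports "Jordan_Normal_Form.Matrix" "HOL-Number_Theory.Totient" "HOL-Number_Theory.Cong"
begin

text \<open>Concrete model: the element a^i b^j (0 <= i < p^n, 0 <= j < p^m) is the pair (i,j).
  From b a b^-1 = a^r we get b^j a^i = a^(i r^j) b^j, hence
  (a^i1 b^j1)(a^i2 b^j2) = a^(i1 + r^j1 i2) b^(j1+j2).\<close>

definition mc_carrier :: "nat \<Rightarrow> nat \<Rightarrow> nat \<Rightarrow> (nat \<times> nat) set" where
  "mc_carrier p n m = {0..<p^n} \<times> {0..<p^m}"

definition mc_mult :: "nat \<Rightarrow> nat \<Rightarrow> nat \<Rightarrow> int \<Rightarrow> nat \<times> nat \<Rightarrow> nat \<times> nat \<Rightarrow> nat \<times> nat" where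
  "mc_mult p n m r x y =
     (nat ((int (fst x) + r ^ snd x * int (fst y)) mod int (p^n)), (snd x + snd y) mod p^m)"

definition mc_one :: "nat \<times> nat" where
  "mc_one = (0, 0)"

definition is_rep ::
  "'g set \<Rightarrow> ('g \<Rightarrow> 'g \<Rightarrow> 'g) \<Rightarrow> 'g \<Rightarrow> nat \<Rightarrow> ('g \<Rightarrow> rat mat) \<Rightarrow> bool" where
  "is_rep G mul e d \<rho> \<longleftrightarrow>
     (\<forall>g\<in>G. \<rho> g \<in> carrier_mat d d) \<and> \<rho> e = 1\<^sub>m d \<and>
     (\<forall>g\<in>G. \<forall>h\<in>G. \<rho> (mul g h) = \<rho> g * \<rho> h)"

definition is_subspace :: "nat \<Rightarrow> rat vec set \<Rightarrow> bool" where
  "is_subspace d W \<longleftrightarrow> W \<subseteq> carrier_vec d \<and> 0\<^sub>v d \<in> W \<and>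
     (\<forall>v\<in>W. \<forall>w\<in>W. v + w \<in> W) \<and> (\<forall>c. \<forall>v\<in>W. c \<cdot>\<^sub>v v \<in> W)"

definition is_irred_rep ::
  "'g set \<Rightarrow> ('g \<Rightarrow> 'g \<Rightarrow> 'g) \<Rightarrow> 'g \<Rightarrow> nat \<Rightarrow> ('g \<Rightarrow> rat mat) \<Rightarrow> bool" where
  "is_irred_rep G mul e d \<rho> \<longleftrightarrow> is_rep G mul e d \<rho> \<and> d > 0 \<and>
     (\<forall>W. is_subspace d W \<and> (\<forall>g\<in>G. \<forall>v\<in>W. \<rho> g *\<^sub>v v \<in> W)
          \<longrightarrow> W = {0\<^sub>v d} \<or> W = carrier_vec d)"

definition rep_equiv ::
  "'g set \<Rightarrow> nat \<Rightarrow> ('g \<Rightarrow> rat mat) \<Rightarrow> ('g \<Rightarrow> rat mat) \<Rightarrow> bool" where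
  "rep_equiv G d \<rho> \<sigma> \<longleftrightarrow>
     (\<exists>P \<in> carrier_mat d d. invertible_mat P \<and> (\<forall>g\<in>G. P * \<rho> g = \<sigma> g * P))"

definition num_irred_reps ::
  "'g set \<Rightarrow> ('g \<Rightarrow> 'g \<Rightarrow> 'g) \<Rightarrow> 'g \<Rightarrow> nat \<Rightarrow> nat" where
  "num_irred_reps G mul e d =
     card ({\<rho>. is_irred_rep G mul e d \<rho>} //
           {(\<rho>, \<sigma>). rep_equiv G d \<rho> \<sigma>})"

end

theory Submission
  imports Defs "Jordan_Normal_Form.Determinant" "HOL-Computational_Algebra.Polynomial_Factorial"
    "HOL-Number_Theory.Residues"
begin

text \<open>Let \<open>c = n - s\<close>, so that \<open>p ^ c\<close> exactly divides \<open>r - 1\<close>. On the residues modulo \<open>p ^ l\<close> let \<open>a\<close> act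
  by \<open>k \<mapsto> k + \<alpha>\<close> and \<open>b\<close> by \<open>k \<mapsto> r k + \<beta>\<close>, where \<open>\<alpha>\<close> or \<open>\<beta>\<close> is a unit. The permutation module
  modulo the sums over the orbits of the shift by \<open>p ^ (l - 1)\<close> has dimension \<open>totient (p ^ l)\<close>, and
  it is irreducible: \<open>a\<close> or \<open>b\<close> acts as a cycle of length \<open>p ^ l\<close>, and the cyclotomic polynomial of order
  \<open>p ^ l\<close> is irreducible over the rationals.

  Conversely, let \<open>V\<close> be a nontrivial irreducible representation and \<open>t\<close> minimal such that
  \<open>a ^ (p ^ (c + t))\<close> acts trivially on \<open>V\<close>. Then \<open>a ^ (p ^ t)\<close> and \<open>b ^ (p ^ t)\<close> act centrally, so one acts as a
  power of the other, and this relation singles out one of the models above. An element of the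
  stabilizer of the point \<open>0\<close> of that model either acts trivially on \<open>V\<close>, or is conjugate on \<open>V\<close> to its
  product with a central element of order \<open>p\<close> and so has trace \<open>0\<close>. The sum over the stabilizer
  therefore has nonzero trace, which yields a fixed vector, hence a nonzero homomorphism from the
  model to \<open>V\<close>. The relations also distinguish the models, so it remains to count the relations.\<close>

section \<open>Irreducibility of prime power cyclotomic polynomials\<close>

text \<open>Everything stays over the rationals: traces take the place of characters and splitting
  fields. That one of \<open>a ^ (p ^ t)\<close>, \<open>b ^ (p ^ t)\<close> acts as a power of the
  other rests on a double count: two independent central elements of order \<open>p\<close> would
  make a certain sum of traces both zero and positive. The exponent \<open>t\<close> enters because
  \<open>r\<close> has order \<open>p ^ t\<close> modulo \<open>p ^ (c + t)\<close>, so that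
  \<open>p ^ t\<close>-th powers of the generators commute with everything. No single generator can
  serve as the long cycle in all models. Whichever of the two central elements has the larger order,
  say \<open>p ^ e\<close>, decides whether \<open>a\<close> or \<open>b\<close> becomes the cycle
  of length \<open>p ^ l\<close>, where \<open>l = e + t\<close>. If it is \<open>b\<close>, the map
  \<open>k \<mapsto> r k + 1\<close> is a cycle but not the standard one, hence a renumbering of the
  points by geometric sums. Oddness of \<open>p\<close> makes the sum of the first \<open>y\<close>
  powers of \<open>r\<close> divisible by the same powers of \<open>p\<close> as \<open>y\<close>
  (false for 2 and \<open>r = 3\<close>). This governs the commutators as well as the second
  cycle.\<close>

lemma prime_dvd_add_power_diff:
  fixes x y :: "'a::comm_ring_1"
  assumes "prime p"
  shows "of_nat p dvd (x + y) ^ p - x ^ p - y ^ p"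
proof -
  have p0: "0 < p" using assms prime_gt_0_nat by blast
  have "(x + y) ^ p = (\<Sum>k\<le>p. of_nat (p choose k) * x ^ k * y ^ (p - k))"
    by (rule binomial_ring)
  also have "{..p} = insert 0 (insert p {1..<p})" using p0 by auto
  finally have "(x + y) ^ p - x ^ p - y ^ p = (\<Sum>k=1..<p. of_nat (p choose k) * x ^ k * y ^ (p - k))"
    using p0 by simp
  also have "of_nat p dvd \<dots>"
  proof (rule dvd_sum)
    fix k assume "k \<in> {1..<p}"
    hence "p dvd (p choose k)" using assms p0 dvd_choose_prime[of k p] by auto
    hence "(of_nat p :: 'a) dvd of_nat (p choose k)" by (auto elim!: dvdE)
    thus "(of_nat p :: 'a) dvd of_nat (p choose k) * x ^ k * y ^ (p - k)"
      by (simp add: dvd_mult2)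
  qed
  finally show ?thesis .
qed

text \<open>Modulo \<open>p\<close> the \<open>p\<close>-th power map is additive; iterating it uses
  that \<open>u - v\<close> divides \<open>u ^ p - v ^ p\<close>.\<close>

lemma prime_dvd_add_one_power_diff:
  fixes x :: "'a::comm_ring_1"
  assumes "prime p"
  shows "of_nat p dvd (1 + x) ^ (p ^ k) - (1 + x ^ (p ^ k))"
proof (induction k)
  case 0
  show ?case by simp
next
  case (Suc k)
  let ?u = "(1 + x) ^ (p ^ k)" and ?v = "1 + x ^ (p ^ k)"
  have "?u - ?v dvd ?u ^ p - ?v ^ p" 
    by (metis dvd_triv_left power_diff_sumr2)
  hence "of_nat p dvd ?u ^ p - ?v ^ p" using Suc dvd_trans by blast
  moreover have "of_nat p dvd ?v ^ p - 1 ^ p - (x ^ (p ^ k)) ^ p"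
    by (rule prime_dvd_add_power_diff[OF assms])
  ultimately have "of_nat p dvd (?u ^ p - ?v ^ p) + (?v ^ p - 1 ^ p - (x ^ (p ^ k)) ^ p)"
    by (rule dvd_add)
  thus ?case by (simp add: power_mult[symmetric] mult.commute algebra_simps)
qed

text \<open>Modulo \<open>p\<close> the product starts in the degree where \<open>g\<close> starts,
  because the constant term of \<open>h\<close> is a unit there. All coefficients below the top one
  vanish modulo \<open>p\<close>, so this degree is at least \<open>degree (g * h)\<close>, yet it
  is at most \<open>degree g\<close>.\<close>

lemma eisenstein_aux:
  fixes g h :: "int poly" and p :: int
  assumes p: "prime p" and lc: "\<not> p dvd lead_coeff (g * h)"
    and low: "\<And>i. i < degree (g * h) \<Longrightarrow> p dvd Polynomial.coeff (g * h) i"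
    and h0: "\<not> p dvd Polynomial.coeff h 0"
  shows "degree h = 0"
proof -
  have ne: "g \<noteq> 0" "h \<noteq> 0" using lc by auto
  have "\<not> p dvd lead_coeff g" using lc by (auto simp: lead_coeff_mult)
  define i where "i = (LEAST i. \<not> p dvd Polynomial.coeff g i)"
  have i: "\<not> p dvd Polynomial.coeff g i" unfolding i_def
    by (rule LeastI[of _ "degree g"]) fact
  have ig: "i \<le> degree g" using i by (metis coeff_eq_0 dvd_0_right leI)
  have less: "p dvd Polynomial.coeff g j" if "j < i" for j using not_less_Least[of j] that i_def by auto
  have "Polynomial.coeff (g * h) i = (\<Sum>j\<le>i. Polynomial.coeff g j * Polynomial.coeff h (i - j))" by (rule coeff_mult)
  also have "{..i} = insert i {..<i}" by auto
  finally have eq: "Polynomial.coeff (g * h) i = Polynomial.coeff g i * Polynomial.coeff h 0 + (\<Sum>j<i. Polynomial.coeff g j * Polynomial.coeff h (i - j))"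
    by simp
  have "p dvd (\<Sum>j<i. Polynomial.coeff g j * Polynomial.coeff h (i - j))"
    by (rule dvd_sum) (use less in auto)
  moreover have "\<not> p dvd Polynomial.coeff g i * Polynomial.coeff h 0" using i h0 p by (simp add: prime_dvd_mult_iff)
  ultimately have "\<not> p dvd Polynomial.coeff (g * h) i" unfolding eq by (simp add: dvd_add_left_iff)
  hence "i \<ge> degree (g * h)" using low leI by blast
  thus ?thesis using ig ne by (simp add: degree_mult_eq)
qed

text \<open>If \<open>p\<close> divided both constant terms, \<open>p * p\<close> would divide that
  of the product; so the auxiliary lemma applies to one order of the factors.\<close>

lemma eisenstein:
  fixes g h :: "int poly" and p :: int
  assumes p: "prime p" and lc: "\<not> p dvd lead_coeff (g * h)"
    and low: "\<And>i. i < degree (g * h) \<Longrightarrow> p dvd Polynomial.coeff (g * h) i"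
    and c0: "\<not> p * p dvd Polynomial.coeff (g * h) 0"
  shows "degree g = 0 \<or> degree h = 0"
proof -
  have "\<not> p dvd Polynomial.coeff g 0 \<or> \<not> p dvd Polynomial.coeff h 0"
    using c0 by (auto simp: coeff_mult mult_dvd_mono)
  thus ?thesis
    using eisenstein_aux[of p g h] eisenstein_aux[of p h g] assms by (auto simp: mult.commute)
qed

text \<open>For prime \<open>p\<close> this is the cyclotomic polynomial of order
  \<open>p ^ (k + 1)\<close>; the index is one less than the exponent of the order.\<close>

definition prime_power_cyclotomic :: "nat \<Rightarrow> nat \<Rightarrow> int poly" where
  "prime_power_cyclotomic p k = (\<Sum>i<p. Polynomial.monom 1 (i * p ^ k))"

lemma coeff_prime_power_cyclotomic:
  assumes "p > 0"
  shows "Polynomial.coeff (prime_power_cyclotomic p k) j = (if p ^ k dvd j \<and> j < p * p ^ k then 1 else 0)"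
proof -
  have "Polynomial.coeff (prime_power_cyclotomic p k) j = (\<Sum>i<p. if i * p ^ k = j then 1 else 0)"
    by (simp add: prime_power_cyclotomic_def coeff_sum)
  also have "\<dots> = (\<Sum>i\<in>{i. i < p \<and> i * p ^ k = j}. 1)"
    by (rule sum.mono_neutral_cong_right) auto
  also have "{i. i < p \<and> i * p ^ k = j} = (if p ^ k dvd j \<and> j < p * p ^ k then {j div p ^ k} else {})"
    using assms by auto
  finally show ?thesis by (simp split: if_splits)
qed

lemma degree_prime_power_cyclotomic:
  assumes "p > 0"
  shows "degree (prime_power_cyclotomic p k) = (p - 1) * p ^ k"
proof (rule antisym)
  show "degree (prime_power_cyclotomic p k) \<le> (p - 1) * p ^ k"
  proof (rule degree_le, intro allI impI)
    fix i assume i: "(p - 1) * p ^ k < i"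
    show "Polynomial.coeff (prime_power_cyclotomic p k) i = 0"
    proof (rule ccontr)
      assume "Polynomial.coeff (prime_power_cyclotomic p k) i \<noteq> 0"
      hence "p ^ k dvd i" "i < p * p ^ k" using assms by (auto simp: coeff_prime_power_cyclotomic split: if_splits)
      then obtain j where "i = p ^ k * j" "j < p" using assms by (auto elim!: dvdE)
      moreover from this have "j * p ^ k \<le> (p - 1) * p ^ k" by (intro mult_le_mono1) auto
      ultimately show False using i by (simp add: mult.commute)
    qed
  qed
  show "(p - 1) * p ^ k \<le> degree (prime_power_cyclotomic p k)"
    by (rule le_degree) (use assms in \<open>simp add: coeff_prime_power_cyclotomic\<close>)
qed

text \<open>Eisenstein's criterion applies after substituting \<open>1 + y\<close>. Modulo
  \<open>p\<close>, \<open>(1 + y) ^ (p ^ k) - 1\<close> is \<open>y ^ (p ^ k)\<close>, so the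
  geometric sum identity reads \<open>y ^ (p ^ k) * f = y ^ (p ^ Suc k)\<close> and leaves
  \<open>f = y ^ d\<close>. The constant term counts the \<open>p\<close> summands.\<close>

lemma prime_power_cyclotomic_factors:
  assumes p: "prime p" and fact: "prime_power_cyclotomic p k = g * h"
  shows "degree g = 0 \<or> degree h = 0"
proof -
  have p0: "p > 0" using p prime_gt_0_nat by blast
  define y :: "int poly" where "y = Polynomial.monom 1 1"
  define f where "f = pcompose (prime_power_cyclotomic p k) (1 + y)"
  define d where "d = (p - 1) * p ^ k"
  have y1: "1 + y = [:1, 1:]" by (simp add: y_def monom_altdef one_pCons)
  have f_eq: "f = (\<Sum>i<p. (1 + y) ^ (i * p ^ k))"
  proof -
    have "pcompose (Polynomial.monom 1 j) q = q ^ j" for j and q :: "int poly"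
      by (induction j) (simp_all add: monom_0 monom_Suc pcompose_pCons)
    thus ?thesis by (simp add: f_def prime_power_cyclotomic_def pcompose_sum)
  qed
  have deg: "degree f = d"
    unfolding f_def y1 by (simp add: degree_pcompose degree_prime_power_cyclotomic p0 d_def)
  have lcf: "lead_coeff f = 1"
  proof -
    have "lead_coeff f = lead_coeff (prime_power_cyclotomic p k) * lead_coeff [:1,1:] ^ degree (prime_power_cyclotomic p k)"
      unfolding f_def y1 by (rule lead_coeff_comp) simp
    also have "lead_coeff (prime_power_cyclotomic p k) = 1"
      using p0 by (simp add: degree_prime_power_cyclotomic coeff_prime_power_cyclotomic)
    finally show ?thesis by simp
  qed
  have f0: "Polynomial.coeff f 0 = int p"
    unfolding f_def y1 by (simp add: poly_0_coeff_0[symmetric] poly_pcompose prime_power_cyclotomic_def poly_sum poly_monom)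
  have low: "int p dvd Polynomial.coeff f i" if i: "i < degree f" for i
  proof -
    have g1: "((1 + y) ^ (p ^ k) - 1) * f = (1 + y) ^ (p ^ Suc k) - 1"
    proof -
      have "(1 + y) ^ (p ^ Suc k) - 1 = ((1 + y) ^ (p ^ k)) ^ p - 1"
        by (simp add: power_mult[symmetric] mult.commute)
      also have "\<dots> = ((1 + y) ^ (p ^ k) - 1) * (\<Sum>i<p. ((1 + y) ^ (p ^ k)) ^ i)"
        by (rule power_diff_1_eq)
      finally show ?thesis by (simp add: f_eq power_mult[symmetric] mult.commute)
    qed
    obtain u where u: "(1 + y) ^ (p ^ k) - (1 + y ^ (p ^ k)) = of_nat p * u"
      using prime_dvd_add_one_power_diff[OF p, of y k] by (elim dvdE)
    obtain v where v: "(1 + y) ^ (p ^ Suc k) - (1 + y ^ (p ^ Suc k)) = of_nat p * v"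
      using prime_dvd_add_one_power_diff[OF p, of y "Suc k"] by (elim dvdE)
    have "y ^ (p ^ Suc k) = y ^ (p ^ k) * y ^ d"
      using p0 by (simp add: d_def power_add[symmetric] mult_eq_if)
    hence "y ^ (p ^ k) * (f - y ^ d) = of_nat p * (v - u * f)"
      using g1 u v by (simp add: algebra_simps)
    \<comment> \<open>Multiplication by \<open>y ^ (p ^ k)\<close> only shifts coefficients, and
      below degree \<open>d\<close> the term \<open>y ^ d\<close> is invisible.\<close>
    hence "Polynomial.coeff (y ^ (p ^ k) * (f - y ^ d)) (i + p ^ k) = int p * Polynomial.coeff (v - u * f) (i + p ^ k)"
      by (simp add: of_nat_poly)
    moreover have "Polynomial.coeff (y ^ (p ^ k) * (f - y ^ d)) (i + p ^ k) = Polynomial.coeff f i"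
      using i by (simp add: y_def monom_power coeff_monom_mult deg)
    ultimately show ?thesis by simp
  qed
  have ff: "f = pcompose g (1 + y) * pcompose h (1 + y)"
    unfolding f_def fact by (rule pcompose_mult)
  have "\<not> int p * int p dvd int p" using p p0 
    by (metis dvd_times_left_cancel_iff mult.right_neutral not_prime_unit of_nat_0_less_iff order_less_irrefl prime_nat_int_transfer)
  hence "degree (pcompose g (1 + y)) = 0 \<or> degree (pcompose h (1 + y)) = 0"
    using p low lcf f0 by (intro eisenstein[of "int p"]) (auto simp flip: ff)
  thus ?thesis by (simp add: degree_pcompose y1)
qed

section \<open>Integer polynomials in a rational matrix\<close>

lemma mat_inverse_of_trivial_kernel:
  fixes A :: "'a::field mat"
  assumes A: "A \<in> carrier_mat d d"
    and ker: "\<And>v. v \<in> carrier_vec d \<Longrightarrow> A *\<^sub>v v = 0\<^sub>v d \<Longrightarrow> v = 0\<^sub>v d"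
  obtains B where "B \<in> carrier_mat d d" "A * B = 1\<^sub>m d" "B * A = 1\<^sub>m d"
proof -
  have "det A \<noteq> 0" using det_0_iff_vec_prod_zero_field[OF A] ker by blast
  from det_non_zero_imp_unit[OF A this, of "()"] show ?thesis
    using that by (auto simp: Units_def ring_mat_def)
qed

text \<open>Turns a rational linear dependence into an integer polynomial, to which the
  factorization result over the integers applies.\<close>

lemma common_denominator:
  fixes c :: "nat \<Rightarrow> rat"
  shows "\<exists>N::int. N \<noteq> 0 \<and> (\<forall>j<d. \<exists>z::int. of_int N * c j = of_int z)"
proof (induction d)
  case 0
  show ?case by (rule exI[of _ 1]) simp
next
  case (Suc d)
  then obtain N where N: "N \<noteq> 0" "\<forall>j<d. \<exists>z::int. of_int N * c j = of_int z" by blast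
  obtain a b where ab: "c d = Rat.Fract a b" "b > 0" by (cases "c d") auto
  hence cd: "of_int b * c d = of_int a" by (simp add: Fract_of_int_quotient)
  have "\<exists>z::int. of_int (N * b) * c j = of_int z" if "j < Suc d" for j
  proof (cases "j = d")
    case True
    have "of_int (N * b) * c j = of_int N * (of_int b * c d)" using True by simp
    also have "\<dots> = of_int (N * a)" unfolding cd by simp
    finally show ?thesis by blast
  next
    case False
    hence "j < d" using that by simp
    then obtain z :: int where "of_int N * c j = of_int z" using N by blast
    hence "of_int (N * b) * c j = of_int (z * b)" by (simp add: algebra_simps)
    thus ?thesis by blast
  qed
  thus ?case using N ab by (intro exI[of _ "N * b"]) auto
qed

text \<open>The vector f(X) w, by Horner's scheme. Integer coefficients keep contents and Gauss's
  lemma available.\<close>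

definition poly_orbit :: "nat \<Rightarrow> rat mat \<Rightarrow> rat vec \<Rightarrow> int poly \<Rightarrow> rat vec" where
  "poly_orbit d X w f = fold_coeffs (\<lambda>a v. of_int a \<cdot>\<^sub>v w + X *\<^sub>v v) f (0\<^sub>v d)"

context
  fixes d :: nat and X :: "rat mat" and w :: "rat vec"
  assumes X: "X \<in> carrier_mat d d" and w: "w \<in> carrier_vec d"
begin

lemma poly_orbit_0: "poly_orbit d X w 0 = 0\<^sub>v d"
  by (simp add: poly_orbit_def)

lemma poly_orbit_pCons: "poly_orbit d X w (pCons a f) = of_int a \<cdot>\<^sub>v w + X *\<^sub>v poly_orbit d X w f"
proof (cases "a = 0 \<and> f = 0")
  case True
  have "X *\<^sub>v 0\<^sub>v d = 0\<^sub>v d" using X by auto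
  thus ?thesis using True w by (auto simp: poly_orbit_0)
next
  case False
  thus ?thesis by (auto simp: poly_orbit_def)
qed

lemma poly_orbit_carrier [simp]: "poly_orbit d X w f \<in> carrier_vec d"
  by (induction f) (use X w in \<open>auto simp: poly_orbit_0 poly_orbit_pCons\<close>)

lemma dim_poly_orbit: "dim_vec (poly_orbit d X w f) = d"
  using carrier_vecD[OF poly_orbit_carrier] .

lemma poly_orbit_add: "poly_orbit d X w (f + g) = poly_orbit d X w f + poly_orbit d X w g"
proof (induction f g rule: poly_induct2)
  case 0
  show ?case by (simp add: poly_orbit_0)
next
  case (pCons a f b g)
  have "X *\<^sub>v (poly_orbit d X w f + poly_orbit d X w g) = X *\<^sub>v poly_orbit d X w f + X *\<^sub>v poly_orbit d X w g"
    by (rule mult_add_distrib_mat_vec[OF X]) auto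
  thus ?case using X w
    by (auto simp: poly_orbit_pCons pCons add_smult_distrib_vec intro!: eq_vecI)
qed

lemma poly_orbit_smult: "poly_orbit d X w (smult c f) = of_int c \<cdot>\<^sub>v poly_orbit d X w f"
proof (induction f)
  case 0
  show ?case by (auto simp: poly_orbit_0)
next
  case (pCons a f)
  have "X *\<^sub>v (of_int c \<cdot>\<^sub>v poly_orbit d X w f) = of_int c \<cdot>\<^sub>v (X *\<^sub>v poly_orbit d X w f)"
    by (rule mult_mat_vec[OF X]) auto
  thus ?case using X w
    by (auto simp: poly_orbit_pCons pCons smult_add_distrib_vec[of _ d] smult_smult_assoc)
qed

lemma poly_orbit_mult_eq_0:
  assumes "poly_orbit d X w f = 0\<^sub>v d"
  shows "poly_orbit d X w (g * f) = 0\<^sub>v d"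
proof (induction g)
  case 0
  show ?case by (simp add: poly_orbit_0)
next
  case (pCons a g)
  have "X *\<^sub>v 0\<^sub>v d = 0\<^sub>v d" using X by auto
  thus ?case using assms w
    by (auto simp: poly_orbit_pCons pCons poly_orbit_add poly_orbit_smult)
qed

lemma poly_orbit_monom:
  "poly_orbit d X w (Polynomial.monom c k) = of_int c \<cdot>\<^sub>v (((*\<^sub>v) X ^^ k) w)"
proof (induction k)
  case 0
  have "X *\<^sub>v 0\<^sub>v d = 0\<^sub>v d" using X by auto
  thus ?case using w by (auto simp: monom_0 poly_orbit_pCons poly_orbit_0)
next
  case (Suc k)
  have "((*\<^sub>v) X ^^ k) w \<in> carrier_vec d" by (induction k) (use X w in auto)
  hence "X *\<^sub>v (of_int c \<cdot>\<^sub>v ((*\<^sub>v) X ^^ k) w) = of_int c \<cdot>\<^sub>v (X *\<^sub>v ((*\<^sub>v) X ^^ k) w)"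
    by (rule mult_mat_vec[OF X])
  moreover have "X *\<^sub>v ((*\<^sub>v) X ^^ k) w \<in> carrier_vec d"
    using X \<open>((*\<^sub>v) X ^^ k) w \<in> carrier_vec d\<close> by auto
  moreover have "0 \<cdot>\<^sub>v w = 0\<^sub>v d" using w by auto
  ultimately show ?case by (simp add: monom_Suc poly_orbit_pCons Suc)
qed

lemma poly_orbit_sum:
  assumes "finite A" "i < d"
  shows "poly_orbit d X w (\<Sum>j\<in>A. f j) $ i = (\<Sum>j\<in>A. poly_orbit d X w (f j) $ i)"
  using assms(1)
proof (induction A)
  case empty
  show ?case using assms by (simp add: poly_orbit_0)
next
  case (insert j A)
  thus ?case using assms by (simp add: poly_orbit_add dim_poly_orbit)
qed

text \<open>Take a nonzero annihilator of \<open>w\<close> of least degree and make it primitive.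
  Pseudo-division shows that it divides an integer multiple of the cyclotomic polynomial, and by
  Gauss's lemma the cyclotomic polynomial itself. So it is a constant, which forces \<open>w\<close>
  to be zero, or has degree \<open>d\<close>, which \<open>f\<close> undercuts.\<close>

lemma poly_orbit_eq_0_imp:
  assumes p: "prime p" and d: "d = (p - 1) * p ^ k" and w0: "w \<noteq> 0\<^sub>v d"
    and cyc: "poly_orbit d X w (prime_power_cyclotomic p k) = 0\<^sub>v d"
    and f: "poly_orbit d X w f = 0\<^sub>v d" "degree f < d"
  shows "f = 0"
proof (rule ccontr)
  assume "f \<noteq> 0"
  let ?C = "prime_power_cyclotomic p k"
  define Q where "Q h \<longleftrightarrow> h \<noteq> 0 \<and> poly_orbit d X w h = 0\<^sub>v d" for h
  have "Q f" using \<open>f \<noteq> 0\<close> f by (simp add: Q_def)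
  then obtain h where h: "Q h" and hmin: "\<And>h'. Q h' \<Longrightarrow> degree h \<le> degree h'"
    using ex_has_least_nat[of Q f degree] by auto
  define g where "g = primitive_part h"
  have h0: "h \<noteq> 0" using h by (simp add: Q_def)
  have g0: "g \<noteq> 0" and cg: "content g = 1" and dg: "degree g = degree h"
    using h0 by (auto simp: g_def)
  have pg: "poly_orbit d X w g = 0\<^sub>v d"
  proof -
    have "of_int (content h) \<cdot>\<^sub>v poly_orbit d X w g = 0\<^sub>v d"
      using h by (simp flip: poly_orbit_smult add: g_def Q_def)
    hence "(of_int (content h) \<cdot>\<^sub>v poly_orbit d X w g) $ i = 0" if "i < d" for i using that by simp
    moreover have "dim_vec (poly_orbit d X w g) = d" using poly_orbit_carrier[of g] by auto
    ultimately show ?thesis using h0 by (intro eq_vecI) auto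
  qed
  obtain a q where aq: "a \<noteq> 0" "smult a ?C = g * q + pseudo_mod ?C g"
    using pseudo_mod(1)[OF g0, of ?C] by blast
  have "pseudo_mod ?C g = smult a ?C + (- q) * g" using aq(2) by (simp add: algebra_simps)
  hence "poly_orbit d X w (pseudo_mod ?C g) = of_int a \<cdot>\<^sub>v 0\<^sub>v d + 0\<^sub>v d"
    by (simp only: poly_orbit_add poly_orbit_smult cyc poly_orbit_mult_eq_0[OF pg])
  also have "\<dots> = 0\<^sub>v d" by auto
  finally have "pseudo_mod ?C g = 0"
    using pseudo_mod(2)[OF g0, of ?C] hmin[of "pseudo_mod ?C g"] dg unfolding Q_def
    by (metis leD)
  hence eq: "smult a ?C = g * q" using aq by simp
  hence "g * q = [:a:] * ?C" by simp
  hence "[:a:] dvd g * q" by (rule dvdI)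
  hence "a dvd content (g * q)" by (simp add: const_poly_dvd_iff_dvd_content)
  \<comment> \<open>Gauss's lemma: \<open>g\<close> has content 1, so the factor \<open>a\<close>
    sits in the content of \<open>q\<close> and can be cancelled.\<close>
  hence "a dvd content q" by (simp add: content_mult cg)
  hence "[:a:] dvd q" by (simp add: const_poly_dvd_iff_dvd_content)
  then obtain q' where "q = [:a:] * q'" by (elim dvdE)
  hence "smult a ?C = smult a (g * q')" using eq by simp
  hence Cq: "?C = g * q'" using aq(1) by (metis smult_cancel)
  have p0: "p > 0" using p prime_gt_0_nat by blast
  have "degree g = 0 \<or> degree q' = 0" using prime_power_cyclotomic_factors[OF p Cq] .
  thus False
  proof
    assume "degree g = 0"
    then obtain c where c: "g = [:c:]" by (rule degree_eq_zeroE)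
    have X0: "X *\<^sub>v 0\<^sub>v d = 0\<^sub>v d" using X by auto
    have "of_int c \<cdot>\<^sub>v w = 0\<^sub>v d" using pg w X0 by (simp add: c poly_orbit_pCons poly_orbit_0)
    hence "of_int c * w $ i = 0" if "i < d" for i using that w by (metis carrier_vecD index_smult_vec(1) index_zero_vec(1))
    hence "w = 0\<^sub>v d" using c g0 w by (intro eq_vecI) auto
    thus False using w0 by simp
  next
    assume "degree q' = 0"
    have "q' \<noteq> 0" using Cq degree_prime_power_cyclotomic[OF p0, of k] d f(2) by auto
    hence "degree ?C = degree g" unfolding Cq using g0 \<open>degree q' = 0\<close> by (simp add: degree_mult_eq)
    thus False using degree_prime_power_cyclotomic[OF p0, of k] d dg hmin[OF \<open>Q f\<close>] f(2) by simp
  qed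
qed

end

lemma subspace_mult_mat_vec:
  assumes W: "is_subspace d W" and P: "P \<in> carrier_mat d e" and c: "c \<in> carrier_vec e"
    and cols: "\<And>j. j < e \<Longrightarrow> col P j \<in> W"
  shows "P *\<^sub>v c \<in> W"
proof -
  have "k \<le> e \<Longrightarrow> vec d (\<lambda>i. \<Sum>j<k. P $$ (i, j) * c $ j) \<in> W" for k
  proof (induction k)
    case 0
    have "vec d (\<lambda>i. \<Sum>j<0. P $$ (i, j) * c $ j) = 0\<^sub>v d" by auto
    thus ?case using W by (simp add: is_subspace_def)
  next
    case (Suc k)
    have "vec d (\<lambda>i. \<Sum>j<Suc k. P $$ (i, j) * c $ j)
        = vec d (\<lambda>i. \<Sum>j<k. P $$ (i, j) * c $ j) + c $ k \<cdot>\<^sub>v col P k"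
      using P Suc by (intro eq_vecI) auto
    thus ?case using W Suc cols[of k] by (auto simp: is_subspace_def)
  qed
  moreover have "P *\<^sub>v c = vec d (\<lambda>i. \<Sum>j<e. P $$ (i, j) * c $ j)"
    using P c by (intro eq_vecI) (auto simp: scalar_prod_def lessThan_atLeast0)
  ultimately show ?thesis by simp
qed

text \<open>\<open>rel\<close> states coordinatewise that the cyclotomic polynomial annihilates
  \<open>X\<close>. Hence, for nonzero \<open>w\<close> in \<open>W\<close>, the first
  \<open>d\<close> vectors of the orbit of \<open>w\<close> under \<open>X\<close> satisfy no linear
  relation; being \<open>d\<close> in number, they span the whole space.\<close>

lemma cyclotomic_invariant_subspace:
  assumes p: "prime p" and d: "d = (p - 1) * p ^ k" and X: "X \<in> carrier_mat d d"
    and rel: "\<And>w i. w \<in> carrier_vec d \<Longrightarrow> i < d \<Longrightarrow> (\<Sum>j<p. (((*\<^sub>v) X ^^ (j * p ^ k)) w) $ i) = 0"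
    and W: "is_subspace d W" and inv: "\<And>v. v \<in> W \<Longrightarrow> X *\<^sub>v v \<in> W" and ne: "W \<noteq> {0\<^sub>v d}"
  shows "W = carrier_vec d"
proof -
  obtain w where w: "w \<in> W" "w \<noteq> 0\<^sub>v d" using W ne by (auto simp: is_subspace_def)
  hence wc: "w \<in> carrier_vec d" using W by (auto simp: is_subspace_def)
  define u where "u j = ((*\<^sub>v) X ^^ j) w" for j
  have uW: "u j \<in> W" for j by (induction j) (use w inv in \<open>auto simp: u_def\<close>)
  hence uc: "u j \<in> carrier_vec d" for j using W by (auto simp: is_subspace_def)
  hence ud: "dim_vec (u j) = d" for j by auto
  have cyc: "poly_orbit d X w (prime_power_cyclotomic p k) = 0\<^sub>v d"
  proof (rule eq_vecI)
    fix i assume "i < dim_vec (0\<^sub>v d :: rat vec)"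
    hence i: "i < d" by simp
    have "poly_orbit d X w (prime_power_cyclotomic p k) $ i = (\<Sum>j<p. u (j * p ^ k) $ i)"
      using i by (simp add: prime_power_cyclotomic_def poly_orbit_sum[OF X wc] poly_orbit_monom[OF X wc] u_def)
    thus "poly_orbit d X w (prime_power_cyclotomic p k) $ i = 0\<^sub>v d $ i"
      using rel[OF wc i] i by (simp add: u_def)
  qed (use poly_orbit_carrier[OF X wc] in auto)
  define P where "P = mat d d (\<lambda>(i, j). u j $ i)"
  have P: "P \<in> carrier_mat d d" by (simp add: P_def)
  have "c = 0\<^sub>v d" if c: "c \<in> carrier_vec d" "P *\<^sub>v c = 0\<^sub>v d" for c
  proof -
    obtain N z where N: "N \<noteq> (0::int)" and z: "\<forall>j<d. of_int N * c $ j = of_int (z j :: int)"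
      using common_denominator[of d "\<lambda>j. c $ j"] by metis
    define f where "f = (\<Sum>j<d. Polynomial.monom (z j) j)"
    have cf: "Polynomial.coeff f j = (if j < d then z j else 0)" for j
      by (simp add: f_def coeff_sum)
    have "f = 0"
    proof (cases "d = 0")
      case True
      thus ?thesis by (simp add: f_def)
    next
      case False
      have "degree f \<le> d - 1" by (rule degree_le) (auto simp: cf)
      moreover have "poly_orbit d X w f = 0\<^sub>v d"
      proof (rule eq_vecI)
        fix i assume "i < dim_vec (0\<^sub>v d :: rat vec)"
        hence i: "i < d" by simp
        have "poly_orbit d X w f $ i = (\<Sum>j<d. of_int (z j) * u j $ i)"
          using i ud by (simp add: f_def poly_orbit_sum[OF X wc] poly_orbit_monom[OF X wc] u_def)
        also have "\<dots> = (\<Sum>j<d. of_int N * (u j $ i * c $ j))"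
          by (rule sum.cong) (use z in \<open>auto simp flip: z[rule_format]\<close>)
        also have "\<dots> = of_int N * (P *\<^sub>v c) $ i"
          using i c(1) by (simp add: P_def scalar_prod_def sum_distrib_left lessThan_atLeast0)
        finally show "poly_orbit d X w f $ i = 0\<^sub>v d $ i" using i c(2) by simp
      qed (use poly_orbit_carrier[OF X wc] in auto)
      ultimately show ?thesis using poly_orbit_eq_0_imp[OF X wc p d w(2) cyc] False by simp
    qed
    hence "z j = 0" if "j < d" for j using cf[of j] that by simp
    thus ?thesis using z N c by (intro eq_vecI) auto
  qed
  then obtain B where B: "B \<in> carrier_mat d d" "P * B = 1\<^sub>m d"
    using mat_inverse_of_trivial_kernel[OF P] by metis
  show ?thesis
  proof
    show "W \<subseteq> carrier_vec d" using W by (simp add: is_subspace_def)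
    show "carrier_vec d \<subseteq> W"
    proof
      fix v :: "rat vec" assume v: "v \<in> carrier_vec d"
      have colP: "col P j = u j" if "j < d" for j
        using that ud by (intro eq_vecI) (auto simp: P_def)
      have "P *\<^sub>v (B *\<^sub>v v) \<in> W"
        by (rule subspace_mult_mat_vec[OF W P]) (use B v uW colP in auto)
      thus "v \<in> W" using assoc_mult_mat_vec[OF P B(1) v] B(2) v by simp
    qed
  qed
qed

section \<open>Irreducible rational representations\<close>

definition mat_trace :: "'a::comm_monoid_add mat \<Rightarrow> 'a" where
  "mat_trace A = (\<Sum>i<dim_row A. A $$ (i, i))"

lemma mat_trace_one: "mat_trace (1\<^sub>m d) = of_nat d"
  by (simp add: mat_trace_def)

lemma mat_trace_mult_comm:
  fixes A B :: "'a::comm_semiring_0 mat"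
  assumes "A \<in> carrier_mat m n" "B \<in> carrier_mat n m"
  shows "mat_trace (A * B) = mat_trace (B * A)"
proof -
  have "mat_trace (A * B) = (\<Sum>i<m. \<Sum>j<n. A $$ (i, j) * B $$ (j, i))"
    using assms by (auto simp: mat_trace_def scalar_prod_def lessThan_atLeast0 intro!: sum.cong)
  also have "\<dots> = (\<Sum>j<n. \<Sum>i<m. A $$ (i, j) * B $$ (j, i))" by (rule sum.swap)
  also have "\<dots> = mat_trace (B * A)"
    using assms by (auto simp: mat_trace_def scalar_prod_def lessThan_atLeast0 mult.commute intro!: sum.cong)
  finally show ?thesis .
qed

lemma mat_trace_mult:
  fixes A B :: "'a::comm_semiring_0 mat"
  assumes "A \<in> carrier_mat d d" "B \<in> carrier_mat d d"
  shows "mat_trace (A * B) = (\<Sum>j<d. (A *\<^sub>v col B j) $ j)"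
  using assms by (simp add: mat_trace_def)

lemma mat_eq_by_vec:
  fixes A B :: "'a::semiring_1 mat"
  assumes A: "A \<in> carrier_mat m n" and B: "B \<in> carrier_mat m n"
    and eq: "\<And>v. v \<in> carrier_vec n \<Longrightarrow> A *\<^sub>v v = B *\<^sub>v v"
  shows "A = B"
proof (rule eq_matI)
  fix i j assume ij: "i < dim_row B" "j < dim_col B"
  have "(A *\<^sub>v unit_vec n j) $ i = (B *\<^sub>v unit_vec n j) $ i" using eq[of "unit_vec n j"] by simp
  thus "A $$ (i, j) = B $$ (i, j)" using ij A B by simp
qed (use A B in auto)

locale irred_rep = group G for G (structure) +
  fixes d :: nat and \<rho> :: "'a \<Rightarrow> rat mat"
  assumes finite_carrier: "finite (carrier G)"
    and irred: "is_irred_rep (carrier G) (\<otimes>) \<one> d \<rho>"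
begin

lemma rep_carrier [simp]: "g \<in> carrier G \<Longrightarrow> \<rho> g \<in> carrier_mat d d"
  and rep_one [simp]: "\<rho> \<one> = 1\<^sub>m d"
  and rep_mult: "g \<in> carrier G \<Longrightarrow> h \<in> carrier G \<Longrightarrow> \<rho> (g \<otimes> h) = \<rho> g * \<rho> h"
  and degree_pos: "d > 0"
  using irred by (auto simp: is_irred_rep_def is_rep_def)

lemma rep_dim [simp]: "g \<in> carrier G \<Longrightarrow> dim_row (\<rho> g) = d" "g \<in> carrier G \<Longrightarrow> dim_col (\<rho> g) = d"
  using carrier_matD[OF rep_carrier] by blast+

lemma rep_assoc: 
  "A \<in> carrier_mat d d \<Longrightarrow> B \<in> carrier_mat d d \<Longrightarrow> C \<in> carrier_mat d d \<Longrightarrow> A * B * C = A * (B * C)"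
  for A B C :: "rat mat"
  by (rule assoc_mult_mat)

lemma rep_prod_carrier [simp]:
  "A \<in> carrier_mat d d \<Longrightarrow> B \<in> carrier_mat d d \<Longrightarrow> A * B \<in> carrier_mat d d" for A B :: "rat mat"
  by (rule mult_carrier_mat)

lemma rep_mult_vec:
  "g \<in> carrier G \<Longrightarrow> h \<in> carrier G \<Longrightarrow> v \<in> carrier_vec d \<Longrightarrow> \<rho> (g \<otimes> h) *\<^sub>v v = \<rho> g *\<^sub>v (\<rho> h *\<^sub>v v)"
  by (simp add: rep_mult assoc_mult_mat_vec[of _ d d _ d])

lemma rep_vec_carrier [simp]: "g \<in> carrier G \<Longrightarrow> \<rho> g *\<^sub>v v \<in> carrier_vec d"
  by (rule carrier_vecI) simp

lemma rep_nat_pow_vec: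
  assumes "g \<in> carrier G" "v \<in> carrier_vec d"
  shows "\<rho> (g [^] (k::nat)) *\<^sub>v v = ((*\<^sub>v) (\<rho> g) ^^ k) v"
proof (induction k)
  case 0
  show ?case using assms by simp
next
  case (Suc k)
  have "\<rho> (g [^] Suc k) *\<^sub>v v = \<rho> (g \<otimes> g [^] k) *\<^sub>v v"
    using assms by (metis nat_pow_Suc2)
  also have "\<dots> = \<rho> g *\<^sub>v (\<rho> (g [^] k) *\<^sub>v v)" using assms by (simp add: rep_mult_vec)
  finally show ?case using Suc by simp
qed

lemma invariant_subspace:
  assumes "is_subspace d W" "\<And>g v. g \<in> carrier G \<Longrightarrow> v \<in> W \<Longrightarrow> \<rho> g *\<^sub>v v \<in> W"
  shows "W = {0\<^sub>v d} \<or> W = carrier_vec d"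
  using irred assms unfolding is_irred_rep_def by blast

text \<open>Centrality is imposed on the images only: the powers of \<open>a\<close> and
  \<open>b\<close> used later commute with the group modulo the kernel of \<open>\<rho>\<close>, not
  necessarily in the group itself.\<close>

definition central :: "'a \<Rightarrow> bool" where
  "central z \<longleftrightarrow> z \<in> carrier G \<and> (\<forall>g\<in>carrier G. \<rho> (z \<otimes> g) = \<rho> (g \<otimes> z))"

lemma central_carrier: "central z \<Longrightarrow> z \<in> carrier G"
  by (simp add: central_def)

lemma central_commute: "central z \<Longrightarrow> g \<in> carrier G \<Longrightarrow> \<rho> z * \<rho> g = \<rho> g * \<rho> z"
  using rep_mult by (force simp: central_def)

lemma central_mult: 
  assumes "central y" "central z"
  shows "central (y \<otimes> z)"
  unfolding central_def
proof safe
  note [simp] = central_carrier[OF assms(1)] central_carrier[OF assms(2)]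
  show "y \<otimes> z \<in> carrier G" by simp
  fix g assume g: "g \<in> carrier G"
  have "\<rho> (y \<otimes> z \<otimes> g) = \<rho> y * (\<rho> z * \<rho> g)"
    using assms g by (simp add: rep_mult rep_assoc)
  also have "\<dots> = \<rho> y * (\<rho> g * \<rho> z)" using central_commute[OF assms(2) g] by simp
  also have "\<dots> = (\<rho> y * \<rho> g) * \<rho> z" using assms g by (simp add: rep_assoc)
  also have "\<dots> = (\<rho> g * \<rho> y) * \<rho> z" using central_commute[OF assms(1) g] by simp
  also have "\<dots> = \<rho> (g \<otimes> (y \<otimes> z))" using assms g by (simp add: rep_mult rep_assoc)
  finally show "\<rho> (y \<otimes> z \<otimes> g) = \<rho> (g \<otimes> (y \<otimes> z))" .
qed

lemma central_one: "central \<one>"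
  by (simp add: central_def)

lemma central_nat_pow: "central z \<Longrightarrow> central (z [^] (k::nat))"
  by (induction k) (simp_all add: central_one central_mult)

lemma rep_central_mult_pow:
  assumes "central y" "central z"
  shows "\<rho> ((y \<otimes> z) [^] (k::nat)) = \<rho> (y [^] k \<otimes> z [^] k)"
proof (induction k)
  case 0
  show ?case by simp
next
  case (Suc k)
  note c [simp] = central_carrier[OF assms(1)] central_carrier[OF assms(2)]
  have "\<rho> ((y \<otimes> z) [^] Suc k) = \<rho> (y [^] k) * (\<rho> (z [^] k) * \<rho> y) * \<rho> z"
    using Suc by (simp add: rep_mult rep_assoc)
  also have "\<dots> = \<rho> (y [^] k) * (\<rho> y * \<rho> (z [^] k)) * \<rho> z"
    using central_commute[OF assms(1), of "z [^] k"] by simp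
  also have "\<dots> = \<rho> (y [^] Suc k \<otimes> z [^] Suc k)" by (simp add: rep_mult rep_assoc)
  finally show ?case .
qed

lemma rep_pow_eq_one:
  assumes "g \<in> carrier G" "\<rho> (g [^] (k::nat)) = 1\<^sub>m d"
  shows "\<rho> (g [^] (k * j :: nat)) = 1\<^sub>m d"
proof -
  have "\<rho> ((g [^] k) [^] j) = 1\<^sub>m d"
    using assms by (induction j) (simp_all add: rep_mult)
  thus ?thesis using assms by (simp add: nat_pow_pow)
qed

lemma rep_pow_add: "g \<in> carrier G \<Longrightarrow> \<rho> (g [^] (i + j :: nat)) = \<rho> (g [^] i) * \<rho> (g [^] j)"
  by (simp add: nat_pow_mult[symmetric] rep_mult)

text \<open>The vectors fixed by \<open>z\<close> form an invariant subspace because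
  \<open>z\<close> acts centrally; it is not everything, so it is zero. The sum over the powers of
  \<open>z\<close> is fixed by \<open>z\<close>.\<close>

lemma central_sum_zero:
  assumes z: "central z" and nt: "\<rho> z \<noteq> 1\<^sub>m d" and ord: "\<rho> (z [^] p) = 1\<^sub>m d"
    and v: "v \<in> carrier_vec d" and j: "j < d"
  shows "(\<Sum>i<p. (\<rho> (z [^] (i::nat)) *\<^sub>v v) $ j) = 0"
proof -
  note [simp] = central_carrier[OF z]
  define u where "u = vec d (\<lambda>j. \<Sum>i<p. (\<rho> (z [^] i) *\<^sub>v v) $ j)"
  define W where "W = {u \<in> carrier_vec d. \<rho> z *\<^sub>v u = u}"
  have "is_subspace d W"
    unfolding is_subspace_def W_def 
  proof (intro conjI)
    show "0\<^sub>v d \<in> {u \<in> carrier_vec d. \<rho> z *\<^sub>v u = u}" by auto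
  qed (auto simp: mult_add_distrib_mat_vec[of _ d d] mult_mat_vec[of _ d d])
  moreover have "\<rho> g *\<^sub>v v \<in> W" if "g \<in> carrier G" "v \<in> W" for g v
  proof -
    have vc: "v \<in> carrier_vec d" using that by (simp add: W_def)
    have "\<rho> z *\<^sub>v (\<rho> g *\<^sub>v v) = \<rho> (z \<otimes> g) *\<^sub>v v" using that vc by (simp add: rep_mult_vec)
    also have "\<rho> (z \<otimes> g) = \<rho> (g \<otimes> z)" using z that by (simp add: central_def)
    also have "\<rho> (g \<otimes> z) *\<^sub>v v = \<rho> g *\<^sub>v v" using that vc by (simp add: rep_mult_vec W_def)
    finally show ?thesis using that by (simp add: W_def)
  qed
  ultimately have "W = {0\<^sub>v d} \<or> W = carrier_vec d" by (rule invariant_subspace)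
  moreover have "W \<noteq> carrier_vec d"
  proof
    assume W: "W = carrier_vec d"
    have "\<rho> z = 1\<^sub>m d"
    proof (rule mat_eq_by_vec)
      fix v :: "rat vec" assume v: "v \<in> carrier_vec d"
      hence "v \<in> W" using W by simp
      thus "\<rho> z *\<^sub>v v = 1\<^sub>m d *\<^sub>v v" using v by (simp add: W_def)
    qed auto
    thus False using nt by simp
  qed
  moreover have "u \<in> W"
  proof -
    have "\<rho> z *\<^sub>v u = u"
    proof (rule eq_vecI)
      fix j assume "j < dim_vec u"
      hence j: "j < d" by (simp add: u_def)
      have "(\<rho> z *\<^sub>v u) $ j = (\<Sum>l<d. \<rho> z $$ (j, l) * (\<Sum>i<p. (\<rho> (z [^] i) *\<^sub>v v) $ l))"
        using j by (simp add: u_def scalar_prod_def lessThan_atLeast0)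
      also have "\<dots> = (\<Sum>i<p. \<Sum>l<d. \<rho> z $$ (j, l) * (\<rho> (z [^] i) *\<^sub>v v) $ l)"
        unfolding sum_distrib_left by (rule sum.swap)
      also have "\<dots> = (\<Sum>i<p. (\<rho> z *\<^sub>v (\<rho> (z [^] i) *\<^sub>v v)) $ j)"
        using j by (simp add: scalar_prod_def lessThan_atLeast0)
      also have "\<dots> = (\<Sum>i<p. (\<rho> (z [^] Suc i) *\<^sub>v v) $ j)"
        by (intro sum.cong refl) (simp only: rep_nat_pow_vec[OF central_carrier[OF z] v] funpow.simps o_apply)
      also have "\<dots> = (\<Sum>i<Suc p. (\<rho> (z [^] i) *\<^sub>v v) $ j) - (\<rho> (z [^] (0::nat)) *\<^sub>v v) $ j"
        by (subst sum.lessThan_Suc_shift) simp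
      also have "\<dots> = (\<Sum>i<p. (\<rho> (z [^] i) *\<^sub>v v) $ j)" using ord v by simp
      finally show "(\<rho> z *\<^sub>v u) $ j = u $ j" using j by (simp add: u_def)
    qed (simp add: u_def)
    thus ?thesis by (simp add: W_def u_def)
  qed
  ultimately have "u = 0\<^sub>v d" by auto
  hence "u $ j = 0" using j by simp
  thus ?thesis using j by (simp add: u_def)
qed

lemma trace_sum_zero:
  assumes z: "central z" "\<rho> z \<noteq> 1\<^sub>m d" "\<rho> (z [^] p) = 1\<^sub>m d" and h: "h \<in> carrier G"
  shows "(\<Sum>i<p. mat_trace (\<rho> (z [^] (i::nat) \<otimes> h))) = 0"
proof -
  note [simp] = central_carrier[OF z(1)]
  have "(\<Sum>i<p. mat_trace (\<rho> (z [^] i \<otimes> h))) = (\<Sum>i<p. \<Sum>j<d. (\<rho> (z [^] i) *\<^sub>v col (\<rho> h) j) $ j)"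
    using z h by (simp add: rep_mult mat_trace_mult[of _ d])
  also have "\<dots> = (\<Sum>j<d. \<Sum>i<p. (\<rho> (z [^] i) *\<^sub>v col (\<rho> h) j) $ j)" by (rule sum.swap)
  also have "\<dots> = 0"
    by (intro sum.neutral ballI central_sum_zero[OF z]) (use h in \<open>auto intro!: col_carrier_vec\<close>)
  finally show ?thesis .
qed

text \<open>The element \<open>g\<close> is conjugate to \<open>z g\<close>, hence to all \<open>z\<^sup>i g\<close>, whose traces add up to zero.\<close>

lemma trace_eq_zero:
  assumes z: "central z" "\<rho> z \<noteq> 1\<^sub>m d" "\<rho> (z [^] p) = 1\<^sub>m d" and p: "(p::nat) > 0"
    and g: "g \<in> carrier G" and x: "x \<in> carrier G" and conj: "\<rho> (x \<otimes> g) = \<rho> (z \<otimes> g \<otimes> x)"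
  shows "mat_trace (\<rho> g) = 0"
proof -
  note [simp] = central_carrier[OF z(1)] g x
  have "mat_trace (\<rho> (z [^] i \<otimes> g)) = mat_trace (\<rho> g)" for i :: nat
  proof (induction i)
    case 0
    show ?case by simp
  next
    case (Suc i)
    have "\<rho> (z [^] Suc i \<otimes> g) = \<rho> (z [^] i \<otimes> (z \<otimes> g \<otimes> x) \<otimes> inv x)"
      by (simp add: m_assoc)
    also have "\<dots> = \<rho> (z [^] i) * \<rho> (z \<otimes> g \<otimes> x) * \<rho> (inv x)" by (simp only: rep_mult m_closed nat_pow_closed g x inv_closed central_carrier[OF z(1)])
    also have "\<dots> = \<rho> (z [^] i) * \<rho> x * \<rho> g * \<rho> (inv x)" by (simp add: conj[symmetric] rep_mult rep_assoc)
    also have "\<rho> (z [^] i) * \<rho> x = \<rho> x * \<rho> (z [^] i)"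
      by (rule central_commute[OF central_nat_pow[OF z(1)] x])
    finally have "mat_trace (\<rho> (z [^] Suc i \<otimes> g)) = mat_trace ((\<rho> x * \<rho> (z [^] i \<otimes> g)) * \<rho> (inv x))"
      by (simp add: rep_mult rep_assoc)
    also have "\<dots> = mat_trace (\<rho> (inv x) * (\<rho> x * \<rho> (z [^] i \<otimes> g)))"
      by (rule mat_trace_mult_comm[of _ d d]) auto
    also have "\<rho> (inv x) * (\<rho> x * \<rho> (z [^] i \<otimes> g)) = (\<rho> (inv x) * \<rho> x) * \<rho> (z [^] i \<otimes> g)"
      by (rule rep_assoc[symmetric]) auto
    also have "\<rho> (inv x) * \<rho> x = 1\<^sub>m d" using rep_mult[of "inv x" x] by simp
    finally show ?case using Suc by (simp add: left_mult_one_mat[of _ d d])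
  qed
  hence "(\<Sum>i<p. mat_trace (\<rho> g)) = 0" using trace_sum_zero[OF z g] by simp
  thus ?thesis using p by simp
qed

lemma order_prime_powers_nontrivial:
  assumes p: "prime p" and g: "g \<in> carrier G" and nt: "\<rho> g \<noteq> 1\<^sub>m d" and ord: "\<rho> (g [^] p) = 1\<^sub>m d"
    and j: "\<not> p dvd j"
  shows "\<rho> (g [^] (j::nat)) \<noteq> 1\<^sub>m d"
proof
  assume eq: "\<rho> (g [^] j) = 1\<^sub>m d"
  have "coprime j p" using j p by (metis coprime_commute prime_imp_coprime)
  then obtain x y where "j * x = p * y + 1" 
    using coprime_bezout_strong[of j p] p prime_gt_1_nat by (metis less_numeral_extra(4))
  hence "\<rho> (g [^] (p * y + 1)) = 1\<^sub>m d" using rep_pow_eq_one[OF g eq, of x] by simp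
  moreover have "\<rho> (g [^] (p * y + 1)) = \<rho> (g [^] (p * y)) * \<rho> (g [^] (1::nat))"
    by (rule rep_pow_add[OF g])
  ultimately have "\<rho> g = 1\<^sub>m d" using rep_pow_eq_one[OF g ord, of y] g by simp
  thus False using nt by simp
qed

text \<open>Otherwise sum the traces of \<open>y ^ j * z ^ (i * j)\<close> over all \<open>i\<close>
  and \<open>j\<close> below \<open>p\<close> in two ways. For fixed \<open>i\<close> these are the
  powers of a nontrivial central element of order \<open>p\<close>, so the sum is 0. For fixed
  \<open>j\<close> other than 0 it is 0 as well, since \<open>z ^ j\<close> is nontrivial, while
  \<open>j = 0\<close> contributes \<open>p * d\<close>.\<close>

lemma central_order_prime:
  assumes p: "prime (p::nat)" and y: "central y" and z: "central z"
    and ordy: "\<rho> (y [^] p) = 1\<^sub>m d" and ordz: "\<rho> (z [^] p) = 1\<^sub>m d" and nt: "\<rho> z \<noteq> 1\<^sub>m d"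
  shows "\<exists>i::nat. \<rho> (y \<otimes> z [^] i) = 1\<^sub>m d"
proof (rule ccontr)
  assume "\<nexists>i::nat. \<rho> (y \<otimes> z [^] i) = 1\<^sub>m d"
  hence ne: "\<rho> (y \<otimes> z [^] i) \<noteq> 1\<^sub>m d" for i :: nat by blast
  note [simp] = central_carrier[OF y] central_carrier[OF z]
  have p0: "p > 0" using p prime_gt_0_nat by blast
  have inner: "(\<Sum>i<p. mat_trace (\<rho> (y [^] j \<otimes> z [^] (i * j)))) = 0" if "j \<noteq> 0" "j < p" for j :: nat
  proof -
    have "\<rho> (z [^] j) \<noteq> 1\<^sub>m d"
      using that by (intro order_prime_powers_nontrivial[OF p _ nt ordz]) (auto dest: dvd_imp_le)
    moreover have "\<rho> ((z [^] j) [^] p) = 1\<^sub>m d"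
      using rep_pow_eq_one[OF _ ordz, of j] by (simp add: nat_pow_pow mult.commute)
    ultimately have "(\<Sum>i<p. mat_trace (\<rho> ((z [^] j) [^] (i::nat) \<otimes> y [^] j))) = 0"
      by (intro trace_sum_zero central_nat_pow z) auto
    moreover have "\<rho> ((z [^] j) [^] (i::nat) \<otimes> y [^] j) = \<rho> (y [^] j \<otimes> z [^] (i * j))" for i
      using central_nat_pow[OF z, of "i * j"] by (auto simp: central_def nat_pow_pow mult.commute)
    ultimately show ?thesis by simp
  qed
  have outer: "(\<Sum>j<p. mat_trace (\<rho> (y [^] j \<otimes> z [^] (i * j)))) = 0" for i :: nat
  proof -
    have c: "central (y \<otimes> z [^] i)" by (intro central_mult y central_nat_pow z)
    have pw: "\<rho> ((y \<otimes> z [^] i) [^] (j::nat)) = \<rho> (y [^] j \<otimes> z [^] (i * j))" for j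
      using rep_central_mult_pow[OF y central_nat_pow[OF z]] by (simp add: nat_pow_pow)
    have "\<rho> ((y \<otimes> z [^] i) [^] p) = 1\<^sub>m d"
      unfolding pw using ordy rep_pow_eq_one[OF _ ordz, of i] by (simp add: rep_mult mult.commute)
    from trace_sum_zero[OF c ne this one_closed] show ?thesis
      by (simp add: pw)
  qed
  have "0 = (\<Sum>i<p. \<Sum>j<p. mat_trace (\<rho> (y [^] j \<otimes> z [^] (i * j))))" by (simp only: outer sum.neutral_const)
  also have "\<dots> = (\<Sum>j<p. \<Sum>i<p. mat_trace (\<rho> (y [^] j \<otimes> z [^] (i * j))))" by (rule sum.swap)
  also have "\<dots> = (\<Sum>j\<in>{0}. \<Sum>i<p. mat_trace (\<rho> (y [^] j \<otimes> z [^] (i * j))))"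
    using inner p0 by (intro sum.mono_neutral_right) auto
  also have "\<dots> = of_nat p * of_nat d" by (simp add: mat_trace_one)
  finally show False using p0 degree_pos by simp
qed

text \<open>Induction on the exponent of the order of \<open>y\<close>. If it is
  \<open>Suc f\<close>, the power \<open>y ^ (p ^ f)\<close> has order at most \<open>p\<close> and
  is cancelled by a power of \<open>z ^ (p ^ (e - 1))\<close>. A \<open>p ^ f\<close>-th root of the
  latter exists among the powers of \<open>z\<close>, and multiplying \<open>y\<close> by it lowers
  the exponent to \<open>f\<close>.\<close>

lemma central_cyclic:
  assumes p: "prime (p::nat)" and y: "central y" and z: "central z"
    and ordy: "\<rho> (y [^] (p ^ e)) = 1\<^sub>m d" and ordz: "\<rho> (z [^] (p ^ e)) = 1\<^sub>m d"
    and nt: "e > 0 \<Longrightarrow> \<rho> (z [^] (p ^ (e - 1))) \<noteq> 1\<^sub>m d"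
  shows "\<exists>l::nat. \<rho> y = \<rho> (z [^] l)"
proof -
  note [simp] = central_carrier[OF z]
  have "\<lbrakk>f \<le> e; central y; \<rho> (y [^] (p ^ f)) = 1\<^sub>m d\<rbrakk> \<Longrightarrow> \<exists>l::nat. \<rho> y = \<rho> (z [^] l)" for f y
  proof (induction f arbitrary: y)
    case 0
    thus ?case using central_carrier[OF 0(2)] by (intro exI[of _ 0]) simp
  next
    case (Suc f)
    note [simp] = central_carrier[OF Suc.prems(2)]
    \<comment> \<open>With this exponent \<open>z ^ (p ^ k)\<close> is a \<open>p ^ f\<close>-th
      root of \<open>z ^ (p ^ (e - 1))\<close>.\<close>
    define k where "k = e - 1 - f"
    have k: "p ^ k * p ^ f = p ^ (e - 1)" using Suc.prems(1) by (simp add: k_def power_add[symmetric])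
    have "\<exists>i::nat. \<rho> (y [^] (p ^ f) \<otimes> (z [^] (p ^ (e - 1))) [^] i) = 1\<^sub>m d"
    proof (rule central_order_prime[OF p])
      show "\<rho> ((y [^] (p ^ f)) [^] p) = 1\<^sub>m d"
        using Suc.prems by (simp add: nat_pow_pow mult.commute)
      show "\<rho> ((z [^] (p ^ (e - 1))) [^] p) = 1\<^sub>m d"
        using ordz Suc.prems(1) by (simp add: nat_pow_pow flip: power_Suc2)
    qed (use nt Suc.prems z central_nat_pow in auto)
    then obtain i :: nat where i: "\<rho> (y [^] (p ^ f) \<otimes> (z [^] (p ^ (e - 1))) [^] i) = 1\<^sub>m d" by blast
    define y' where "y' = y \<otimes> z [^] (i * p ^ k)"
    have cy': "central y'" unfolding y'_def by (intro central_mult Suc.prems central_nat_pow z)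
    have "\<rho> (y' [^] (p ^ f)) = \<rho> (y [^] (p ^ f) \<otimes> (z [^] (i * p ^ k)) [^] (p ^ f))"
      unfolding y'_def by (rule rep_central_mult_pow[OF Suc.prems(2) central_nat_pow[OF z]])
    also have "(z [^] (i * p ^ k)) [^] (p ^ f) = (z [^] (p ^ (e - 1))) [^] i"
    proof -
      have "i * p ^ k * p ^ f = p ^ (e - 1) * i" by (simp only: k[symmetric] mult_ac)
      thus ?thesis by (simp only: nat_pow_pow central_carrier[OF z])
    qed
    finally have "\<rho> (y' [^] (p ^ f)) = 1\<^sub>m d" using i by simp
    with Suc.IH[of y'] cy' Suc.prems(1) obtain l :: nat where l: "\<rho> y' = \<rho> (z [^] l)" by auto
    \<comment> \<open>\<open>z ^ k'\<close> acts as the inverse of \<open>z ^ (i * p ^ k)\<close>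
      with a natural exponent: the two exponents add up to a multiple of
      \<open>p ^ e\<close>.\<close>
    define k' where "k' = i * p ^ k * (p ^ e - 1)"
    have kk: "i * p ^ k + k' = p ^ e * (i * p ^ k)"
    proof -
      have "p ^ e \<noteq> 0" using p prime_gt_0_nat by simp
      then obtain N where "p ^ e = Suc N" using not0_implies_Suc by blast
      thus ?thesis unfolding k'_def by simp
    qed
    have "\<rho> y = \<rho> y * \<rho> (z [^] (i * p ^ k + k'))"
      unfolding kk using rep_pow_eq_one[OF _ ordz] Suc.prems by simp
    also have "\<dots> = \<rho> y' * \<rho> (z [^] k')"
      by (simp add: y'_def rep_mult rep_pow_add rep_assoc)
    also have "\<dots> = \<rho> (z [^] (l + k'))" using l by (simp add: rep_pow_add)
    finally show ?case by blast
  qed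
  from this[OF order_refl y ordy] show ?thesis .
qed

text \<open>The sum \<open>E\<close> of all \<open>\<rho> h\<close> has positive trace, since the
  unit contributes \<open>d\<close> and no element contributes a negative value. Left multiplication
  permutes \<open>H\<close>, so every column of \<open>E\<close> is fixed, and some column is
  nonzero.\<close>

lemma fixed_vector:
  assumes H: "H \<subseteq> carrier G" "\<one> \<in> H" "\<And>g h. g \<in> H \<Longrightarrow> h \<in> H \<Longrightarrow> g \<otimes> h \<in> H"
    and tr: "\<And>h. h \<in> H \<Longrightarrow> \<rho> h = 1\<^sub>m d \<or> mat_trace (\<rho> h) = 0"
  obtains w where "w \<in> carrier_vec d" "w \<noteq> 0\<^sub>v d" "\<And>h. h \<in> H \<Longrightarrow> \<rho> h *\<^sub>v w = w"
proof -
  have fin: "finite H" using H finite_carrier finite_subset by blast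
  define E where "E = mat d d (\<lambda>(i, j). \<Sum>h\<in>H. \<rho> h $$ (i, j))"
  have E: "E \<in> carrier_mat d d" by (simp add: E_def)
  have "mat_trace E = (\<Sum>i<d. \<Sum>h\<in>H. \<rho> h $$ (i, i))" by (simp add: mat_trace_def E_def)
  also have "\<dots> = (\<Sum>h\<in>H. \<Sum>i<d. \<rho> h $$ (i, i))" by (rule sum.swap)
  also have "\<dots> = (\<Sum>h\<in>H. mat_trace (\<rho> h))"
    using H by (intro sum.cong) (auto simp: mat_trace_def)
  also have "\<dots> > 0"
  proof (rule sum_pos2[OF fin H(2)])
    show "0 < mat_trace (\<rho> \<one>)" using degree_pos by (simp add: mat_trace_one)
    show "0 \<le> mat_trace (\<rho> h)" if "h \<in> H" for h using tr[OF that] by (auto simp: mat_trace_one)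
  qed
  finally have "mat_trace E > 0" .
  hence "(\<Sum>j<d. E $$ (j, j)) \<noteq> 0" using E by (simp add: mat_trace_def)
  then obtain j where j: "j < d" "E $$ (j, j) \<noteq> 0" by (meson lessThan_iff sum.neutral)
  have avg: "\<rho> h * E = E" if h: "h \<in> H" for h
  proof (rule eq_matI)
    have hc: "h \<in> carrier G" using h H by auto
    have bij: "bij_betw ((\<otimes>) h) H H"
      unfolding bij_betw_def
    proof
      show inj: "inj_on ((\<otimes>) h) H" using H hc by (metis inj_on_cmult inj_on_subset)
      show "(\<otimes>) h ` H = H" using H(3)[OF h] by (intro endo_inj_surj[OF fin _ inj]) blast
    qed
    fix i j assume ij: "i < dim_row E" "j < dim_col E"
    hence ij: "i < d" "j < d" by (auto simp: E_def)
    have "(\<rho> h * E) $$ (i, j) = (\<Sum>l<d. \<rho> h $$ (i, l) * (\<Sum>g\<in>H. \<rho> g $$ (l, j)))"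
      using ij hc by (simp add: E_def scalar_prod_def lessThan_atLeast0)
    also have "\<dots> = (\<Sum>g\<in>H. \<Sum>l<d. \<rho> h $$ (i, l) * \<rho> g $$ (l, j))"
      unfolding sum_distrib_left by (rule sum.swap)
    also have "\<dots> = (\<Sum>g\<in>H. \<rho> (h \<otimes> g) $$ (i, j))"
    proof (rule sum.cong)
      fix g assume "g \<in> H"
      hence "g \<in> carrier G" using H by auto
      thus "(\<Sum>l<d. \<rho> h $$ (i, l) * \<rho> g $$ (l, j)) = \<rho> (h \<otimes> g) $$ (i, j)"
        using ij hc by (simp add: rep_mult scalar_prod_def lessThan_atLeast0)
    qed simp
    also have "\<dots> = (\<Sum>g\<in>H. \<rho> g $$ (i, j))"
      by (rule sum.reindex_bij_betw[OF bij])
    finally show "(\<rho> h * E) $$ (i, j) = E $$ (i, j)" using ij by (simp add: E_def)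
  qed (use subsetD[OF H(1) h] E in simp_all)
  show ?thesis
  proof (rule that[of "col E j"])
    show "col E j \<in> carrier_vec d" using E by auto
    show "col E j \<noteq> 0\<^sub>v d"
    proof
      assume "col E j = 0\<^sub>v d"
      hence "col E j $ j = 0" using j by simp
      thus False using j E by simp
    qed
    show "\<rho> h *\<^sub>v col E j = col E j" if h: "h \<in> H" for h
    proof -
      have "\<rho> h *\<^sub>v col E j = col (\<rho> h * E) j"
        using h H j E by (subst col_mult2[of _ d d _ d]) auto
      thus ?thesis using avg[OF h] by simp
    qed
  qed
qed

end

text \<open>Kernel and image of \<open>P\<close> are invariant, so \<open>P\<close> is
  bijective.\<close>

lemma schur:
  assumes "irred_rep G d \<rho>" "irred_rep G e \<sigma>"
    and P: "P \<in> carrier_mat e d" and comm: "\<And>g. g \<in> carrier G \<Longrightarrow> P * \<rho> g = \<sigma> g * P"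
    and P0: "P \<noteq> 0\<^sub>m e d"
  shows "d = e \<and> rep_equiv (carrier G) d \<rho> \<sigma>"
proof -
  interpret r: irred_rep G d \<rho> by fact
  interpret s: irred_rep G e \<sigma> by fact
  define K where "K = {v \<in> carrier_vec d. P *\<^sub>v v = 0\<^sub>v e}"
  define I where "I = {P *\<^sub>v v |v. v \<in> carrier_vec d}"
  have comm_vec: "P *\<^sub>v (\<rho> g *\<^sub>v v) = \<sigma> g *\<^sub>v (P *\<^sub>v v)" if "g \<in> carrier G" "v \<in> carrier_vec d" for g v
    using comm[OF that(1)] that P
    by (metis assoc_mult_mat_vec r.rep_carrier s.rep_carrier)
  have P_zero: "P *\<^sub>v 0\<^sub>v d = 0\<^sub>v e" using P by auto
  have K: "K = {0\<^sub>v d} \<or> K = carrier_vec d"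
  proof (rule r.invariant_subspace)
    show "is_subspace d K" unfolding is_subspace_def K_def
      using P P_zero by (auto simp: mult_add_distrib_mat_vec[of _ e d] mult_mat_vec[of _ e d])
    show "\<rho> g *\<^sub>v v \<in> K" if "g \<in> carrier G" "v \<in> K" for g v
    proof -
      have "\<sigma> g *\<^sub>v 0\<^sub>v e = 0\<^sub>v e" using that by auto
      thus ?thesis using that by (simp add: K_def comm_vec)
    qed
  qed
  have "K \<noteq> carrier_vec d"
  proof
    assume "K = carrier_vec d"
    hence "P *\<^sub>v v = 0\<^sub>v e" if "v \<in> carrier_vec d" for v using that unfolding K_def by blast
    moreover have "0\<^sub>m e d *\<^sub>v v = 0\<^sub>v e" if "v \<in> carrier_vec d" for v :: "rat vec"
      using that by (intro eq_vecI) auto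
    ultimately have "P = 0\<^sub>m e d" by (intro mat_eq_by_vec[OF P]) auto
    thus False using P0 by simp
  qed
  with K have K0: "K = {0\<^sub>v d}" by blast
  have I: "I = {0\<^sub>v e} \<or> I = carrier_vec e"
  proof (rule s.invariant_subspace)
    show "is_subspace e I" unfolding is_subspace_def
    proof (intro conjI ballI allI)
      show "I \<subseteq> carrier_vec e" using P by (auto simp: I_def)
      show "0\<^sub>v e \<in> I" using P_zero by (auto simp: I_def intro!: exI[of _ "0\<^sub>v d"])
      fix v assume "v \<in> I"
      then obtain v' where v': "v = P *\<^sub>v v'" "v' \<in> carrier_vec d" by (auto simp: I_def)
      show "c \<cdot>\<^sub>v v \<in> I" for c
        using v' mult_mat_vec[OF P v'(2), of c] by (auto simp: I_def intro!: exI[of _ "c \<cdot>\<^sub>v v'"])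
      fix w assume "w \<in> I"
      then obtain w' where w': "w = P *\<^sub>v w'" "w' \<in> carrier_vec d" by (auto simp: I_def)
      show "v + w \<in> I"
        using v' w' mult_add_distrib_mat_vec[OF P v'(2) w'(2)] by (auto simp: I_def intro!: exI[of _ "v' + w'"])
    qed
    show "\<sigma> g *\<^sub>v v \<in> I" if "g \<in> carrier G" "v \<in> I" for g v
      using that comm_vec[OF that(1), symmetric] by (auto simp: I_def)
  qed
  have "I \<noteq> {0\<^sub>v e}"
  proof
    assume "I = {0\<^sub>v e}"
    hence "K = carrier_vec d" by (auto simp: I_def K_def)
    thus False using \<open>K \<noteq> carrier_vec d\<close> by simp
  qed
  with I have Iall: "I = carrier_vec e" by blast
  have "\<exists>v. v \<in> carrier_vec d \<and> P *\<^sub>v v = unit_vec e j" for j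
  proof -
    have "unit_vec e j \<in> I" using Iall by simp
    thus ?thesis by (auto simp: I_def)
  qed
  then obtain q where q: "\<And>j. q j \<in> carrier_vec d" "\<And>j. P *\<^sub>v q j = unit_vec e j" by metis
  define Q where "Q = mat d e (\<lambda>(i, j). q j $ i)"
  have Q: "Q \<in> carrier_mat d e" by (simp add: Q_def)
  have colQ: "col Q j = q j" if "j < e" for j
    using that q(1)[of j] by (intro eq_vecI) (auto simp: Q_def)
  have PQ: "P * Q = 1\<^sub>m e"
  proof (rule mat_col_eqI)
    fix j assume "j < dim_col (1\<^sub>m e :: rat mat)"
    hence j: "j < e" by simp
    show "col (P * Q) j = col (1\<^sub>m e) j"
      using j by (subst col_mult2[OF P Q j]) (simp add: colQ q)
  qed (use P Q in auto)
  have QP: "Q * P = 1\<^sub>m d"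
  proof (rule mat_eq_by_vec)
    fix v :: "rat vec" assume v: "v \<in> carrier_vec d"
    have Pv: "P *\<^sub>v v \<in> carrier_vec e" using P v by auto
    have QPv: "Q *\<^sub>v (P *\<^sub>v v) \<in> carrier_vec d" using Q Pv by auto
    have "P *\<^sub>v (Q *\<^sub>v (P *\<^sub>v v)) = P *\<^sub>v v"
      using assoc_mult_mat_vec[OF P Q Pv] PQ Pv by simp
    hence "P *\<^sub>v (Q *\<^sub>v (P *\<^sub>v v) - v) = 0\<^sub>v e"
      using mult_minus_distrib_mat_vec[OF P QPv v] Pv by simp
    hence "Q *\<^sub>v (P *\<^sub>v v) - v \<in> K" using QPv v by (auto simp: K_def)
    hence eq: "Q *\<^sub>v (P *\<^sub>v v) - v = 0\<^sub>v d" using K0 by simp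
    have "Q *\<^sub>v (P *\<^sub>v v) = v"
    proof (rule eq_vecI)
      fix i assume i: "i < dim_vec v"
      have "(Q *\<^sub>v (P *\<^sub>v v) - v) $ i = 0" using eq i v by simp
      thus "(Q *\<^sub>v (P *\<^sub>v v)) $ i = v $ i" using i by simp
    qed (use Q v in auto)
    thus "Q * P *\<^sub>v v = 1\<^sub>m d *\<^sub>v v" using assoc_mult_mat_vec[OF Q P v] v by simp
  qed (use P Q in auto)
  \<comment> \<open>The degrees agree because \<open>P * Q\<close> and \<open>Q * P\<close> have the
    same trace and both are identity matrices.\<close>
  have "(of_nat d :: rat) = of_nat e"
    using mat_trace_mult_comm[OF P Q] unfolding PQ QP by (simp add: mat_trace_one)
  hence de: "d = e" by simp
  have "invertible_mat P"
    unfolding invertible_mat_def inverts_mat_def square_mat.simps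
    by (intro conjI exI[of _ Q]) (simp_all only: carrier_matD[OF P] carrier_matD[OF Q] PQ QP de)
  hence "rep_equiv (carrier G) d \<rho> \<sigma>"
    unfolding rep_equiv_def using P comm de by blast
  thus ?thesis using de by blast
qed

section \<open>Representations from actions with a cyclic shift\<close>

text \<open>\<open>act_shift\<close> makes the orbits of the shift by \<open>p ^ (l - 1)\<close> a
  system of blocks, so that the group acts on the quotient by the block sums; \<open>act_g0\<close>
  provides the cycle to which the cyclotomic polynomial is applied.\<close>

locale cyclic_action = group G for G (structure) +
  fixes p l :: nat and act :: "'a \<Rightarrow> nat \<Rightarrow> nat" and g0 :: 'a
  assumes finite_carrier: "finite (carrier G)" and p: "prime p" and l: "l > 0" 
    and g0 [simp]: "g0 \<in> carrier G"
    and act_less: "g \<in> carrier G \<Longrightarrow> k < p ^ l \<Longrightarrow> act g k < p ^ l"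
    and act_one: "k < p ^ l \<Longrightarrow> act \<one> k = k"
    and act_mult: "g \<in> carrier G \<Longrightarrow> h \<in> carrier G \<Longrightarrow> k < p ^ l \<Longrightarrow> act (g \<otimes> h) k = act g (act h k)"
    and act_shift: "g \<in> carrier G \<Longrightarrow> k < p ^ l \<Longrightarrow>
      act g ((k + p ^ (l - 1)) mod p ^ l) = (act g k + p ^ (l - 1)) mod p ^ l"
    and act_g0: "k < p ^ l \<Longrightarrow> act g0 k = (k + 1) mod p ^ l"
begin

text \<open>There are \<open>q'\<close> blocks, the residue classes modulo \<open>q'\<close>, each
  of size \<open>p\<close>; one relation per block leaves dimension \<open>d\<close>.\<close>

definition q' :: nat where "q' = p ^ (l - 1)"
definition d :: nat where "d = (p - 1) * q'"

lemma p_gt_1: "p > 1" using p by (rule prime_gt_1_nat)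
lemma q'_pos: "q' > 0" using p_gt_1 by (simp add: q'_def)
lemma q_eq: "p ^ l = p * q'" using l by (simp add: q'_def power_eq_if)
lemma d_add: "d + q' = p ^ l" using p_gt_1 by (simp add: d_def q_eq mult_eq_if)
lemma q'_le_d: "q' \<le> d"
proof -
  have "1 * q' \<le> (p - 1) * q'" using p_gt_1 by (intro mult_le_mono1) simp
  thus ?thesis by (simp add: d_def)
qed

text \<open>The images of the points in the quotient of the permutation module by the sums over the
  orbits of the shift by \<open>p ^ (l - 1)\<close>; the first \<open>d\<close> of them form a basis.\<close>

definition pvec :: "nat \<Rightarrow> rat vec" where
  "pvec k = vec d (\<lambda>i. (if i = k then 1 else 0) - (if d \<le> k \<and> i mod q' = k mod q' then 1 else 0))"

definition mrep :: "'a \<Rightarrow> rat mat" where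
  "mrep g = mat d d (\<lambda>(i, j). pvec (act g j) $ i)"

lemma pvec_carrier [simp]: "pvec k \<in> carrier_vec d" and dim_pvec [simp]: "dim_vec (pvec k) = d"
  by (simp_all add: pvec_def)

lemma mrep_carrier [simp]: "mrep g \<in> carrier_mat d d"
  by (simp add: mrep_def)

lemma pvec_unit: "k < d \<Longrightarrow> pvec k = unit_vec d k"
  by (auto simp: pvec_def)

lemma block_less: "c < q' \<Longrightarrow> j < p \<Longrightarrow> c + j * q' < p ^ l"
proof -
  assume c: "c < q'" and j: "j < p"
  have "c + j * q' < Suc j * q'" using c by simp
  also have "\<dots> \<le> p ^ l" unfolding q_eq using j by (intro mult_le_mono1) auto
  finally show "c + j * q' < p ^ l" .
qed

lemma block_div_mod: "c < q' \<Longrightarrow> (c + j * q') mod q' = c" "c < q' \<Longrightarrow> (c + j * q') div q' = j"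
  using q'_pos by auto

lemma sum_residue_class:
  assumes c: "c < q'"
  shows "(\<Sum>j<d. if j mod q' = c then f j else 0) = (\<Sum>j<p - 1. f (c + j * q') :: rat)"
proof -
  have "(\<Sum>j<d. if j mod q' = c then f j else 0) = (\<Sum>j\<in>{j. j < d \<and> j mod q' = c}. f j)"
    by (rule sum.mono_neutral_cong_right) auto
  also have "\<dots> = (\<Sum>j<p - 1. f (c + j * q'))"
  proof (rule sum.reindex_bij_witness[of _ "\<lambda>j. c + j * q'" "\<lambda>j. j div q'"])
    fix j assume j: "j \<in> {j. j < d \<and> j mod q' = c}"
    show "c + j div q' * q' = j" using j mod_div_mult_eq[of j q'] by simp
    thus "f (c + j div q' * q') = f j" by simp
    show "j div q' \<in> {..<p - 1}" using j q'_pos by (simp add: d_def less_mult_imp_div_less)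
  next
    fix j assume j: "j \<in> {..<p - 1}"
    show "(c + j * q') div q' = j" using c by (simp add: block_div_mod)
    have "c + j * q' < Suc j * q'" using c by simp
    also have "\<dots> \<le> d" unfolding d_def using j by (intro mult_le_mono1) auto
    finally show "c + j * q' \<in> {j. j < d \<and> j mod q' = c}" using c by (simp add: block_div_mod)
  qed
  finally show ?thesis .
qed

text \<open>The universal property of the quotient: a function on the points with zero block sums
  factors through the vectors \<open>pvec k\<close>.\<close>

lemma lincomb_pvec:
  fixes F :: "nat \<Rightarrow> rat"
  assumes F: "\<And>c. c < q' \<Longrightarrow> (\<Sum>j<p. F (c + j * q')) = 0" and k: "k < p ^ l"
  shows "(\<Sum>j<d. F j * pvec k $ j) = F k"
proof (cases "k < d")
  case True
  have "(\<Sum>j<d. F j * pvec k $ j) = (\<Sum>j<d. if j = k then F j else 0)"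
    using True by (intro sum.cong) (auto simp: pvec_def)
  thus ?thesis using True by simp
next
  case False
  define c where "c = k - d"
  have c: "c < q'" using k d_add False by (simp add: c_def)
  have kc: "k = c + (p - 1) * q'" using False by (simp add: c_def d_def)
  have "(\<Sum>j<d. F j * pvec k $ j) = - (\<Sum>j<d. if j mod q' = c then F j else 0)"
    unfolding sum_negf[symmetric] using False c block_div_mod(1)[OF c, of "p - 1"]
    by (intro sum.cong) (auto simp: pvec_def kc)
  also have "\<dots> = - (\<Sum>j<p - 1. F (c + j * q'))" by (simp only: sum_residue_class[OF c])
  also have "(\<Sum>j<p. F (c + j * q')) = (\<Sum>j<p - 1. F (c + j * q')) + F k"
    using p_gt_1 by (cases p) (auto simp: kc)
  hence "- (\<Sum>j<p - 1. F (c + j * q')) = F k" using F[OF c] by simp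
  finally show ?thesis .
qed

lemma pvec_sum_block:
  assumes c: "c < q'" and i: "i < d"
  shows "(\<Sum>j<p. pvec (c + j * q') $ i) = 0"
proof -
  have less: "c + j * q' < d" if "j < p - 1" for j
  proof -
    have "c + j * q' < Suc j * q'" using c by simp
    also have "\<dots> \<le> d" unfolding d_def using that by (intro mult_le_mono1) auto
    finally show ?thesis .
  qed
  have "{..<p} = insert (p - 1) {..<p - 1}" using p_gt_1 by auto
  hence "(\<Sum>j<p. pvec (c + j * q') $ i) = (\<Sum>j<p - 1. pvec (c + j * q') $ i) + pvec (c + d) $ i"
    by (simp add: d_def)
  also have "(\<Sum>j<p - 1. pvec (c + j * q') $ i) = (\<Sum>j<p - 1. if i = c + j * q' then 1 else 0)"
    using less i by (intro sum.cong) (auto simp: pvec_unit)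
  also have "\<dots> = (\<Sum>j<d. if j mod q' = c then (if i = j then 1 else 0) else 0)"
    by (rule sum_residue_class[OF c, symmetric])
  also have "\<dots> = (\<Sum>j<d. if j = i then (if i mod q' = c then 1 else 0) else 0)"
    by (rule sum.cong) auto
  also have "\<dots> = (if i mod q' = c then 1 else 0)" using i by simp
  also have "pvec (c + d) $ i = - (if i mod q' = c then 1 else 0)"
    using i c block_div_mod(1)[OF c, of "p - 1"] by (auto simp: pvec_def d_def)
  finally show ?thesis by simp
qed

lemma pvec_sum:
  assumes k: "k < p ^ l" and i: "i < d"
  shows "(\<Sum>j<p. pvec ((k + j * q') mod p ^ l) $ i) = 0"
proof -
  define c a where "c = k mod q'" and "a = k div q'"
  have c: "c < q'" using q'_pos by (simp add: c_def)
  have ka: "k = c + a * q'" unfolding c_def a_def by (rule mod_div_mult_eq[symmetric])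
  have eq: "(k + j * q') mod p ^ l = c + ((a + j) mod p) * q'" for j
  proof -
    have "k + j * q' = c + (a + j) * q'" by (simp add: ka algebra_simps)
    also have "(a + j) * q' = ((a + j) mod p) * q' + ((a + j) div p) * p ^ l"
      unfolding q_eq by (metis add.commute add_mult_distrib div_mult_mod_eq mult.assoc)
    also have "(c + (((a + j) mod p) * q' + ((a + j) div p) * p ^ l)) mod p ^ l = (c + ((a + j) mod p) * q') mod p ^ l"
      by (simp flip: add.assoc)
    also have "\<dots> = c + ((a + j) mod p) * q'"
      using block_less[OF c, of "(a + j) mod p"] p_gt_1 by simp
    finally show ?thesis .
  qed
  have inj: "inj_on (\<lambda>j. (a + j) mod p) {..<p}"
  proof (rule inj_onI)
    fix x y assume xy: "x \<in> {..<p}" "y \<in> {..<p}" "(a + x) mod p = (a + y) mod p"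
    hence "[a + x = a + y] (mod p)" by (simp add: cong_def)
    hence "[x = y] (mod p)" by (simp add: cong_add_lcancel_nat)
    thus "x = y" using xy by (simp add: cong_def)
  qed
  have bij: "bij_betw (\<lambda>j. (a + j) mod p) {..<p} {..<p}"
    unfolding bij_betw_def using inj p_gt_1 by (intro conjI endo_inj_surj) auto
  have "(\<Sum>j<p. pvec ((k + j * q') mod p ^ l) $ i) = (\<Sum>j<p. pvec (c + ((a + j) mod p) * q') $ i)"
    by (simp only: eq)
  also have "\<dots> = (\<Sum>j<p. pvec (c + j * q') $ i)"
    by (rule sum.reindex_bij_betw[OF bij])
  finally show ?thesis using pvec_sum_block[OF c i] by simp
qed

text \<open>Needed so that the model has no larger kernel than the action. Basis points have an
  entry 1; a point \<open>k\<close> beyond the basis has only entries 0 and -1, and one of the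
  latter at \<open>k - d\<close>.\<close>

lemma pvec_inj:
  assumes "pvec k = pvec k'" "k < p ^ l" "k' < p ^ l"
  shows "k = k'"
proof -
  have aux: False if eq: "pvec k = pvec k'" and k: "k < d" and k': "d \<le> k'" for k k'
  proof -
    have "pvec k $ k = 1" using k by (simp add: pvec_def)
    moreover have "pvec k' $ k \<le> 0" using k k' by (simp add: pvec_def)
    ultimately show False using eq by simp
  qed
  consider "k < d" "k' < d" | "k < d" "d \<le> k'" | "d \<le> k" "k' < d" | "d \<le> k" "d \<le> k'" by linarith
  thus ?thesis
  proof cases
    case 1
    thus ?thesis using assms by (simp add: pvec_unit)
  next
    case 2
    thus ?thesis using aux assms by blast
  next
    case 3
    thus ?thesis using aux[of k' k] assms by simp
  next
    case 4
    have c: "k - d < q'" "k' - d < q'" using assms(2,3) d_add q'_pos by linarith+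
    have "k - d + (p - 1) * q' = k" "k' - d + (p - 1) * q' = k'" using 4 by (simp_all add: d_def)
    hence m: "k mod q' = k - d" "k' mod q' = k' - d"
      using block_div_mod(1)[OF c(1), of "p - 1"] block_div_mod(1)[OF c(2), of "p - 1"] by metis+
    have "k - d < d" using c q'_le_d by simp
    hence "pvec k $ (k - d) = -1" "pvec k' $ (k - d) = - (if k - d = k' - d then 1 else 0)"
      using 4 c m by (auto simp: pvec_def)
    thus ?thesis using assms(1) 4 by (auto split: if_splits)
  qed
qed

lemma act_block:
  assumes g: "g \<in> carrier G" and c: "c < q'" and j: "j < p"
  shows "act g (c + j * q') = (act g c + j * q') mod p ^ l"
  using j
proof (induction j)
  case 0
  have "c < p ^ l" using block_less[OF c, of 0] p_gt_1 by simp
  thus ?case using act_less[OF g] by simp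
next
  case (Suc j)
  have less: "c + j * q' < p ^ l" "c + Suc j * q' < p ^ l" using block_less[OF c, of j] block_less[OF c, of "Suc j"] Suc.prems by auto
  have "act g (c + Suc j * q') = act g ((c + j * q' + p ^ (l - 1)) mod p ^ l)"
    using less by (simp add: q'_def algebra_simps)
  also have "\<dots> = (act g c + j * q' + q') mod p ^ l"
    using act_shift[OF g less(1)] Suc by (simp add: q'_def mod_add_left_eq)
  finally show ?case by (simp add: algebra_simps)
qed

text \<open>\<open>mrep g\<close> is defined by its values on the basis points. For the others
  \<open>lincomb_pvec\<close> applies, because \<open>g\<close> maps blocks to blocks and so the
  coordinates of \<open>pvec (act g j)\<close>, as functions of \<open>j\<close>, have zero block
  sums.\<close>

lemma mrep_pvec:
  assumes g: "g \<in> carrier G" and k: "k < p ^ l"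
  shows "mrep g *\<^sub>v pvec k = pvec (act g k)"
proof (rule eq_vecI)
  fix i assume "i < dim_vec (pvec (act g k))"
  hence i: "i < d" by simp
  have "(mrep g *\<^sub>v pvec k) $ i = (\<Sum>j<d. pvec (act g j) $ i * pvec k $ j)"
    using i by (simp add: mrep_def scalar_prod_def lessThan_atLeast0)
  also have "\<dots> = pvec (act g k) $ i"
  proof (rule lincomb_pvec[OF _ k])
    fix c assume c: "c < q'"
    have "c < p ^ l" using block_less[OF c, of 0] p_gt_1 by simp
    hence "(\<Sum>j<p. pvec ((act g c + j * q') mod p ^ l) $ i) = 0"
      by (intro pvec_sum act_less[OF g] i)
    thus "(\<Sum>j<p. pvec (act g (c + j * q')) $ i) = 0"
      using act_block[OF g c] by simp
  qed
  finally show "(mrep g *\<^sub>v pvec k) $ i = pvec (act g k) $ i" .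
qed (simp add: mrep_def)

lemma mat_eq_on_pvec:
  assumes A: "A \<in> carrier_mat e d" and B: "B \<in> carrier_mat e d"
    and eq: "\<And>k. k < d \<Longrightarrow> A *\<^sub>v pvec k = B *\<^sub>v pvec k"
  shows "A = B"
proof (rule eq_matI)
  fix i j assume ij: "i < dim_row B" "j < dim_col B"
  hence "j < d" using B by simp
  hence "(A *\<^sub>v unit_vec d j) $ i = (B *\<^sub>v unit_vec d j) $ i" using eq[of j] by (simp add: pvec_unit)
  thus "A $$ (i, j) = B $$ (i, j)" using ij A B by simp
qed (use A B in auto)

lemma less_d: "k < d \<Longrightarrow> k < p ^ l" using d_add by simp

lemma mrep_mult:
  assumes "g \<in> carrier G" "h \<in> carrier G"
  shows "mrep (g \<otimes> h) = mrep g * mrep h"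
proof (rule mat_eq_on_pvec[of _ d])
  fix k assume k: "k < d"
  have "mrep g * mrep h *\<^sub>v pvec k = mrep g *\<^sub>v (mrep h *\<^sub>v pvec k)"
    by (rule assoc_mult_mat_vec[of _ d d _ d]) auto
  thus "mrep (g \<otimes> h) *\<^sub>v pvec k = mrep g * mrep h *\<^sub>v pvec k"
    using assms less_d[OF k] by (simp add: mrep_pvec act_mult act_less)
qed (rule mrep_carrier mult_carrier_mat[OF mrep_carrier mrep_carrier])+

lemma mrep_eq_one_iff:
  assumes g: "g \<in> carrier G"
  shows "mrep g = 1\<^sub>m d \<longleftrightarrow> (\<forall>k<p ^ l. act g k = k)"
proof
  assume "mrep g = 1\<^sub>m d"
  hence "pvec (act g k) = pvec k" if "k < p ^ l" for k
    using mrep_pvec[OF g that] by simp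
  thus "\<forall>k<p ^ l. act g k = k" using pvec_inj act_less[OF g] by blast
next
  assume "\<forall>k<p ^ l. act g k = k"
  thus "mrep g = 1\<^sub>m d" using mrep_pvec[OF g] less_d
    by (intro mat_eq_on_pvec) auto
qed

lemma mrep_is_rep: "is_rep (carrier G) (\<otimes>) \<one> d mrep"
  using mrep_mult mrep_eq_one_iff[OF one_closed] by (simp add: is_rep_def act_one)

lemma act_g0_pow:
  assumes "k < p ^ l"
  shows "act (g0 [^] (j::nat)) k = (k + j) mod p ^ l"
proof (induction j)
  case 0
  show ?case using assms by (simp add: act_one)
next
  case (Suc j)
  have "act (g0 [^] Suc j) k = act (g0 \<otimes> g0 [^] j) k" by (metis nat_pow_Suc2 g0)
  also have "\<dots> = ((k + j) mod p ^ l + 1) mod p ^ l"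
    using assms Suc p_gt_1 by (simp add: act_mult act_g0)
  finally show ?case by (simp add: mod_Suc_eq)
qed

lemma mrep_g0_pow_eq_one_iff: "mrep (g0 [^] (j::nat)) = 1\<^sub>m d \<longleftrightarrow> p ^ l dvd j"
proof -
  have "0 < p ^ l" using p_gt_1 by simp
  show ?thesis
  proof (subst mrep_eq_one_iff, simp, rule iffI)
    assume "\<forall>k<p ^ l. act (g0 [^] j) k = k"
    hence "act (g0 [^] j) 0 = 0" using \<open>0 < p ^ l\<close> by blast
    thus "p ^ l dvd j" using \<open>0 < p ^ l\<close> by (simp add: act_g0_pow mod_eq_0_iff_dvd)
  next
    assume "p ^ l dvd j"
    thus "\<forall>k<p ^ l. act (g0 [^] j) k = k" by (auto simp: act_g0_pow elim!: dvdE)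
  qed
qed

lemma mrep_irred: "is_irred_rep (carrier G) (\<otimes>) \<one> d mrep"
  unfolding is_irred_rep_def
proof (intro conjI allI impI)
  show "is_rep (carrier G) (\<otimes>) \<one> d mrep" by (rule mrep_is_rep)
  show "d > 0" using q'_le_d q'_pos by simp
  fix W assume W: "is_subspace d W \<and> (\<forall>g\<in>carrier G. \<forall>v\<in>W. mrep g *\<^sub>v v \<in> W)"
  have pow: "((*\<^sub>v) (mrep g0) ^^ j) w = mrep (g0 [^] j) *\<^sub>v w" if "w \<in> carrier_vec d" for w j
  proof (induction j)
    case 0
    show ?case using that mrep_is_rep by (simp add: is_rep_def)
  next
    case (Suc j)
    have "mrep (g0 [^] Suc j) *\<^sub>v w = mrep (g0 \<otimes> g0 [^] j) *\<^sub>v w" by (metis nat_pow_Suc2 g0)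
    also have "\<dots> = mrep g0 *\<^sub>v (mrep (g0 [^] j) *\<^sub>v w)"
      using that by (subst mrep_mult) (auto intro!: assoc_mult_mat_vec[of _ d d _ d])
    finally show ?case using Suc by simp
  qed
  show "W = {0\<^sub>v d} \<or> W = carrier_vec d"
  proof (cases "W = {0\<^sub>v d}")
    case ne: False
    have "W = carrier_vec d"
    proof (rule cyclotomic_invariant_subspace[OF p _ mrep_carrier[of g0] _ _ _ ne])
      show "d = (p - 1) * p ^ (l - 1)" by (simp add: d_def q'_def)
      fix w :: "rat vec" and i assume w: "w \<in> carrier_vec d" and i: "i < d"
      have "(\<Sum>j<p. (((*\<^sub>v) (mrep g0) ^^ (j * p ^ (l - 1))) w) $ i)
          = (\<Sum>j<p. (mrep (g0 [^] (j * q')) *\<^sub>v w) $ i)"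
        by (simp only: pow[OF w] q'_def)
      \<comment> \<open>On a point, the powers \<open>g0 ^ (j * q')\<close> run through one block,
        whose sum vanishes in the quotient.\<close>
      also have "\<dots> = (\<Sum>j<p. \<Sum>m<d. pvec ((m + j * q') mod p ^ l) $ i * w $ m)"
        using i w less_d by (simp add: mrep_def scalar_prod_def lessThan_atLeast0 act_g0_pow)
      also have "\<dots> = (\<Sum>m<d. (\<Sum>j<p. pvec ((m + j * q') mod p ^ l) $ i) * w $ m)"
        by (subst sum.swap) (simp add: sum_distrib_right)
      also have "\<dots> = 0" using less_d by (intro sum.neutral) (simp add: pvec_sum i)
      finally show "(\<Sum>j<p. (((*\<^sub>v) (mrep g0) ^^ (j * p ^ (l - 1))) w) $ i) = 0" .
    qed (use W in auto)
    thus ?thesis ..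
  qed simp
qed

lemma irred_rep_mrep: "irred_rep G d mrep"
  by unfold_locales (use finite_carrier mrep_irred in auto)

lemma act_inj:
  assumes g: "g \<in> carrier G" and "k < p ^ l" "k' < p ^ l" "act g k = act g k'"
  shows "k = k'"
proof -
  have "act (inv g \<otimes> g) k = act (inv g \<otimes> g) k'"
    using assms by (simp only: act_mult inv_closed)
  thus ?thesis using assms by (simp add: act_one)
qed

text \<open>A vector fixed by the stabilizer of the point \<open>0\<close> defines a homomorphism from the
  permutation module, which factors through the model when \<open>rel\<close> holds.\<close>

lemma equiv_of_fixed_vector:
  assumes \<sigma>: "irred_rep G e \<sigma>"
    and w: "w \<in> carrier_vec e" "w \<noteq> 0\<^sub>v e"
    and fixw: "\<And>h. h \<in> carrier G \<Longrightarrow> act h 0 = 0 \<Longrightarrow> \<sigma> h *\<^sub>v w = w"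
    and rel: "\<And>v i. v \<in> carrier_vec e \<Longrightarrow> i < e \<Longrightarrow> (\<Sum>j<p. (\<sigma> ((g0 [^] q') [^] j) *\<^sub>v v) $ i) = 0"
  shows "d = e \<and> rep_equiv (carrier G) d mrep \<sigma>"
proof -
  interpret s: irred_rep G e \<sigma> by fact
  define P where "P = mat e d (\<lambda>(i, j). (\<sigma> (g0 [^] j) *\<^sub>v w) $ i)"
  have P: "P \<in> carrier_mat e d" by (simp add: P_def)
  have P_pvec: "P *\<^sub>v pvec k = \<sigma> (g0 [^] k) *\<^sub>v w" if k: "k < p ^ l" for k
  proof (rule eq_vecI)
    fix i assume "i < dim_vec (\<sigma> (g0 [^] k) *\<^sub>v w)"
    hence i: "i < e" by simp
    have "(P *\<^sub>v pvec k) $ i = (\<Sum>j<d. (\<sigma> (g0 [^] j) *\<^sub>v w) $ i * pvec k $ j)"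
      using i by (simp add: P_def scalar_prod_def lessThan_atLeast0)
    also have "\<dots> = (\<sigma> (g0 [^] k) *\<^sub>v w) $ i"
    proof (rule lincomb_pvec[OF _ k])
      fix c assume "c < q'"
      have "\<sigma> (g0 [^] (c + j * q')) *\<^sub>v w = \<sigma> ((g0 [^] q') [^] j) *\<^sub>v (\<sigma> (g0 [^] c) *\<^sub>v w)" for j
      proof -
        have "g0 [^] (c + j * q') = (g0 [^] q') [^] j \<otimes> g0 [^] c"
          by (simp add: nat_pow_pow nat_pow_mult add.commute mult.commute)
        thus ?thesis using w by (simp add: s.rep_mult_vec)
      qed
      thus "(\<Sum>j<p. (\<sigma> (g0 [^] (c + j * q')) *\<^sub>v w) $ i) = 0"
        using rel[OF _ i, of "\<sigma> (g0 [^] c) *\<^sub>v w"] by simp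
    qed
    finally show "(P *\<^sub>v pvec k) $ i = (\<sigma> (g0 [^] k) *\<^sub>v w) $ i" .
  qed (simp add: P_def)
  have comm: "P * mrep g = \<sigma> g * P" if g: "g \<in> carrier G" for g
  proof (rule mat_eq_on_pvec[of _ e])
    fix k assume "k < d"
    hence k: "k < p ^ l" by (rule less_d)
    define a where "a = act g k"
    have a: "a < p ^ l" using act_less[OF g k] by (simp add: a_def)
    have q0: "0 < p ^ l" using p_gt_1 by simp
    \<comment> \<open>\<open>g0 ^ k\<close> carries 0 to \<open>k\<close> and \<open>g\<close>
      carries \<open>k\<close> to \<open>a\<close>, so \<open>x\<close> lies in the stabilizer of
      0.\<close>
    define x where "x = inv (g0 [^] a) \<otimes> (g \<otimes> g0 [^] k)"
    have x: "x \<in> carrier G" using g by (simp add: x_def)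
    have gx: "g0 [^] a \<otimes> x = g \<otimes> g0 [^] k"
      using g by (simp add: x_def m_assoc[symmetric])
    have "act (g0 [^] a) (act x 0) = act (g \<otimes> g0 [^] k) 0"
      using gx x q0 by (metis act_mult g0 nat_pow_closed)
    also have "\<dots> = act (g0 [^] a) 0"
      using g k a q0 by (simp add: act_mult act_g0_pow a_def)
    finally have "act x 0 = 0"
      by (rule act_inj[of "g0 [^] a", rotated 3]) (use act_less[OF x q0] q0 in simp_all)
    hence xw: "\<sigma> x *\<^sub>v w = w" by (rule fixw[OF x])
    have "P * mrep g *\<^sub>v pvec k = P *\<^sub>v (mrep g *\<^sub>v pvec k)"
      by (rule assoc_mult_mat_vec[OF P mrep_carrier pvec_carrier])
    also have "\<dots> = \<sigma> (g0 [^] a) *\<^sub>v (\<sigma> x *\<^sub>v w)"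
      using g k a by (simp add: mrep_pvec P_pvec a_def[symmetric] xw)
    also have "\<dots> = \<sigma> (g \<otimes> g0 [^] k) *\<^sub>v w"
      using x w by (simp add: s.rep_mult_vec[symmetric] gx)
    also have "\<dots> = \<sigma> g *\<^sub>v (P *\<^sub>v pvec k)"
      using g w k by (simp add: s.rep_mult_vec P_pvec)
    also have "\<dots> = \<sigma> g * P *\<^sub>v pvec k"
      using g by (intro assoc_mult_mat_vec[OF _ P, symmetric]) auto
    finally show "P * mrep g *\<^sub>v pvec k = \<sigma> g * P *\<^sub>v pvec k" .
  qed (use P g in \<open>auto intro!: mult_carrier_mat[of _ e]\<close>)
  have "P \<noteq> 0\<^sub>m e d"
  proof
    assume "P = 0\<^sub>m e d"
    hence "\<sigma> (g0 [^] (0::nat)) *\<^sub>v w = 0\<^sub>m e d *\<^sub>v pvec 0" using P_pvec[of 0] p_gt_1 by simp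
    also have "0\<^sub>m e d *\<^sub>v pvec 0 = 0\<^sub>v e" by (intro eq_vecI) auto
    finally show False using w by simp
  qed
  from schur[OF irred_rep_mrep \<sigma> P comm this] show ?thesis .
qed

lemma equiv_of_traces:
  assumes \<sigma>: "irred_rep G e \<sigma>"
    and c: "irred_rep.central G \<sigma> (g0 [^] q')" and nt: "\<sigma> (g0 [^] q') \<noteq> 1\<^sub>m e"
    and ord: "\<sigma> (g0 [^] (p ^ l)) = 1\<^sub>m e"
    and tr: "\<And>h. h \<in> carrier G \<Longrightarrow> act h 0 = 0 \<Longrightarrow> \<sigma> h = 1\<^sub>m e \<or> mat_trace (\<sigma> h) = 0"
  shows "d = e \<and> rep_equiv (carrier G) d mrep \<sigma>"
proof -
  interpret s: irred_rep G e \<sigma> by fact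
  have q0: "0 < p ^ l" using p_gt_1 by simp
  define H where "H = {h \<in> carrier G. act h 0 = 0}"
  obtain w where w: "w \<in> carrier_vec e" "w \<noteq> 0\<^sub>v e" "\<And>h. h \<in> H \<Longrightarrow> \<sigma> h *\<^sub>v w = w"
    by (rule s.fixed_vector[of H]) (use tr act_one act_mult q0 in \<open>auto simp: H_def\<close>)
  have "\<sigma> ((g0 [^] q') [^] p) = 1\<^sub>m e" using ord by (simp add: nat_pow_pow q_eq mult.commute)
  from s.central_sum_zero[OF c nt this] show ?thesis
    by (intro equiv_of_fixed_vector[OF \<sigma> w(1,2)] w(3)) (auto simp: H_def)
qed

end

section \<open>Powers of an integer congruent to 1\<close>

text \<open>The translation part of the \<open>y\<close>-th iterate of
  \<open>k \<mapsto> r k + 1\<close>.\<close>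

definition gsum :: "int \<Rightarrow> nat \<Rightarrow> int" where
  "gsum r y = (\<Sum>i<y. r ^ i)"

lemma gsum_0 [simp]: "gsum r 0 = 0" and gsum_1 [simp]: "gsum r (Suc 0) = 1"
  by (simp_all add: gsum_def)

lemma gsum_add: "gsum r (x + y) = gsum r x + r ^ x * gsum r y"
proof (induction y)
  case (Suc y)
  have "gsum r (x + Suc y) = gsum r (x + y) + r ^ (x + y)" by (simp add: gsum_def)
  thus ?case using Suc by (simp add: gsum_def power_add algebra_simps)
qed simp

lemma gsum_mult: "gsum r (x * y) = gsum r x * gsum (r ^ x) y"
proof (induction y)
  case (Suc y)
  have "gsum r (x * Suc y) = gsum r (x * y) + r ^ (x * y) * gsum r x"
    by (simp add: gsum_add[symmetric] add.commute)
  thus ?case using Suc by (simp add: gsum_def power_mult algebra_simps)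
qed simp

lemma power_minus_one_eq: "r ^ y - 1 = (r - 1) * gsum r y"
  by (simp add: gsum_def power_diff_1_eq)

lemma gsum_cong:
  assumes "[r = 1] (mod q)"
  shows "[gsum r y = int y] (mod q)"
proof -
  have "[gsum r y = (\<Sum>i<y. 1 ^ i)] (mod q)"
    unfolding gsum_def by (intro cong_sum cong_pow assms)
  thus ?thesis by simp
qed

lemma cong_power_one: "[r = 1] (mod q) \<Longrightarrow> [r ^ y = 1] (mod q)" for r q :: int
  using cong_pow[of r 1 q y] by simp

text \<open>Modulo the square of \<open>p\<close>, \<open>r ^ i\<close> is linear in
  \<open>i\<close>, so the sum is \<open>p\<close> plus \<open>p (p - 1) / 2\<close> times
  \<open>r - 1\<close>. As \<open>p\<close> is odd, both factors of this correction are divisible by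
  \<open>p\<close>.\<close>

lemma gsum_prime:
  assumes "odd p" and r: "[r = 1] (mod int p)"
  obtains v where "gsum r p = int p * v" "[v = 1] (mod int p)"
proof -
  obtain z where z: "r = 1 + int p * z" using r by (metis cong_iff_lin cong_sym)
  have pw: "[r ^ i = 1 + int i * (int p * z)] (mod (int p)\<^sup>2)" for i
  proof (induction i)
    case (Suc i)
    have "[r ^ i * r = (1 + int i * (int p * z)) * r] (mod (int p)\<^sup>2)"
      by (rule cong_scalar_right[OF Suc])
    moreover have "(1 + int i * (int p * z)) * r = 1 + int (Suc i) * (int p * z) + (int p)\<^sup>2 * (int i * z\<^sup>2)"
      unfolding z by (simp add: algebra_simps power2_eq_square)
    ultimately show ?case by (simp add: cong_def mult.commute)
  qed simp
  obtain k where k: "p = 2 * k + 1" using \<open>odd p\<close> by (elim oddE)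
  have "(\<Sum>i<p. int i) = int p * int k"
  proof -
    have "2 * (\<Sum>i<N. int i) = int N * (int N - 1)" for N
      by (induction N) (simp_all add: algebra_simps)
    from this[of p] show ?thesis unfolding k by (simp add: algebra_simps)
  qed
  moreover have "(\<Sum>i<p. 1 + int i * (int p * z)) = int p + (\<Sum>i<p. int i) * (int p * z)"
    by (simp only: sum.distrib sum_distrib_right) simp
  ultimately have "(\<Sum>i<p. 1 + int i * (int p * z)) = int p + (int p)\<^sup>2 * (int k * z)"
    by (simp add: power2_eq_square)
  moreover have "[gsum r p = (\<Sum>i<p. 1 + int i * (int p * z))] (mod (int p)\<^sup>2)"
    unfolding gsum_def by (intro cong_sum pw)
  ultimately have "[gsum r p = int p] (mod (int p)\<^sup>2)" by (simp add: cong_def)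
  then obtain w where "gsum r p = int p + (int p)\<^sup>2 * w" by (metis cong_iff_lin cong_sym)
  hence "gsum r p = int p * (1 + int p * w)" by (simp add: power2_eq_square algebra_simps)
  moreover have "[1 + int p * w = 1] (mod int p)" by (simp add: cong_def)
  ultimately show ?thesis by (rule that)
qed

lemma gsum_prime_power:
  assumes "odd p" and r: "[r = 1] (mod int p)"
  obtains v where "gsum r (p ^ k) = int p ^ k * v" "[v = 1] (mod int p)"
proof -
  have "\<exists>v. gsum r (p ^ k) = int p ^ k * v \<and> [v = 1] (mod int p)"
  proof (induction k)
    case 0
    show ?case by (intro exI[of _ 1]) simp
  next
    case (Suc k)
    then obtain v where v: "gsum r (p ^ k) = int p ^ k * v" "[v = 1] (mod int p)" by blast
    obtain w where w: "gsum (r ^ (p ^ k)) p = int p * w" "[w = 1] (mod int p)"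
      using gsum_prime[OF assms(1) cong_power_one[OF r]] by blast
    have "gsum r (p ^ Suc k) = gsum r (p ^ k * p)" by (simp add: mult.commute)
    also have "\<dots> = int p ^ Suc k * (v * w)" unfolding gsum_mult v w by simp
    finally show ?case using cong_mult[OF v(2) w(2)] by auto
  qed
  thus ?thesis using that by blast
qed

lemma prime_power_dvd_mult_iff:
  fixes v x :: int
  assumes "prime p" and v: "\<not> int p dvd v"
  shows "int p ^ k dvd v * x \<longleftrightarrow> int p ^ k dvd x"
proof -
  have "coprime (int p) v" using assms by (simp add: prime_imp_coprime)
  hence "coprime (int p ^ k) v" by simp
  thus ?thesis by (simp add: coprime_dvd_mult_right_iff)
qed

locale unit_order =
  fixes p c :: nat and r :: int
  assumes p: "prime p" and odd: "odd p" and c: "c > 0"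
    and dvd_r: "int p ^ c dvd r - 1" and not_dvd_r: "\<not> int p ^ Suc c dvd r - 1"
begin

lemma p_gt_1: "p > 1" using p by (rule prime_gt_1_nat)

lemma r_cong: "[r = 1] (mod int p)"
proof -
  have "int p dvd int p ^ c" using c by (simp add: dvd_power)
  thus ?thesis using dvd_r by (metis cong_iff_dvd_diff dvd_trans)
qed

lemma gsum_pow:
  obtains v where "gsum r (p ^ k) = int p ^ k * v" "\<not> int p dvd v"
proof -
  obtain v where v: "gsum r (p ^ k) = int p ^ k * v" "[v = 1] (mod int p)"
    using gsum_prime_power[OF odd r_cong] by blast
  have "\<not> int p dvd v" using cong_dvd_iff[OF v(2)] p_gt_1 by simp
  thus ?thesis using v that by blast
qed

text \<open>Splitting off the full power \<open>p ^ f\<close> from \<open>y\<close> splits off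
  \<open>p ^ f\<close> times a unit from the sum, and the remaining factor is congruent to
  \<open>y'\<close> modulo \<open>p\<close>. So the sum has the \<open>p\<close>-adic valuation of
  \<open>y\<close>.\<close>

lemma dvd_gsum_iff: "int p ^ k dvd gsum r y \<longleftrightarrow> p ^ k dvd y"
proof
  assume "p ^ k dvd y"
  then obtain y' where y: "y = p ^ k * y'" by (elim dvdE)
  obtain v where "gsum r (p ^ k) = int p ^ k * v" using gsum_pow by blast
  thus "int p ^ k dvd gsum r y" by (simp add: y gsum_mult)
next
  assume dvd: "int p ^ k dvd gsum r y"
  show "p ^ k dvd y"
  proof (cases "y = 0")
    case False
    obtain f y' where y: "y = p ^ f * y'" and y': "\<not> p dvd y'"
      using prime_power_canonical[OF p, of y] False by (auto simp: mult.commute)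
    obtain v where v: "gsum r (p ^ f) = int p ^ f * v" "\<not> int p dvd v" using gsum_pow by blast
    have "[gsum (r ^ (p ^ f)) y' = int y'] (mod int p)" by (intro gsum_cong cong_power_one r_cong)
    hence nd: "\<not> int p dvd gsum (r ^ (p ^ f)) y'" using y' by (simp add: cong_dvd_iff)
    have "gsum r y = v * (gsum (r ^ (p ^ f)) y' * int p ^ f)" by (simp add: y gsum_mult v)
    hence "int p ^ k dvd int p ^ f"
      using dvd by (simp add: prime_power_dvd_mult_iff[OF p v(2)] prime_power_dvd_mult_iff[OF p nd])
    hence "p ^ k dvd p ^ f" by (simp flip: of_nat_power)
    thus ?thesis by (simp add: y)
  qed simp
qed

text \<open>\<open>r ^ y - 1\<close> is \<open>r - 1\<close> times a geometric sum; the first factor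
  has valuation \<open>c\<close>, the second that of \<open>y\<close>.\<close>

lemma dvd_power_minus_one_iff: "int p ^ (c + k) dvd r ^ y - 1 \<longleftrightarrow> p ^ k dvd y"
proof -
  obtain u where u: "r - 1 = int p ^ c * u" using dvd_r by (elim dvdE)
  have nu: "\<not> int p dvd u" using not_dvd_r unfolding u by (auto simp: mult.commute)
  have p0: "int p ^ c \<noteq> 0" using p_gt_1 by simp
  have "r ^ y - 1 = int p ^ c * (u * gsum r y)" by (simp add: power_minus_one_eq u)
  hence "int p ^ (c + k) dvd r ^ y - 1 \<longleftrightarrow> int p ^ k dvd u * gsum r y"
    by (simp only: power_add dvd_times_left_cancel_iff[OF p0])
  thus ?thesis by (simp add: prime_power_dvd_mult_iff[OF p nu] dvd_gsum_iff)
qed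

lemma power_cong_one:
  assumes "p ^ k dvd y" "e \<le> c + k"
  shows "[r ^ y = 1] (mod int p ^ e)"
proof -
  have "int p ^ (c + k) dvd r ^ y - 1" using assms by (simp add: dvd_power_minus_one_iff)
  moreover have "int p ^ e dvd int p ^ (c + k)" using assms by (simp add: le_imp_power_dvd)
  ultimately show ?thesis by (metis cong_iff_dvd_diff dvd_trans)
qed

lemma gsum_scale_cong:
  assumes "[r ^ x = 1] (mod q)"
  shows "[gsum r (x * j) = int j * gsum r x] (mod q)"
  using cong_scalar_left[OF gsum_cong[OF assms], of "gsum r x" j]
  by (simp only: gsum_mult mult.commute[of "int j"])

lemma gsum_add_cong:
  assumes "[r ^ x = 1] (mod q)"
  shows "[gsum r (x + y) = gsum r x + gsum r y] (mod q)"
  using cong_add[OF cong_refl[of "gsum r x"] cong_scalar_right[OF assms, of "gsum r y"]] by (simp add: gsum_add)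

end

lemma fermat_int:
  fixes x :: int
  assumes "prime p"
  shows "[x ^ p = x] (mod int p)"
proof -
  have p0: "p > 0" using assms prime_gt_0_nat by blast
  define y where "y = nat (x mod int p)"
  have y: "[int y = x] (mod int p)" using p0 by (simp add: y_def cong_def)
  have "[y ^ p = y] (mod p)"
  proof (cases "p dvd y")
    case True
    hence "p dvd y ^ p" using p0 by (simp add: dvd_power_same dvd_trans[OF _ dvd_power])
    thus ?thesis using True by (metis cong_0_iff cong_sym cong_trans)
  next
    case False
    have "[y ^ (p - 1) * y = 1 * y] (mod p)"
      using fermat_theorem[OF assms False] by (rule cong_scalar_right)
    moreover have "y ^ (p - 1) * y = y ^ p" using p0 by (rule power_minus_mult)
    ultimately show ?thesis by simp
  qed
  hence "[int y ^ p = int y] (mod int p)" by (metis cong_int_iff of_nat_power)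
  thus ?thesis using y cong_pow by (meson cong_sym cong_trans)
qed

text \<open>By Fermat, \<open>r ^ (p ^ s)\<close> is congruent to \<open>r\<close> modulo
  \<open>p\<close>, so \<open>r\<close> is 1 modulo \<open>p\<close>. Then the valuation of
  \<open>r ^ (p ^ k) - 1\<close> exceeds that of \<open>r - 1\<close> by exactly \<open>k\<close>,
  and comparison with \<open>n\<close> at \<open>k = s\<close> and \<open>k = s - 1\<close> bounds
  the latter from both sides.\<close>

lemma unit_order_of_order:
  fixes p n s :: nat and r :: int
  assumes p: "prime p" "odd p" and ord: "[r ^ (p ^ s) = 1] (mod int (p ^ n))"
    and min: "\<forall>k. 0 < k \<and> k < p ^ s \<longrightarrow> \<not> [r ^ k = 1] (mod int (p ^ n))"
    and s: "0 < s" "s < n"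
  shows "unit_order p (n - s) r"
proof -
  have p1: "p > 1" using p prime_gt_1_nat by blast
  have "[r ^ (p ^ s) = 1] (mod int p)"
    by (rule cong_dvd_mono_modulus[OF ord]) (use s in simp)
  moreover have "[r ^ (p ^ k) = r] (mod int p)" for k
  proof (induction k)
    case (Suc k)
    have "r ^ (p ^ Suc k) = (r ^ (p ^ k)) ^ p" by (simp add: power_mult[symmetric] mult.commute)
    thus ?case using fermat_int[OF p(1), of "r ^ (p ^ k)"] Suc by (auto intro: cong_trans)
  qed simp
  ultimately have rc: "[r = 1] (mod int p)" by (meson cong_sym cong_trans)
  have v: "\<exists>v. r ^ (p ^ k) - 1 = int p ^ k * (r - 1) * v \<and> \<not> int p dvd v" for k
  proof -
    obtain v where v: "gsum r (p ^ k) = int p ^ k * v" "[v = 1] (mod int p)"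
      using gsum_prime_power[OF p(2) rc] by blast
    have "\<not> int p dvd v" using cong_dvd_iff[OF v(2)] p1 by simp
    thus ?thesis using v(1) by (auto simp: power_minus_one_eq)
  qed
  have iff: "int p ^ (k + j) dvd r ^ (p ^ k) - 1 \<longleftrightarrow> int p ^ j dvd r - 1" for k j
  proof -
    obtain v where v: "r ^ (p ^ k) - 1 = int p ^ k * (r - 1) * v" "\<not> int p dvd v" using v by blast
    have p0: "int p ^ k \<noteq> 0" using p1 by simp
    have "r ^ (p ^ k) - 1 = int p ^ k * (v * (r - 1))" using v(1) by simp
    hence "int p ^ (k + j) dvd r ^ (p ^ k) - 1 \<longleftrightarrow> int p ^ j dvd v * (r - 1)"
      by (simp only: power_add dvd_times_left_cancel_iff[OF p0])
    thus ?thesis by (simp add: prime_power_dvd_mult_iff[OF p(1) v(2)])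
  qed
  show ?thesis
  proof
    show "int p ^ (n - s) dvd r - 1"
      using ord s iff[of s "n - s"] by (simp add: cong_iff_dvd_diff)
    have "p ^ (s - 1) < p ^ s" using s p1 by simp
    hence "\<not> [r ^ (p ^ (s - 1)) = 1] (mod int (p ^ n))" using min p1 by simp
    moreover have "s - 1 + Suc (n - s) = n" using s by simp
    ultimately show "\<not> int p ^ Suc (n - s) dvd r - 1"
      using iff[of "s - 1" "Suc (n - s)"] by (simp add: cong_iff_dvd_diff)
  qed (use p s in auto)
qed

section \<open>The metacyclic group and its affine actions\<close>

locale metacyclic = unit_order p c r for p c r +
  fixes s m :: nat
  assumes s_pos: "s > 0" and s_le_m: "s \<le> m"
begin

definition n :: nat where "n = c + s"

definition Mc :: "(nat \<times> nat) monoid" where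
  "Mc = \<lparr>carrier = mc_carrier p n m, mult = mc_mult p n m r, one = mc_one\<rparr>"

text \<open>The element \<open>a ^ x b ^ y\<close> with unreduced exponents, so that products and
  powers are computed without \<open>mod\<close> and reduction is left to congruences.\<close>

definition el :: "int \<Rightarrow> nat \<Rightarrow> nat \<times> nat" where
  "el x y = (nat (x mod int p ^ n), y mod p ^ m)"

lemma p_pow_pos: "int p ^ k > 0" "p ^ k > 0" using p_gt_1 by simp_all

lemma el_carrier [simp]: "el x y \<in> carrier Mc"
  using p_pow_pos[of n] p_pow_pos(2)[of m]
  by (auto simp: el_def Mc_def mc_carrier_def nat_less_iff)

lemma carrier_eq_el:
  assumes "g \<in> carrier Mc"
  obtains x y :: nat where "g = el (int x) y" "x < p ^ n" "y < p ^ m"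
proof -
  obtain i j where g: "g = (i, j)" by force
  have ij: "i < p ^ n" "j < p ^ m" using assms by (auto simp: g Mc_def mc_carrier_def)
  hence "int i mod int p ^ n = int i" by (simp flip: of_nat_power)
  hence "g = el (int i) j" using ij by (simp add: g el_def)
  thus ?thesis using ij that by blast
qed

lemma el_eqI: "[x = x'] (mod int p ^ n) \<Longrightarrow> [y = y'] (mod p ^ m) \<Longrightarrow> el x y = el x' y'"
  by (simp add: el_def cong_def)

lemma r_pow_cong: "[r ^ (y mod p ^ m) = r ^ y] (mod int p ^ e)" if "e \<le> c + m"
proof -
  have "[r ^ (p ^ m * (y div p ^ m)) = 1] (mod int p ^ e)"
    by (rule power_cong_one[OF _ that]) simp
  hence "[r ^ (p ^ m * (y div p ^ m)) * r ^ (y mod p ^ m) = 1 * r ^ (y mod p ^ m)] (mod int p ^ e)"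
    by (rule cong_scalar_right)
  thus ?thesis by (simp flip: power_add add: cong_sym)
qed

lemma el_mult: "el x y \<otimes>\<^bsub>Mc\<^esub> el x' y' = el (x + r ^ y * x') (y + y')"
proof -
  have "[x mod int p ^ n + r ^ (y mod p ^ m) * (x' mod int p ^ n) = x + r ^ y * x'] (mod int p ^ n)"
    using s_le_m by (intro cong_add cong_mult r_pow_cong) (auto simp: n_def)
  thus ?thesis using p_pow_pos(1)[of n]
    by (simp add: el_def Mc_def mc_mult_def cong_def mod_add_eq)
qed

lemma one_eq_el: "\<one>\<^bsub>Mc\<^esub> = el 0 0"
  by (simp add: el_def Mc_def mc_one_def)

lemma Mc_group: "group Mc"
proof (rule groupI)
  fix g h assume "g \<in> carrier Mc" "h \<in> carrier Mc"
  thus "g \<otimes>\<^bsub>Mc\<^esub> h \<in> carrier Mc" by (elim carrier_eq_el) (simp add: el_mult)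
next
  fix g h k assume "g \<in> carrier Mc" "h \<in> carrier Mc" "k \<in> carrier Mc"
  thus "g \<otimes>\<^bsub>Mc\<^esub> h \<otimes>\<^bsub>Mc\<^esub> k = g \<otimes>\<^bsub>Mc\<^esub> (h \<otimes>\<^bsub>Mc\<^esub> k)"
    by (elim carrier_eq_el) (simp add: el_mult algebra_simps power_add)
next
  fix g assume "g \<in> carrier Mc"
  thus "\<one>\<^bsub>Mc\<^esub> \<otimes>\<^bsub>Mc\<^esub> g = g" by (elim carrier_eq_el) (simp add: el_mult one_eq_el)
next
  fix g assume "g \<in> carrier Mc"
  then obtain x y :: nat where g: "g = el (int x) y" by (elim carrier_eq_el)
  \<comment> \<open>The exponent \<open>w\<close> serves as \<open>-y\<close>: \<open>w + y\<close>
    is a multiple of \<open>p ^ m\<close>.\<close>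
  define w where "w = y * (p ^ m - 1)"
  obtain N where "p ^ m = Suc N" using p_pow_pos(2)[of m] by (metis Suc_pred)
  hence w: "w + y = p ^ m * y" by (simp add: w_def)
  have "el (- (r ^ w * int x)) w \<otimes>\<^bsub>Mc\<^esub> g = el 0 (p ^ m * y)" by (simp add: g el_mult w)
  also have "\<dots> = \<one>\<^bsub>Mc\<^esub>" unfolding one_eq_el by (rule el_eqI) (simp_all add: cong_def)
  finally show "\<exists>h\<in>carrier Mc. h \<otimes>\<^bsub>Mc\<^esub> g = \<one>\<^bsub>Mc\<^esub>" using el_carrier by blast
qed (simp add: one_eq_el)

sublocale group Mc by (rule Mc_group)

lemma finite_Mc: "finite (carrier Mc)"
  by (simp add: Mc_def mc_carrier_def)

lemma el_pow_left: "el x 0 [^]\<^bsub>Mc\<^esub> (k::nat) = el (int k * x) 0"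
  by (induction k) (simp_all add: one_eq_el el_mult algebra_simps)

lemma el_pow_right: "el 0 y [^]\<^bsub>Mc\<^esub> (k::nat) = el 0 (k * y)"
  by (induction k) (simp_all add: one_eq_el el_mult algebra_simps)

text \<open>The affine action \<open>a \<cdot> k = k + \<alpha>\<close>, \<open>b \<cdot> k = r k + \<beta>\<close> on the residues modulo \<open>p ^ l\<close>.\<close>

definition aff :: "nat \<Rightarrow> int \<Rightarrow> int \<Rightarrow> nat \<times> nat \<Rightarrow> nat \<Rightarrow> nat" where
  "aff l \<alpha> \<beta> g k = nat ((r ^ snd g * int k + \<beta> * gsum r (snd g) + \<alpha> * int (fst g)) mod int p ^ l)"

lemma aff_less: "aff l \<alpha> \<beta> g k < p ^ l"
  using p_pow_pos(1)[of l] by (simp add: aff_def nat_less_iff)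

context
  fixes l :: nat and \<alpha> \<beta> :: int
  assumes l: "l \<le> c + m" and \<alpha>: "int p ^ l dvd int p ^ n * \<alpha>" and \<beta>: "int p ^ l dvd int p ^ m * \<beta>"
begin

text \<open>The assumptions make \<open>a ^ (p ^ n)\<close> and \<open>b ^ (p ^ m)\<close> act
  trivially, so reducing the exponents changes nothing. For \<open>b\<close> this uses that the
  geometric sum with \<open>p ^ m\<close> terms is divisible by \<open>p ^ m\<close>.\<close>

lemma aff_el: "int (aff l \<alpha> \<beta> (el x y) k) = (r ^ y * int k + \<beta> * gsum r y + \<alpha> * x) mod int p ^ l"
proof -
  have 1: "[r ^ (y mod p ^ m) * int k = r ^ y * int k] (mod int p ^ l)"
    by (intro cong_scalar_right r_pow_cong l)
  have 2: "[\<beta> * gsum r (y mod p ^ m) = \<beta> * gsum r y] (mod int p ^ l)"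
  proof -
    define z where "z = y div p ^ m"
    have y: "y = p ^ m * z + y mod p ^ m" by (simp add: z_def)
    have "[\<beta> * r ^ (p ^ m * z) = \<beta> * 1] (mod int p ^ l)"
      by (intro cong_scalar_left power_cong_one[of m]) (use l in auto)
    hence "[\<beta> * r ^ (p ^ m * z) * gsum r (y mod p ^ m) = \<beta> * 1 * gsum r (y mod p ^ m)] (mod int p ^ l)"
      by (rule cong_scalar_right)
    moreover have "[\<beta> * gsum r (p ^ m * z) = 0] (mod int p ^ l)"
    proof -
      have "int p ^ m dvd gsum r (p ^ m * z)" by (simp add: dvd_gsum_iff)
      hence "int p ^ m * \<beta> dvd \<beta> * gsum r (p ^ m * z)" by (simp add: mult.commute mult_dvd_mono)
      thus ?thesis using \<beta> by (metis cong_0_iff dvd_trans)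
    qed
    ultimately have "[\<beta> * gsum r (p ^ m * z) + \<beta> * r ^ (p ^ m * z) * gsum r (y mod p ^ m)
        = 0 + \<beta> * 1 * gsum r (y mod p ^ m)] (mod int p ^ l)" by (intro cong_add)
    moreover have "\<beta> * gsum r y = \<beta> * gsum r (p ^ m * z) + \<beta> * r ^ (p ^ m * z) * gsum r (y mod p ^ m)"
      by (subst y, subst gsum_add) (simp add: algebra_simps)
    ultimately show ?thesis by (simp add: cong_sym)
  qed
  have 3: "[\<alpha> * (x mod int p ^ n) = \<alpha> * x] (mod int p ^ l)"
  proof -
    have "x - x mod int p ^ n = int p ^ n * (x div int p ^ n)" by (simp add: minus_mod_eq_mult_div)
    hence "\<alpha> * x - \<alpha> * (x mod int p ^ n) = int p ^ n * \<alpha> * (x div int p ^ n)"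
      by (metis mult.assoc mult.commute right_diff_distrib)
    hence "int p ^ l dvd \<alpha> * x - \<alpha> * (x mod int p ^ n)" using \<alpha> by simp
    thus ?thesis by (metis cong_iff_dvd_diff cong_sym)
  qed
  show ?thesis
    using cong_add[OF cong_add[OF 1 2] 3] p_pow_pos(1)[of l] p_pow_pos(1)[of n]
    by (simp add: aff_def el_def cong_def)
qed

lemma aff_eq_iff_cong:
  "aff l \<alpha> \<beta> (el x y) k = aff l \<alpha> \<beta> (el x' y') k' \<longleftrightarrow>
    [r ^ y * int k + \<beta> * gsum r y + \<alpha> * x = r ^ y' * int k' + \<beta> * gsum r y' + \<alpha> * x'] (mod int p ^ l)"
  unfolding cong_def aff_el[symmetric] by simp

lemma aff_eq_iff:
  assumes "k' < p ^ l"
  shows "aff l \<alpha> \<beta> (el x y) k = k' \<longleftrightarrow> [r ^ y * int k + \<beta> * gsum r y + \<alpha> * x = int k'] (mod int p ^ l)"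
proof -
  have "int k' mod int p ^ l = int k'" using assms by (simp flip: of_nat_power)
  thus ?thesis unfolding cong_def by (metis aff_el of_nat_eq_iff)
qed

lemma aff_mult:
  assumes "g \<in> carrier Mc" "h \<in> carrier Mc"
  shows "aff l \<alpha> \<beta> (g \<otimes>\<^bsub>Mc\<^esub> h) k = aff l \<alpha> \<beta> g (aff l \<alpha> \<beta> h k)"
proof -
  obtain x y where g: "g = el x y" using assms(1) by (elim carrier_eq_el)
  obtain x' y' where h: "h = el x' y'" using assms(2) by (elim carrier_eq_el)
  have "[int (aff l \<alpha> \<beta> h k) = r ^ y' * int k + \<beta> * gsum r y' + \<alpha> * x'] (mod int p ^ l)"
    by (simp add: h aff_el cong_def)
  hence "[r ^ y * int (aff l \<alpha> \<beta> h k) + (\<beta> * gsum r y + \<alpha> * x) =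
     r ^ y * (r ^ y' * int k + \<beta> * gsum r y' + \<alpha> * x') + (\<beta> * gsum r y + \<alpha> * x)] (mod int p ^ l)"
    by (intro cong_add cong_scalar_left cong_refl)
  also have "r ^ y * (r ^ y' * int k + \<beta> * gsum r y' + \<alpha> * x') + (\<beta> * gsum r y + \<alpha> * x)
     = r ^ (y + y') * int k + \<beta> * gsum r (y + y') + \<alpha> * (x + r ^ y * x')"
    unfolding gsum_add power_add by (simp add: algebra_simps)
  finally have "[r ^ (y + y') * int k + \<beta> * gsum r (y + y') + \<alpha> * (x + r ^ y * x')
      = int (aff l \<alpha> \<beta> g (aff l \<alpha> \<beta> h k))] (mod int p ^ l)"
    by (simp add: g aff_el cong_def add.assoc)
  hence "aff l \<alpha> \<beta> (el (x + r ^ y * x') (y + y')) k = aff l \<alpha> \<beta> g (aff l \<alpha> \<beta> h k)"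
    using aff_eq_iff[OF aff_less] by blast
  thus ?thesis by (simp add: g h el_mult)
qed

lemma aff_one: "k < p ^ l \<Longrightarrow> aff l \<alpha> \<beta> \<one>\<^bsub>Mc\<^esub> k = k"
  by (simp add: one_eq_el aff_eq_iff)

text \<open>Every element acts as an affine map whose slope is a power of \<open>r\<close>, hence is \<open>1\<close> modulo \<open>p\<close>.\<close>

lemma aff_shift:
  assumes "g \<in> carrier Mc" and "l > 0"
  shows "aff l \<alpha> \<beta> g ((k + p ^ (l - 1) * u) mod p ^ l) = (aff l \<alpha> \<beta> g k + p ^ (l - 1) * u) mod p ^ l"
proof -
  obtain x y where g: "g = el x y" using assms(1) by (elim carrier_eq_el)
  have pl: "int p * int p ^ (l - 1) = int p ^ l" using \<open>l > 0\<close> by (simp flip: power_Suc)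
  have "[r ^ y * int p ^ (l - 1) = int p ^ (l - 1)] (mod int p ^ l)"
  proof -
    have "[r ^ y = 1] (mod int p)" by (intro cong_power_one r_cong)
    thus ?thesis using cong_cmult_rightI[of "r ^ y" 1 "int p" "int p ^ (l - 1)"]
      by (simp only: pl mult_1)
  qed
  hence e: "[r ^ y * int p ^ (l - 1) * int u = int p ^ (l - 1) * int u] (mod int p ^ l)"
    by (rule cong_scalar_right)
  have "[int ((k + p ^ (l - 1) * u) mod p ^ l) = int k + int p ^ (l - 1) * int u] (mod int p ^ l)"
    by (simp add: cong_def of_nat_mod)
  hence "[r ^ y * int ((k + p ^ (l - 1) * u) mod p ^ l) + (\<beta> * gsum r y + \<alpha> * x)
      = r ^ y * (int k + int p ^ (l - 1) * int u) + (\<beta> * gsum r y + \<alpha> * x)] (mod int p ^ l)"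
    by (intro cong_add cong_scalar_left cong_refl)
  also have "r ^ y * (int k + int p ^ (l - 1) * int u) + (\<beta> * gsum r y + \<alpha> * x)
      = (r ^ y * int k + \<beta> * gsum r y + \<alpha> * x) + r ^ y * int p ^ (l - 1) * int u"
    by (simp add: algebra_simps)
  also have "[\<dots> = int (aff l \<alpha> \<beta> g k) + int p ^ (l - 1) * int u] (mod int p ^ l)"
    by (rule cong_add[OF _ e]) (simp add: g aff_el cong_def)
  also have "[int (aff l \<alpha> \<beta> g k) + int p ^ (l - 1) * int u = int ((aff l \<alpha> \<beta> g k + p ^ (l - 1) * u) mod p ^ l)] (mod int p ^ l)"
    by (simp add: cong_def of_nat_mod)
  finally have "[r ^ y * int ((k + p ^ (l - 1) * u) mod p ^ l) + \<beta> * gsum r y + \<alpha> * x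
      = int ((aff l \<alpha> \<beta> g k + p ^ (l - 1) * u) mod p ^ l)] (mod int p ^ l)" by (simp add: add.assoc)
  thus ?thesis unfolding g using aff_eq_iff[OF mod_less_divisor[OF p_pow_pos(2)]] by blast
qed

end

end

section \<open>Two families of irreducible representations\<close>

lemma (in cyclic_action) mrep_eqI:
  assumes "\<And>k. k < p ^ l \<Longrightarrow> act g k = act h k"
  shows "mrep g = mrep h"
  unfolding mrep_def using assms less_d by (intro cong_mat) auto

lemma (in irred_rep) rep_pow_eq_one_iff:
  assumes p: "prime p" and g: "g \<in> carrier G" and ord: "\<rho> (g [^] (p ^ l :: nat)) = 1\<^sub>m d"
    and nt: "l > 0 \<Longrightarrow> \<rho> (g [^] (p ^ (l - 1) :: nat)) \<noteq> 1\<^sub>m d"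
  shows "\<rho> (g [^] (k::nat)) = 1\<^sub>m d \<longleftrightarrow> p ^ l dvd k"
proof
  assume "p ^ l dvd k"
  then obtain j where "k = p ^ l * j" by (elim dvdE)
  thus "\<rho> (g [^] k) = 1\<^sub>m d" using rep_pow_eq_one[OF g ord] by simp
next
  assume k: "\<rho> (g [^] k) = 1\<^sub>m d"
  show "p ^ l dvd k"
  proof (rule ccontr)
    assume ndvd: "\<not> p ^ l dvd k"
    hence "k \<noteq> 0" "l > 0" by (auto intro: gr0I)
    obtain f where f: "f \<le> l" "gcd k (p ^ l) = p ^ f"
      using divides_primepow_nat[OF p, of "gcd k (p ^ l)" l] by auto
    have "f \<noteq> l" using f ndvd by (metis gcd_dvd1)
    hence "p ^ f dvd p ^ (l - 1)" using f by (intro le_imp_power_dvd) simp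
    then obtain z where z: "p ^ (l - 1) = p ^ f * z" by (elim dvdE)
    obtain x y where xy: "k * x = p ^ l * y + gcd k (p ^ l)" using bezout_nat[OF \<open>k \<noteq> 0\<close>] by blast
    have "1\<^sub>m d = \<rho> (g [^] (p ^ l * y + p ^ f))" using rep_pow_eq_one[OF g k, of x] xy f by simp
    also have "\<dots> = \<rho> (g [^] (p ^ f))"
      using rep_pow_eq_one[OF g ord, of y] g by (simp add: rep_pow_add)
    finally have "\<rho> (g [^] (p ^ (l - 1))) = 1\<^sub>m d"
      unfolding z using rep_pow_eq_one[OF g] by metis
    thus False using nt[OF \<open>l > 0\<close>] by simp
  qed
qed

context metacyclic
begin

lemma el_pow_gen: "el (int k) 0 = el 1 0 [^]\<^bsub>Mc\<^esub> k" "el 0 k = el 0 1 [^]\<^bsub>Mc\<^esub> k"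
  by (simp_all add: el_pow_left el_pow_right)

lemma cyclic_action_a:
  assumes l: "l > 0" "l \<le> n" and \<beta>: "int p ^ l dvd int p ^ m * \<beta>"
  shows "cyclic_action Mc p l (aff l 1 \<beta>) (el 1 0)"
proof -
  have lm: "l \<le> c + m" using l s_le_m by (simp add: n_def)
  have \<alpha>: "int p ^ l dvd int p ^ n * 1" using l by (simp add: le_imp_power_dvd)
  note aff = lm \<alpha> \<beta>
  show ?thesis
  proof (intro cyclic_action.intro cyclic_action_axioms.intro Mc_group)
    show "aff l 1 \<beta> g ((k + p ^ (l - 1)) mod p ^ l) = (aff l 1 \<beta> g k + p ^ (l - 1)) mod p ^ l"
      if "g \<in> carrier Mc" for g k
      using aff_shift[OF aff that l(1), of k 1] by simp
    show "aff l 1 \<beta> (el 1 0) k = (k + 1) mod p ^ l" for k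
    proof -
      have "[r ^ 0 * int k + \<beta> * gsum r 0 + 1 * 1 = int ((k + 1) mod p ^ l)] (mod int p ^ l)"
        by (simp add: cong_def of_nat_mod add.commute)
      thus ?thesis using aff_eq_iff[OF aff mod_less_divisor[OF p_pow_pos(2)]] by blast
    qed
  qed (use finite_Mc p l aff_less aff_one[OF aff] aff_mult[OF aff] in auto)
qed

text \<open>The orbit map of \<open>b \<cdot> k = r k + 1\<close> through \<open>0\<close>; it makes \<open>b\<close> act as the standard cycle.\<close>

definition orb :: "nat \<Rightarrow> nat \<Rightarrow> nat" where
  "orb l k = nat (gsum r k mod int p ^ l)"

lemma int_orb: "int (orb l k) = gsum r k mod int p ^ l"
  using p_pow_pos(1)[of l] by (simp add: orb_def)

lemma orb_less: "orb l k < p ^ l"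
  using p_pow_pos(1)[of l] by (simp add: orb_def nat_less_iff)

lemma orb_0 [simp]: "orb l 0 = 0" by (simp add: orb_def)

lemma orb_eq_iff: "orb l j = orb l k \<longleftrightarrow> [gsum r j = gsum r k] (mod int p ^ l)"
  unfolding cong_def int_orb[symmetric] by simp

lemma orb_mod: "orb l (k mod p ^ l) = orb l k"
proof -
  define z where "z = p ^ l * (k div p ^ l)"
  have k: "k = z + k mod p ^ l" by (simp add: z_def)
  have "[r ^ z = 1] (mod int p ^ l)" by (rule power_cong_one[of l]) (simp_all add: z_def)
  from gsum_add_cong[OF this, of "k mod p ^ l"]
  have "[gsum r k = gsum r z + gsum r (k mod p ^ l)] (mod int p ^ l)" unfolding k[symmetric] .
  moreover have "[gsum r z = 0] (mod int p ^ l)" by (simp add: cong_0_iff dvd_gsum_iff z_def)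
  hence "[gsum r z + gsum r (k mod p ^ l) = 0 + gsum r (k mod p ^ l)] (mod int p ^ l)"
    by (intro cong_add cong_refl)
  ultimately show ?thesis unfolding orb_eq_iff by (metis add_0 cong_sym cong_trans)
qed

text \<open>\<open>gsum r k - gsum r j\<close> is a unit times \<open>gsum r (k - j)\<close>, which
  has the valuation of \<open>k - j\<close>.\<close>

lemma orb_inj_aux: "j \<le> k \<Longrightarrow> k < p ^ l \<Longrightarrow> orb l j = orb l k \<Longrightarrow> j = k"
proof -
  assume jk: "j \<le> k" "k < p ^ l" and eq: "orb l j = orb l k"
  have kj: "k = j + (k - j)" using jk by simp
  have "int p ^ l dvd gsum r k - gsum r j" using eq[symmetric] by (simp add: orb_eq_iff cong_iff_dvd_diff)
  also have "gsum r k - gsum r j = r ^ j * gsum r (k - j)" by (subst (1) kj) (simp add: gsum_add)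
  finally have dvd: "int p ^ l dvd r ^ j * gsum r (k - j)" .
  have "[r ^ j = 1] (mod int p)" by (rule cong_power_one[OF r_cong])
  hence "\<not> int p dvd r ^ j" using p_gt_1 by (simp add: cong_dvd_iff)
  hence "p ^ l dvd k - j" using dvd by (simp add: prime_power_dvd_mult_iff[OF p] dvd_gsum_iff)
  hence "k - j = 0" using jk by (metis dvd_imp_le gr0I leD less_imp_diff_less)
  thus "j = k" using jk by simp
qed

lemma orb_bij: "bij_betw (orb l) {..<p ^ l} {..<p ^ l}"
proof -
  have "inj_on (orb l) {..<p ^ l}"
    by (rule inj_onI) (metis lessThan_iff nat_le_linear orb_inj_aux)
  thus ?thesis unfolding bij_betw_def by (intro conjI endo_inj_surj) (auto simp: orb_less)
qed

definition act_b :: "nat \<Rightarrow> int \<Rightarrow> nat \<times> nat \<Rightarrow> nat \<Rightarrow> nat" where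
  "act_b l \<alpha> g k = inv_into {..<p ^ l} (orb l) (aff l \<alpha> 1 g (orb l k))"

lemma orb_act_b: "orb l (act_b l \<alpha> g k) = aff l \<alpha> 1 g (orb l k)"
  unfolding act_b_def by (rule bij_betw_inv_into_right[OF orb_bij]) (simp add: aff_less)

lemma act_b_less: "act_b l \<alpha> g k < p ^ l"
  using bij_betwE[OF bij_betw_inv_into[OF orb_bij]] aff_less unfolding act_b_def by blast

lemma act_b_eqI: "j < p ^ l \<Longrightarrow> aff l \<alpha> 1 g (orb l k) = orb l j \<Longrightarrow> act_b l \<alpha> g k = j"
  unfolding act_b_def using bij_betw_inv_into_left[OF orb_bij] by simp

lemma cyclic_action_b:
  assumes l: "l > 0" "l \<le> m" and \<alpha>: "int p ^ l dvd int p ^ n * \<alpha>"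
  shows "cyclic_action Mc p l (act_b l \<alpha>) (el 0 1)"
proof -
  have lm: "l \<le> c + m" using l by simp
  have \<beta>: "int p ^ l dvd int p ^ m * 1" using l by (simp add: le_imp_power_dvd)
  note aff = lm \<alpha> \<beta>
  obtain v where v: "gsum r (p ^ (l - 1)) = int p ^ (l - 1) * v" using gsum_pow by blast
  \<comment> \<open>Under \<open>orb\<close> the shift by \<open>p ^ (l - 1)\<close> becomes a shift
    by \<open>gsum r (p ^ (l - 1))\<close>, which is \<open>p ^ (l - 1) * u\<close> modulo
    \<open>p ^ l\<close>; hence the factor \<open>u\<close> in \<open>aff_shift\<close>.\<close>
  define u where "u = nat (v mod int p)"
  have uv: "[int p ^ (l - 1) * int u = int p ^ (l - 1) * v] (mod int p ^ l)"
  proof -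
    have "[int u = v] (mod int p)" using p_gt_1 by (simp add: u_def cong_def)
    hence "[int p ^ (l - 1) * int u = int p ^ (l - 1) * v] (mod int p ^ (l - 1) * int p)"
      by (rule cong_cmult_leftI)
    thus ?thesis using l by (simp flip: power_Suc2)
  qed
  have orb_shift: "orb l ((k + p ^ (l - 1)) mod p ^ l) = (orb l k + p ^ (l - 1) * u) mod p ^ l" for k
  proof -
    have "[r ^ (p ^ (l - 1)) = 1] (mod int p ^ l)" using c by (intro power_cong_one[of "l - 1"]) auto
    from gsum_add_cong[OF this, of k, unfolded v]
    have "[gsum r (k + p ^ (l - 1)) = int p ^ (l - 1) * v + gsum r k] (mod int p ^ l)"
      by (simp add: add.commute)
    moreover have "[int (orb l k) + int p ^ (l - 1) * int u = gsum r k + int p ^ (l - 1) * v] (mod int p ^ l)"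
      by (rule cong_add[OF _ uv]) (simp add: int_orb cong_def)
    ultimately have "[gsum r (k + p ^ (l - 1)) = int (orb l k) + int p ^ (l - 1) * int u] (mod int p ^ l)"
      by (metis add.commute cong_sym cong_trans)
    hence "int (orb l (k + p ^ (l - 1))) = int ((orb l k + p ^ (l - 1) * u) mod p ^ l)"
      by (simp add: int_orb cong_def of_nat_mod)
    thus ?thesis by (simp add: orb_mod)
  qed
  show ?thesis
  proof (intro cyclic_action.intro cyclic_action_axioms.intro Mc_group)
    show "act_b l \<alpha> g ((k + p ^ (l - 1)) mod p ^ l) = (act_b l \<alpha> g k + p ^ (l - 1)) mod p ^ l"
      if "g \<in> carrier Mc" for g k
      by (intro act_b_eqI) (simp_all only: orb_shift aff_shift[OF aff that l(1)] orb_act_b mod_less_divisor[OF p_pow_pos(2)])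
    show "act_b l \<alpha> (el 0 1) k = (k + 1) mod p ^ l" for k
    proof (rule act_b_eqI)
      have "[r * int (orb l k) + 1 = r * gsum r k + 1] (mod int p ^ l)"
        by (intro cong_add cong_scalar_left cong_refl) (simp add: int_orb cong_def)
      moreover have "gsum r (k + 1) = r * gsum r k + 1" using gsum_add[of r 1 k] by simp
      ultimately have "[r ^ 1 * int (orb l k) + 1 * gsum r 1 + \<alpha> * 0 = int (orb l (k + 1))] (mod int p ^ l)"
        by (simp add: int_orb cong_def)
      hence "aff l \<alpha> 1 (el 0 1) (orb l k) = orb l (k + 1)"
        using aff_eq_iff[OF aff orb_less] by blast
      thus "aff l \<alpha> 1 (el 0 1) (orb l k) = orb l ((k + 1) mod p ^ l)" by (simp only: orb_mod)
    qed (rule mod_less_divisor[OF p_pow_pos(2)])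
    show "act_b l \<alpha> (g \<otimes>\<^bsub>Mc\<^esub> h) k = act_b l \<alpha> g (act_b l \<alpha> h k)" if "g \<in> carrier Mc" "h \<in> carrier Mc" for g h k
      by (rule act_b_eqI[OF act_b_less]) (simp only: orb_act_b aff_mult[OF aff that])
    show "act_b l \<alpha> \<one>\<^bsub>Mc\<^esub> k = k" if "k < p ^ l" for k
      by (rule act_b_eqI[OF that aff_one[OF aff orb_less]])
  qed (use finite_Mc p l act_b_less in auto)
qed

text \<open>The two families of irreducible representations of degree \<open>totient (p ^ l)\<close>: in the first,
  \<open>a\<close> has order \<open>p ^ l\<close> and \<open>b ^ (p ^ t) = a ^ (p ^ t * j)\<close> for \<open>t = l - c\<close> (truncated);
  in the second, \<open>a\<close> has smaller order, \<open>b\<close> has order \<open>p ^ l\<close> and \<open>a ^ (p ^ t) = b ^ (j * p ^ t)\<close>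
  where \<open>t\<close> is the least number with \<open>a ^ (p ^ (c + t)) = 1\<close>.\<close>

definition valid_a :: "nat \<Rightarrow> nat \<Rightarrow> bool" where
  "valid_a l j \<longleftrightarrow> 0 < l \<and> l \<le> n \<and> j < p ^ (l - (l - c)) \<and> p ^ (l - (l - c)) dvd j * p ^ (m - (l - c))"

text \<open>\<open>p ^ (l - t) dvd j * p ^ c\<close> expresses that \<open>a ^ (p ^ (c + t))\<close>
  acts trivially, just as the divisibility in \<open>valid_a\<close> expresses that
  \<open>b ^ (p ^ m)\<close> does. The last clause makes \<open>t\<close> minimal: for positive
  \<open>t\<close>, \<open>a ^ (p ^ (c + t - 1))\<close> must survive. By \<open>c < l - t\<close>,
  or by \<open>p dvd j\<close> if \<open>t = 0\<close>, the power \<open>a ^ (p ^ (l - 1))\<close>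
  is trivial, which separates this family from the first.\<close>

definition valid_b :: "nat \<Rightarrow> nat \<Rightarrow> nat \<Rightarrow> bool" where
  "valid_b l t j \<longleftrightarrow> l \<le> m \<and> t \<le> s \<and> t < l \<and> j < p ^ (l - t) \<and> p ^ (l - t) dvd j * p ^ c \<and>
     (if t = 0 then p dvd j else c < l - t \<and> \<not> p ^ (l - t) dvd j * p ^ (c - 1))"

definition rel_a :: "nat \<Rightarrow> nat \<Rightarrow> nat \<Rightarrow> (nat \<times> nat \<Rightarrow> rat mat) \<Rightarrow> bool" where
  "rel_a l j e \<sigma> \<longleftrightarrow> \<sigma> (el 0 (p ^ (l - c))) = \<sigma> (el (int (p ^ (l - c) * j)) 0) \<and>
     \<sigma> (el (int (p ^ l)) 0) = 1\<^sub>m e \<and> \<sigma> (el (int (p ^ (l - 1))) 0) \<noteq> 1\<^sub>m e"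

definition rel_b :: "nat \<Rightarrow> nat \<Rightarrow> nat \<Rightarrow> nat \<Rightarrow> (nat \<times> nat \<Rightarrow> rat mat) \<Rightarrow> bool" where
  "rel_b l t j e \<sigma> \<longleftrightarrow> \<sigma> (el (int (p ^ t)) 0) = \<sigma> (el 0 (j * p ^ t)) \<and>
     \<sigma> (el 0 (p ^ l)) = 1\<^sub>m e \<and> \<sigma> (el 0 (p ^ (l - 1))) \<noteq> 1\<^sub>m e"

text \<open>With this slope-free part of \<open>b\<close>, and \<open>t = l - c\<close>, the
  translation part of \<open>b ^ (p ^ t)\<close> is that of \<open>a ^ (p ^ t * j)\<close>. A
  solution exists because the geometric sum is \<open>p ^ t\<close> times a unit.\<close>

definition beta :: "nat \<Rightarrow> nat \<Rightarrow> int" where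
  "beta l j = (SOME \<beta>. [\<beta> * gsum r (p ^ (l - c)) = int (p ^ (l - c) * j)] (mod int p ^ l))"

text \<open>Chosen so that \<open>a ^ (p ^ t)\<close> translates by as much as
  \<open>b ^ (j * p ^ t)\<close> does when \<open>b\<close> is
  \<open>k \<mapsto> r k + 1\<close>.\<close>

definition alpha :: "nat \<Rightarrow> nat \<Rightarrow> int" where
  "alpha t j = gsum r (j * p ^ t) div int p ^ t"

definition rep_a :: "nat \<Rightarrow> nat \<Rightarrow> nat \<times> nat \<Rightarrow> rat mat" where
  "rep_a l j = cyclic_action.mrep p l (aff l 1 (beta l j))"

definition rep_b :: "nat \<Rightarrow> nat \<Rightarrow> nat \<Rightarrow> nat \<times> nat \<Rightarrow> rat mat" where
  "rep_b l t j = cyclic_action.mrep p l (act_b l (alpha t j))"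

lemma beta: "[beta l j * gsum r (p ^ (l - c)) = int (p ^ (l - c) * j)] (mod int p ^ l)"
proof -
  obtain v where v: "gsum r (p ^ (l - c)) = int p ^ (l - c) * v" "\<not> int p dvd v" using gsum_pow by blast
  have "coprime (int p) v" using v(2) p by (simp add: prime_imp_coprime)
  hence "coprime v (int p ^ l)" by (simp add: coprime_commute)
  then obtain w where "[v * w = 1] (mod int p ^ l)" using cong_solve_coprime_int by blast
  hence "[v * w * int (p ^ (l - c) * j) = 1 * int (p ^ (l - c) * j)] (mod int p ^ l)"
    by (rule cong_scalar_right)
  moreover have "v * w * int (p ^ (l - c) * j) = (int j * w) * gsum r (p ^ (l - c))"
    unfolding v(1) by simp
  ultimately have "[(int j * w) * gsum r (p ^ (l - c)) = int (p ^ (l - c) * j)] (mod int p ^ l)"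
    by (simp only: mult_1)
  thus ?thesis unfolding beta_def by (rule someI)
qed

lemma alpha: "int p ^ t * alpha t j = gsum r (j * p ^ t)"
proof -
  have "int p ^ t dvd gsum r (j * p ^ t)" by (simp add: dvd_gsum_iff)
  thus ?thesis by (simp add: alpha_def)
qed

text \<open>Multiplying the congruence for \<open>beta\<close> by \<open>p ^ (m - t)\<close> turns
  \<open>p ^ l dvd j * p ^ m\<close> into the conclusion, up to a unit. This is what makes
  \<open>b ^ (p ^ m)\<close> act trivially.\<close>

lemma valid_a_beta:
  assumes "valid_a l j"
  shows "int p ^ l dvd int p ^ m * beta l j"
proof -
  define t where "t = l - c"
  have t: "t \<le> m" "t \<le> l" using assms s_le_m by (auto simp: valid_a_def t_def n_def)
  obtain v where v: "gsum r (p ^ t) = int p ^ t * v" "\<not> int p dvd v" using gsum_pow by blast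
  have "p ^ (l - t) * p ^ t dvd (j * p ^ (m - t)) * p ^ t"
    using assms by (intro mult_dvd_mono) (simp_all add: valid_a_def t_def)
  hence "p ^ l dvd j * p ^ m" using t by (simp add: mult.assoc flip: power_add)
  hence "int p ^ l dvd int j * int p ^ m" by (metis of_nat_dvd_iff of_nat_mult of_nat_power)
  moreover have "[beta l j * (int p ^ t * v) * int p ^ (m - t) = int (p ^ t * j) * int p ^ (m - t)] (mod int p ^ l)"
    using beta[of l j] unfolding t_def[symmetric] v(1) by (rule cong_scalar_right)
  moreover have pm: "int p ^ m = int p ^ t * int p ^ (m - t)" using t(1) by (simp flip: power_add)
  have "beta l j * (int p ^ t * v) * int p ^ (m - t) = v * (int p ^ m * beta l j)"
    unfolding pm by simp
  moreover have "int (p ^ t * j) * int p ^ (m - t) = int j * int p ^ m"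
    unfolding pm by simp
  ultimately have "int p ^ l dvd v * (int p ^ m * beta l j)" by (metis cong_dvd_iff)
  thus ?thesis by (simp add: prime_power_dvd_mult_iff[OF p v(2)])
qed

text \<open>Ensures that \<open>b ^ (j * p ^ t)\<close> has slope 1 modulo \<open>p ^ l\<close>, so
  that it is a pure translation and can agree with a power of \<open>a\<close>.\<close>

lemma valid_b_dvd:
  assumes "valid_b l t j"
  shows "p ^ (l - c) dvd j * p ^ t"
proof (cases "c \<le> l")
  case True
  have "p ^ (l - t) * p ^ t dvd (j * p ^ c) * p ^ t"
    using assms by (intro mult_dvd_mono) (simp_all add: valid_b_def)
  moreover have "p ^ (l - t) * p ^ t = p ^ c * p ^ (l - c)"
    using assms True by (simp add: valid_b_def flip: power_add)
  moreover have "j * p ^ c * p ^ t = p ^ c * (j * p ^ t)" by simp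
  ultimately have "p ^ c * p ^ (l - c) dvd p ^ c * (j * p ^ t)" by (simp only:)
  thus ?thesis using p_pow_pos(2)[of c] by (simp only: nat_mult_dvd_cancel1)
qed simp

lemma valid_b_alpha:
  assumes "valid_b l t j"
  shows "int p ^ l dvd int p ^ n * alpha t j"
proof -
  \<comment> \<open>Both \<open>p ^ t\<close> and \<open>p ^ (l - c)\<close> divide
    \<open>j * p ^ t\<close>. The larger exponent satisfies \<open>n + f >= t + l\<close>, because
    \<open>n = c + s\<close> and \<open>t <= s\<close>.\<close>
  define f where "f = max t (l - c)"
  have "p ^ f dvd j * p ^ t" using valid_b_dvd[OF assms] by (simp add: f_def max_def)
  hence "int p ^ f dvd gsum r (j * p ^ t)" by (simp add: dvd_gsum_iff)
  hence "int p ^ n * int p ^ f dvd int p ^ n * (int p ^ t * alpha t j)" by (simp add: alpha)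
  moreover have "int p ^ t * int p ^ l dvd int p ^ n * int p ^ f"
    unfolding power_add[symmetric] using assms
    by (intro le_imp_power_dvd) (auto simp: valid_b_def f_def n_def)
  ultimately have "int p ^ t * int p ^ l dvd int p ^ n * (int p ^ t * alpha t j)"
    by (blast intro: dvd_trans)
  moreover have "int p ^ n * (int p ^ t * alpha t j) = int p ^ t * (int p ^ n * alpha t j)" by simp
  moreover have p0: "int p ^ t \<noteq> 0" using p_gt_1 by simp
  ultimately show ?thesis by (simp only: dvd_times_left_cancel_iff[OF p0])
qed

lemma valid_b_power_cong:
  assumes "valid_b l t j"
  shows "[r ^ (j * p ^ t) = 1] (mod int p ^ l)"
  by (rule power_cong_one[OF valid_b_dvd[OF assms]]) simp

lemma cyclic_action_rep_a:
  "valid_a l j \<Longrightarrow> cyclic_action Mc p l (aff l 1 (beta l j)) (el 1 0)"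
  by (rule cyclic_action_a) (auto simp: valid_a_def intro: valid_a_beta)

lemma cyclic_action_rep_b:
  "valid_b l t j \<Longrightarrow> cyclic_action Mc p l (act_b l (alpha t j)) (el 0 1)"
  by (rule cyclic_action_b) (auto simp: valid_b_def intro: valid_b_alpha)

lemma not_dvd_pow_pred: "l > 0 \<Longrightarrow> \<not> p ^ l dvd p ^ (l - 1)"
  using power_dvd_imp_le[of p l "l - 1"] p_gt_1 by auto

lemma irred_rep_a:
  assumes v: "valid_a l j"
  shows "irred_rep Mc ((p - 1) * p ^ (l - 1)) (rep_a l j)"
    and "rel_a l j ((p - 1) * p ^ (l - 1)) (rep_a l j)"
proof -
  interpret A: cyclic_action Mc p l "aff l 1 (beta l j)" "el 1 0" by (rule cyclic_action_rep_a[OF v])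
  have d: "A.d = (p - 1) * p ^ (l - 1)" by (simp add: A.d_def A.q'_def)
  show "irred_rep Mc ((p - 1) * p ^ (l - 1)) (rep_a l j)"
    using A.irred_rep_mrep by (simp add: d rep_a_def)
  have "l \<le> n" using v by (simp add: valid_a_def)
  hence aff: "l \<le> c + m" "int p ^ l dvd int p ^ n * 1" "int p ^ l dvd int p ^ m * beta l j"
    using s_le_m valid_a_beta[OF v] by (auto simp: n_def le_imp_power_dvd)
  have "A.mrep (el 0 (p ^ (l - c))) = A.mrep (el (int (p ^ (l - c) * j)) 0)"
  proof (rule A.mrep_eqI)
    fix k
    have "[r ^ (p ^ (l - c)) = 1] (mod int p ^ l)" by (rule power_cong_one[of "l - c"]) auto
    hence "[r ^ (p ^ (l - c)) * int k + beta l j * gsum r (p ^ (l - c)) = 1 * int k + int (p ^ (l - c) * j)] (mod int p ^ l)"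
      by (intro cong_add cong_scalar_right beta)
    thus "aff l 1 (beta l j) (el 0 (p ^ (l - c))) k = aff l 1 (beta l j) (el (int (p ^ (l - c) * j)) 0) k"
      by (simp add: aff_eq_iff_cong[OF aff])
  qed
  moreover have "A.mrep (el (int (p ^ l)) 0) = 1\<^sub>m A.d" "A.mrep (el (int (p ^ (l - 1))) 0) \<noteq> 1\<^sub>m A.d"
    unfolding el_pow_gen(1)[of "p ^ l"] el_pow_gen(1)[of "p ^ (l - 1)"] A.mrep_g0_pow_eq_one_iff using not_dvd_pow_pred[OF A.l] by simp_all
  ultimately show "rel_a l j ((p - 1) * p ^ (l - 1)) (rep_a l j)"
    by (simp add: rel_a_def rep_a_def d)
qed

lemma irred_rep_b:
  assumes v: "valid_b l t j"
  shows "irred_rep Mc ((p - 1) * p ^ (l - 1)) (rep_b l t j)"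
    and "rel_b l t j ((p - 1) * p ^ (l - 1)) (rep_b l t j)"
proof -
  interpret B: cyclic_action Mc p l "act_b l (alpha t j)" "el 0 1" by (rule cyclic_action_rep_b[OF v])
  have d: "B.d = (p - 1) * p ^ (l - 1)" by (simp add: B.d_def B.q'_def)
  show "irred_rep Mc ((p - 1) * p ^ (l - 1)) (rep_b l t j)"
    using B.irred_rep_mrep by (simp add: d rep_b_def)
  have "l \<le> m" using v by (simp add: valid_b_def)
  hence aff: "l \<le> c + m" "int p ^ l dvd int p ^ n * alpha t j" "int p ^ l dvd int p ^ m * 1"
    using valid_b_alpha[OF v] by (auto simp: le_imp_power_dvd)
  have "B.mrep (el (int (p ^ t)) 0) = B.mrep (el 0 (j * p ^ t))"
  proof (rule B.mrep_eqI)
    fix k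
    have al: "alpha t j * int (p ^ t) = gsum r (j * p ^ t)" using alpha[of t j] by (simp add: mult.commute)
    have cg: "[r ^ (j * p ^ t) * int (orb l k) + gsum r (j * p ^ t) = 1 * int (orb l k) + gsum r (j * p ^ t)] (mod int p ^ l)"
      by (intro cong_add cong_scalar_right valid_b_power_cong[OF v] cong_refl)
    have "aff l (alpha t j) 1 (el (int (p ^ t)) 0) (orb l k) = aff l (alpha t j) 1 (el 0 (j * p ^ t)) (orb l k)"
      using cong_sym[OF cg] unfolding aff_eq_iff_cong[OF aff] al
      by (simp only: power_0 gsum_0 mult_1 mult_zero_right add_0_right)
    thus "act_b l (alpha t j) (el (int (p ^ t)) 0) k = act_b l (alpha t j) (el 0 (j * p ^ t)) k"
      by (simp only: act_b_def)
  qed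
  moreover have "B.mrep (el 0 (p ^ l)) = 1\<^sub>m B.d" "B.mrep (el 0 (p ^ (l - 1))) \<noteq> 1\<^sub>m B.d"
    unfolding el_pow_gen(2)[of "p ^ l"] el_pow_gen(2)[of "p ^ (l - 1)"] B.mrep_g0_pow_eq_one_iff using not_dvd_pow_pred[OF B.l] by simp_all
  ultimately show "rel_b l t j ((p - 1) * p ^ (l - 1)) (rep_b l t j)"
    by (simp add: rel_b_def rep_b_def d)
qed

end

section \<open>Classification\<close>

locale metacyclic_rep = metacyclic p c r s m + irred_rep "metacyclic.Mc p c r s m" d \<rho>
  for p c r s m d \<rho>
begin

definition level :: "nat \<Rightarrow> bool" where
  "level t \<longleftrightarrow> \<rho> (el (int (p ^ (c + t))) 0) = 1\<^sub>m d"

lemma rep_el_mult: "\<rho> (el x y) * \<rho> (el x' y') = \<rho> (el (x + r ^ y * x') (y + y'))"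
  by (simp add: rep_mult[symmetric] el_mult)

lemma rep_el_pow_left: "\<rho> (el (int k * x) 0) = \<rho> (el x 0 [^]\<^bsub>Mc\<^esub> k)"
  by (simp add: el_pow_left)

lemma rep_el_pow_eq_one_left: "\<rho> (el x 0) = 1\<^sub>m d \<Longrightarrow> \<rho> (el (int k * x) 0) = 1\<^sub>m d"
  using rep_pow_eq_one[of "el x 0" 1 k] by (simp add: rep_el_pow_left)

lemma level_cong:
  assumes t: "level t" and x: "[x = x'] (mod int (p ^ (c + t)))"
  shows "\<rho> (el x y) = \<rho> (el x' y)"
proof -
  obtain z where z: "x = x' + int (p ^ (c + t)) * z" using x by (metis cong_iff_lin cong_sym)
  define k where "k = nat (z mod int p ^ n)"
  have "[int k = z] (mod int p ^ n)" using p_pow_pos(1)[of n] by (simp add: k_def cong_def)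
  hence "[x' + int (p ^ (c + t)) * z = int (p ^ (c + t)) * int k + x'] (mod int p ^ n)"
    by (subst add.commute) (intro cong_add cong_scalar_left cong_refl, rule cong_sym)
  hence "el x y = el (int k * int (p ^ (c + t)) + x') y"
    by (intro el_eqI) (simp_all add: z mult.commute)
  also have "\<rho> \<dots> = \<rho> (el (int k * int (p ^ (c + t))) 0) * \<rho> (el x' y)"
    by (simp add: rep_el_mult)
  also have "\<rho> (el (int k * int (p ^ (c + t))) 0) = 1\<^sub>m d"
    using t by (intro rep_el_pow_eq_one_left) (simp add: level_def)
  finally show ?thesis by (simp add: left_mult_one_mat[of _ d d])
qed

lemma level_mono:
  assumes "level t" "t \<le> t'"
  shows "level t'"
proof -
  have "[int (p ^ (c + t')) = 0] (mod int (p ^ (c + t)))"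
    using assms(2) by (simp add: cong_0_iff le_imp_power_dvd)
  from level_cong[OF assms(1) this, of 0] show ?thesis
    using rep_one by (simp add: level_def one_eq_el)
qed

text \<open>Exponents of \<open>a\<close> matter only modulo \<open>p ^ (c + t)\<close>. There
  \<open>r ^ (p ^ t)\<close> is 1, so \<open>b ^ (p ^ t)\<close> commutes with \<open>a\<close>; and
  \<open>r\<close> fixes multiples of \<open>p ^ t\<close> because it is 1 modulo
  \<open>p ^ c\<close>.\<close>

lemma central_el:
  assumes t: "level t" and x: "int (p ^ t) dvd x" and y: "p ^ t dvd y"
  shows "central (el x y)"
  unfolding central_def
proof (intro conjI ballI)
  fix g assume "g \<in> carrier Mc"
  then obtain x' y' :: nat where g: "g = el (int x') y'" by (elim carrier_eq_el)
  have 1: "[r ^ y * int x' = 1 * int x'] (mod int p ^ (c + t))"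
    by (intro cong_scalar_right power_cong_one[OF y]) simp
  have 2: "[r ^ y' * x = 1 * x] (mod int p ^ (c + t))"
  proof -
    obtain z where z: "x = int p ^ t * z" using x by (auto elim!: dvdE)
    have "[r ^ y' = 1] (mod int p ^ c)" by (rule power_cong_one[of 0]) simp_all
    hence "[r ^ y' * int p ^ t = 1 * int p ^ t] (mod int p ^ c * int p ^ t)" by (rule cong_cmult_rightI)
    hence "[r ^ y' * int p ^ t * z = 1 * int p ^ t * z] (mod int p ^ (c + t))"
      unfolding power_add by (rule cong_scalar_right)
    thus ?thesis by (simp add: z mult.assoc)
  qed
  have "[x + r ^ y * int x' = x + 1 * int x'] (mod int p ^ (c + t))"
    by (rule cong_add[OF cong_refl 1])
  also have "x + 1 * int x' = int x' + 1 * x" by simp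
  also have "[int x' + 1 * x = int x' + r ^ y' * x] (mod int p ^ (c + t))"
    by (rule cong_sym[OF cong_add[OF cong_refl 2]])
  finally have "[x + r ^ y * int x' = int x' + r ^ y' * x] (mod int (p ^ (c + t)))" by simp
  from level_cong[OF t this, of "y + y'"]
  show "\<rho> (el x y \<otimes>\<^bsub>Mc\<^esub> g) = \<rho> (g \<otimes>\<^bsub>Mc\<^esub> el x y)"
    by (simp add: g el_mult add.commute)
qed simp

text \<open>Supplies the central elements of order \<open>p\<close> for
  \<open>trace_eq_zero\<close>: when \<open>t\<close> is the least level, exponents of valuation
  exactly \<open>c + t - 1\<close> give nontrivial powers of one such element.\<close>

lemma rep_el_ne_one:
  assumes t: "level t" "t > 0" "\<not> level (t - 1)"
    and a: "int p ^ (c + t - 1) dvd a" "\<not> int p ^ (c + t) dvd a"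
  shows "central (el a 0)" "\<rho> (el a 0) \<noteq> 1\<^sub>m d" "\<rho> (el a 0 [^]\<^bsub>Mc\<^esub> p) = 1\<^sub>m d"
proof -
  obtain w where w: "a = int p ^ (c + t - 1) * w" using a by (elim dvdE)
  have pp: "int p ^ (c + t) = int p ^ (c + t - 1) * int p" using t(2) by (simp flip: power_Suc2)
  have "\<not> int p dvd w" using a(2) by (auto simp: w pp)
  define w' where "w' = nat (w mod int p)"
  have w': "[w = int w'] (mod int p)" using p_gt_1 by (simp add: w'_def cong_def)
  hence nd: "\<not> p dvd w'" using \<open>\<not> int p dvd w\<close> by (simp add: cong_dvd_iff)
  have "[a = int p ^ (c + t - 1) * int w'] (mod int (p ^ (c + t)))"
    using cong_cmult_leftI[OF w', of "int p ^ (c + t - 1)"] by (simp only: w pp of_nat_power)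
  hence eq: "\<rho> (el a 0) = \<rho> (el (int p ^ (c + t - 1)) 0 [^]\<^bsub>Mc\<^esub> w')"
    using level_cong[OF t(1)] by (simp add: el_pow_left mult.commute)
  have "c + t - 1 = c + (t - 1)" using t(2) by simp
  hence 1: "\<rho> (el (int p ^ (c + t - 1)) 0) \<noteq> 1\<^sub>m d" using t(3) by (simp add: level_def)
  have 2: "\<rho> (el (int p ^ (c + t - 1)) 0 [^]\<^bsub>Mc\<^esub> p) = 1\<^sub>m d"
    using t(1) pp by (simp add: level_def el_pow_left mult.commute)
  show "\<rho> (el a 0) \<noteq> 1\<^sub>m d"
    unfolding eq by (rule order_prime_powers_nontrivial[OF p el_carrier 1 2 nd])
  have "int (p ^ t) dvd int p ^ (c + t - 1)" using c by (simp add: le_imp_power_dvd)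
  thus "central (el a 0)" using a(1) by (intro central_el[OF t(1)]) (auto intro: dvd_trans)
  have "[int p * a = 0] (mod int (p ^ (c + t)))" by (simp add: w pp cong_0_iff)
  from level_cong[OF t(1) this, of 0] show "\<rho> (el a 0 [^]\<^bsub>Mc\<^esub> p) = 1\<^sub>m d"
    using rep_one by (simp add: el_pow_left one_eq_el)
qed

lemma not_dvd_decompose:
  assumes "\<not> p ^ t dvd y"
  obtains q y' where "y = p ^ q * y'" "\<not> p dvd y'" "q < t"
proof -
  have "y > 0" using assms by (auto intro: gr0I)
  then obtain q y' where qy: "\<not> p dvd y'" "y = y' * p ^ q" using prime_power_canonical[OF p] by blast
  have "q < t"
  proof (rule ccontr)
    assume "\<not> q < t"
    hence "p ^ t dvd y" by (simp add: qy le_imp_power_dvd)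
    thus False using assms by simp
  qed
  thus ?thesis using qy that by (simp add: mult.commute)
qed

text \<open>The conjugating element is chosen so that the commutator is a power of the first
  generator whose exponent has valuation exactly \<open>c + t - 1\<close>, hence acts as a central
  element of order \<open>p\<close>.\<close>

lemma trace_zero:
  fixes x y :: nat
  assumes t: "level t" "t > 0" "\<not> level (t - 1)" and nd: "\<not> (p ^ t dvd x \<and> p ^ t dvd y)"
  shows "mat_trace (\<rho> (el (int x) y)) = 0"
proof -
  have p0: "p > 0" using p_gt_1 by simp
  show ?thesis
  proof (cases "p ^ t dvd y")
    case False
    then obtain q y' where y: "y = p ^ q * y'" "\<not> p dvd y'" "q < t" by (rule not_dvd_decompose)
    \<comment> \<open>The commutator with \<open>el u 0\<close> has exponent
      \<open>u * (r ^ y - 1)\<close> up to sign. The second factor has valuation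
      \<open>c + q\<close>, so \<open>u\<close> must supply \<open>t - 1 - q\<close>.\<close>
    define u where "u = int p ^ (t - 1 - q)"
    define a where "a = - (u * (r ^ y - 1))"
    have u0: "u \<noteq> 0" using p0 by (simp add: u_def)
    have "c + t - 1 = (t - 1 - q) + (c + q)" "c + t = (t - 1 - q) + (c + Suc q)" using y(3) by auto
    hence e: "int p ^ (c + t - 1) = u * int p ^ (c + q)" "int p ^ (c + t) = u * int p ^ (c + Suc q)"
      by (metis u_def power_add)+
    have a1: "int p ^ (c + t - 1) dvd a"
      unfolding a_def e dvd_minus_iff dvd_times_left_cancel_iff[OF u0] dvd_power_minus_one_iff
      by (simp add: y(1))
    have a2: "\<not> int p ^ (c + t) dvd a"
      unfolding a_def e dvd_minus_iff dvd_times_left_cancel_iff[OF u0] dvd_power_minus_one_iff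
      using y p0 by (simp add: mult.commute)
    have "el u 0 \<otimes>\<^bsub>Mc\<^esub> el (int x) y = el a 0 \<otimes>\<^bsub>Mc\<^esub> el (int x) y \<otimes>\<^bsub>Mc\<^esub> el u 0"
      by (simp add: el_mult a_def algebra_simps)
    thus ?thesis using p0 by (intro trace_eq_zero[OF rep_el_ne_one[OF t a1 a2], of _ "el u 0"]) auto
  next
    case True
    hence "\<not> p ^ t dvd x" using nd by simp
    then obtain q x' where x: "x = p ^ q * x'" "\<not> p dvd x'" "q < t" by (rule not_dvd_decompose)
    \<comment> \<open>The commutator with \<open>el 0 u\<close> has exponent
      \<open>(r ^ u - 1) * x\<close>. Here \<open>x\<close> has valuation \<open>q\<close>, and
      \<open>r ^ u - 1\<close> must supply \<open>c + (t - 1 - q)\<close>.\<close>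
    define u where "u = p ^ (t - 1 - q)"
    define a where "a = (r ^ u - 1) * int x"
    have q0: "int p ^ q \<noteq> 0" using p0 by simp
    have nx: "\<not> int p dvd int x'" using x by simp
    have ea: "a = int p ^ q * (int x' * (r ^ u - 1))" by (simp add: a_def x)
    have "c + t - 1 = q + (c + (t - 1 - q))" "c + t = q + (c + Suc (t - 1 - q))" using x(3) by auto
    hence e: "int p ^ (c + t - 1) = int p ^ q * int p ^ (c + (t - 1 - q))"
      "int p ^ (c + t) = int p ^ q * int p ^ (c + Suc (t - 1 - q))"
      by (metis power_add)+
    have a1: "int p ^ (c + t - 1) dvd a"
      unfolding ea e dvd_times_left_cancel_iff[OF q0] prime_power_dvd_mult_iff[OF p nx] dvd_power_minus_one_iff
      by (simp add: u_def)
    have a2: "\<not> int p ^ (c + t) dvd a"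
      unfolding ea e dvd_times_left_cancel_iff[OF q0] prime_power_dvd_mult_iff[OF p nx] dvd_power_minus_one_iff
      using not_dvd_pow_pred[of "Suc (t - 1 - q)"] by (simp add: u_def)
    have "el 0 u \<otimes>\<^bsub>Mc\<^esub> el (int x) y = el a 0 \<otimes>\<^bsub>Mc\<^esub> el (int x) y \<otimes>\<^bsub>Mc\<^esub> el 0 u"
      by (simp add: el_mult a_def algebra_simps)
    thus ?thesis using p0 by (intro trace_eq_zero[OF rep_el_ne_one[OF t a1 a2], of _ "el 0 u"]) auto
  qed
qed

text \<open>By the relation, a stabilizer element with both exponents divisible by
  \<open>p ^ t\<close> acts under \<open>\<rho>\<close> as a power of \<open>a\<close>. Modulo
  \<open>p ^ l\<close> its exponent is the image of 0 in the model, so it is divisible by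
  \<open>p ^ l\<close> and the action is trivial. The remaining elements are covered by
  \<open>trace_zero\<close>.\<close>

lemma equiv_rep_a:
  assumes v: "valid_a l j" and rel: "rel_a l j d \<rho>"
  shows "(p - 1) * p ^ (l - 1) = d \<and> rep_equiv (carrier Mc) d (rep_a l j) \<rho>"
proof -
  interpret A: cyclic_action Mc p l "aff l 1 (beta l j)" "el 1 0" by (rule cyclic_action_rep_a[OF v])
  define t where "t = l - c"
  have l: "l > 0" "l \<le> n" using v by (auto simp: valid_a_def)
  have aff: "l \<le> c + m" "int p ^ l dvd int p ^ n * 1" "int p ^ l dvd int p ^ m * beta l j"
    using l s_le_m valid_a_beta[OF v] by (auto simp: n_def le_imp_power_dvd)
  have rb: "\<rho> (el 0 (p ^ t)) = \<rho> (el (int (p ^ t * j)) 0)"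
    and ra1: "\<rho> (el (int (p ^ l)) 0) = 1\<^sub>m d" and ra2: "\<rho> (el (int (p ^ (l - 1))) 0) \<noteq> 1\<^sub>m d"
    using rel by (simp_all add: rel_a_def t_def)
  have lev: "level t"
  proof -
    have "c + t = (c + t - l) + l" by (simp add: t_def)
    hence "int (p ^ (c + t)) = int (p ^ (c + t - l)) * int (p ^ l)" by (metis of_nat_mult power_add)
    thus ?thesis using rep_el_pow_eq_one_left[OF ra1] by (simp only: level_def)
  qed
  have nlev: "\<not> level (t - 1)" if "t > 0"
  proof -
    have "c + (t - 1) = l - 1" using that by (simp add: t_def)
    thus ?thesis using ra2 by (simp only: level_def) simp
  qed
  have "A.d = d \<and> rep_equiv (carrier Mc) A.d A.mrep \<rho>"
  proof (rule A.equiv_of_traces)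
    show "irred_rep Mc d \<rho>" by unfold_locales
    have g0: "el 1 0 [^]\<^bsub>Mc\<^esub> k = el (int k) 0" for k :: nat by (simp add: el_pow_left)
    show "central (el 1 0 [^]\<^bsub>Mc\<^esub> A.q')"
      unfolding g0 A.q'_def using l c
      by (intro central_el[OF lev]) (auto simp: t_def le_imp_power_dvd)
    show "\<rho> (el 1 0 [^]\<^bsub>Mc\<^esub> A.q') \<noteq> 1\<^sub>m d" unfolding g0 A.q'_def by (rule ra2)
    show "\<rho> (el 1 0 [^]\<^bsub>Mc\<^esub> (p ^ l)) = 1\<^sub>m d" unfolding g0 by (rule ra1)
    fix h assume "h \<in> carrier Mc" and stab: "aff l 1 (beta l j) h 0 = 0"
    then obtain x y :: nat where h: "h = el (int x) y" by (elim carrier_eq_el)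
    show "\<rho> h = 1\<^sub>m d \<or> mat_trace (\<rho> h) = 0"
    proof (cases "p ^ t dvd x \<and> p ^ t dvd y")
      case False
      hence "t > 0" by (auto intro: gr0I)
      thus ?thesis using trace_zero[OF lev _ nlev False] h by blast
    next
      case True
      then obtain z where y: "y = p ^ t * z" by (auto elim!: dvdE)
      have "[beta l j * gsum r y + int x = 0] (mod int p ^ l)"
        using stab aff_eq_iff[OF aff, of 0 "int x" y 0] p_pow_pos(2)[of l] by (simp add: h)
      moreover have "[beta l j * gsum r y = int z * int (p ^ t * j)] (mod int p ^ l)"
      proof -
        have "[r ^ (p ^ t) = 1] (mod int p ^ l)" by (rule power_cong_one[of t]) (simp_all add: t_def)
        from cong_scalar_left[OF gsum_scale_cong[OF this, of z], of "beta l j"]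
        have "[beta l j * gsum r y = int z * (beta l j * gsum r (p ^ t))] (mod int p ^ l)"
          by (simp add: y mult.left_commute)
        also have "[int z * (beta l j * gsum r (p ^ t)) = int z * int (p ^ t * j)] (mod int p ^ l)"
          unfolding t_def by (rule cong_scalar_left[OF beta])
        finally show ?thesis .
      qed
      ultimately have "[int z * int (p ^ t * j) + int x = 0] (mod int p ^ l)"
        by (meson cong_add cong_refl cong_sym cong_trans)
      hence "int (p ^ l) dvd int (z * (p ^ t * j) + x)" by (simp add: cong_0_iff)
      hence "p ^ l dvd z * (p ^ t * j) + x" by (simp only: of_nat_dvd_iff)
      then obtain k where "z * (p ^ t * j) + x = p ^ l * k" by (elim dvdE)
      hence k: "z * (p ^ t * j) + x = k * p ^ l" by (simp only: mult.commute)
      have "\<rho> h = \<rho> (el (int x) 0) * \<rho> (el 0 (z * p ^ t))" by (simp add: h rep_el_mult y mult.commute)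
      also have "\<rho> (el 0 (z * p ^ t)) = \<rho> (el (int (z * (p ^ t * j))) 0)"
      proof -
        have "\<rho> (el 0 (p ^ t) [^]\<^bsub>Mc\<^esub> z) = \<rho> (el (int (p ^ t * j)) 0 [^]\<^bsub>Mc\<^esub> z)"
          using rb by (induction z) (simp_all add: rep_mult)
        thus ?thesis by (simp add: el_pow_left el_pow_right)
      qed
      also have "\<rho> (el (int x) 0) * \<dots> = \<rho> (el (int k * int (p ^ l)) 0)"
        using arg_cong[OF k, of int] by (simp add: rep_el_mult add.commute)
      also have "\<dots> = 1\<^sub>m d" by (rule rep_el_pow_eq_one_left[OF ra1])
      finally show ?thesis by simp
    qed
  qed
  thus ?thesis by (metis rep_a_def A.d_def A.q'_def)
qed

context
  fixes l t j :: nat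
  assumes v: "valid_b l t j" and rel: "rel_b l t j d \<rho>"
begin

lemma rel_b_order: "\<rho> (el 0 k) = 1\<^sub>m d \<longleftrightarrow> p ^ l dvd k"
proof -
  have g0: "el 0 1 [^]\<^bsub>Mc\<^esub> k = el 0 k" for k :: nat by (simp add: el_pow_right)
  show ?thesis
    using rep_pow_eq_one_iff[OF p el_carrier, of 0 1 l k] rel unfolding g0 rel_b_def by blast
qed

lemma rel_b_pow: "\<rho> (el (int (k * p ^ t)) 0) = \<rho> (el 0 (k * (j * p ^ t)))"
proof -
  have "\<rho> (el (int (p ^ t)) 0 [^]\<^bsub>Mc\<^esub> k) = \<rho> (el 0 (j * p ^ t) [^]\<^bsub>Mc\<^esub> k)"
    using rel by (induction k) (simp_all add: rep_mult rel_b_def)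
  thus ?thesis by (simp add: el_pow_left el_pow_right)
qed

lemma rel_b_pow_eq_one_iff:
  "\<rho> (el (int (p ^ (f + t))) 0) = 1\<^sub>m d \<longleftrightarrow> p ^ (l - t) dvd j * p ^ f"
proof -
  have "t < l" using v by (simp add: valid_b_def)
  have "\<rho> (el (int (p ^ (f + t))) 0) = 1\<^sub>m d \<longleftrightarrow> p ^ l dvd p ^ f * (j * p ^ t)"
    using rel_b_pow[of "p ^ f"] rel_b_order by (simp add: power_add)
  also have "p ^ l = p ^ t * p ^ (l - t)" using \<open>t < l\<close> by (simp flip: power_add)
  also have "p ^ f * (j * p ^ t) = p ^ t * (j * p ^ f)" by simp
  also have "p ^ t * p ^ (l - t) dvd p ^ t * (j * p ^ f) \<longleftrightarrow> p ^ (l - t) dvd j * p ^ f"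
    by (rule nat_mult_dvd_cancel1[OF p_pow_pos(2)])
  finally show ?thesis .
qed

lemma rel_b_level: "level t"
  using v rel_b_pow_eq_one_iff[of c] by (simp add: level_def valid_b_def)

lemma rel_b_not_level: "t > 0 \<Longrightarrow> \<not> level (t - 1)"
proof -
  assume t: "t > 0"
  hence "c + (t - 1) = (c - 1) + t" using c by simp
  thus ?thesis using v t by (simp only: level_def rel_b_pow_eq_one_iff) (simp add: valid_b_def)
qed

text \<open>As for the first family, but now such an element acts as a power of \<open>b\<close>.
  That it fixes 0 says that a geometric sum vanishes modulo \<open>p ^ l\<close>, and
  \<open>dvd_gsum_iff\<close> turns this into divisibility of the number of terms.\<close>

lemma equiv_rep_b:
  "(p - 1) * p ^ (l - 1) = d \<and> rep_equiv (carrier Mc) d (rep_b l t j) \<rho>"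
proof -
  interpret B: cyclic_action Mc p l "act_b l (alpha t j)" "el 0 1" by (rule cyclic_action_rep_b[OF v])
  have l: "l > 0" "l \<le> m" "t < l" using v by (auto simp: valid_b_def)
  have aff: "l \<le> c + m" "int p ^ l dvd int p ^ n * alpha t j" "int p ^ l dvd int p ^ m * 1"
    using l valid_b_alpha[OF v] by (auto simp: le_imp_power_dvd)
  have rb1: "\<rho> (el 0 (p ^ l)) = 1\<^sub>m d" and rb2: "\<rho> (el 0 (p ^ (l - 1))) \<noteq> 1\<^sub>m d"
    using rel by (simp_all add: rel_b_def)
  have g0: "el 0 1 [^]\<^bsub>Mc\<^esub> k = el 0 k" for k :: nat by (simp add: el_pow_right)
  have "B.d = d \<and> rep_equiv (carrier Mc) B.d B.mrep \<rho>"
  proof (rule B.equiv_of_traces)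
    show "irred_rep Mc d \<rho>" by unfold_locales
    show "central (el 0 1 [^]\<^bsub>Mc\<^esub> B.q')"
      unfolding g0 B.q'_def using l
      by (intro central_el[OF rel_b_level]) (auto simp: le_imp_power_dvd)
    show "\<rho> (el 0 1 [^]\<^bsub>Mc\<^esub> B.q') \<noteq> 1\<^sub>m d" unfolding g0 B.q'_def by (rule rb2)
    show "\<rho> (el 0 1 [^]\<^bsub>Mc\<^esub> (p ^ l)) = 1\<^sub>m d" unfolding g0 by (rule rb1)
    fix h assume "h \<in> carrier Mc" and stab: "act_b l (alpha t j) h 0 = 0"
    then obtain x y :: nat where h: "h = el (int x) y" by (elim carrier_eq_el)
    have stab': "aff l (alpha t j) 1 h 0 = 0" using orb_act_b[of l "alpha t j" h 0] stab by simp
    show "\<rho> h = 1\<^sub>m d \<or> mat_trace (\<rho> h) = 0"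
    proof (cases "p ^ t dvd x \<and> p ^ t dvd y")
      case False
      hence "t > 0" by (auto intro: gr0I)
      thus ?thesis using trace_zero[OF rel_b_level _ rel_b_not_level False] h by blast
    next
      case True
      then obtain z where "x = p ^ t * z" by (blast elim: dvdE)
      hence x: "x = z * p ^ t" by (simp only: mult.commute)
      have al: "alpha t j * int x = int z * gsum r (j * p ^ t)" by (simp add: x alpha[symmetric])
      have "[gsum r y + alpha t j * int x = 0] (mod int p ^ l)"
        using stab' aff_eq_iff[OF aff, of 0 "int x" y 0] p_pow_pos(2)[of l] by (simp add: h)
      hence 0: "[int z * gsum r (j * p ^ t) + gsum r y = 0] (mod int p ^ l)"
        unfolding al by (simp only: add.commute)
      note V = valid_b_power_cong[OF v]
      have "[r ^ (j * p ^ t * z) = 1] (mod int p ^ l)" using cong_power_one[OF V, of z] by (simp add: power_mult)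
      hence 1: "[gsum r (j * p ^ t * z + y) = gsum r (j * p ^ t * z) + gsum r y] (mod int p ^ l)"
        by (rule gsum_add_cong)
      have 2: "[gsum r (j * p ^ t * z) + gsum r y = int z * gsum r (j * p ^ t) + gsum r y] (mod int p ^ l)"
        by (rule cong_add[OF gsum_scale_cong[OF V] cong_refl])
      have "[gsum r (j * p ^ t * z + y) = 0] (mod int p ^ l)" by (rule cong_trans[OF 1 cong_trans[OF 2 0]])
      hence "p ^ l dvd j * p ^ t * z + y" by (simp add: cong_0_iff dvd_gsum_iff)
      hence "\<rho> (el 0 (j * p ^ t * z + y)) = 1\<^sub>m d" by (simp add: rel_b_order)
      moreover have "\<rho> h = \<rho> (el (int (z * p ^ t)) 0) * \<rho> (el 0 y)" by (simp add: h rep_el_mult x)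
      hence "\<rho> h = \<rho> (el 0 (j * p ^ t * z + y))"
        unfolding rel_b_pow by (simp add: rep_el_mult mult_ac)
      ultimately show ?thesis by simp
    qed
  qed
  thus ?thesis by (metis rep_b_def B.d_def B.q'_def)
qed

end

text \<open>Let \<open>t\<close> be the least level and \<open>p ^ e\<close> the larger of the
  orders of the images of \<open>a ^ (p ^ t)\<close> and \<open>b ^ (p ^ t)\<close>. By
  \<open>central_cyclic\<close> the element of larger order generates the other; ties go to
  \<open>a\<close>. The long cycle then has length \<open>p ^ l\<close> with
  \<open>l = e + t\<close>.\<close>

lemma classify:
  "(\<forall>g\<in>carrier Mc. \<rho> g = 1\<^sub>m d) \<or> (\<exists>l j. valid_a l j \<and> rel_a l j d \<rho>) \<or>
   (\<exists>l t j. valid_b l t j \<and> rel_b l t j d \<rho>)"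
proof -
  have el_P: "el (int (p ^ n)) 0 = \<one>\<^bsub>Mc\<^esub>" "el 0 (p ^ m) = \<one>\<^bsub>Mc\<^esub>"
    unfolding one_eq_el by (rule el_eqI; simp add: cong_def)+
  have "level s" using el_P by (simp add: level_def n_def)
  define t where "t = (LEAST t. level t)"
  have lev: "level t" unfolding t_def by (rule LeastI) fact
  have ts: "t \<le> s" unfolding t_def by (rule Least_le) fact
  have nlev: "\<not> level (t - 1)" if "t > 0" using not_less_Least[of "t - 1" level] that unfolding t_def by simp
  define z1 z2 where "z1 = el (int (p ^ t)) 0" and "z2 = el 0 (p ^ t)"
  have z1_pow: "z1 [^]\<^bsub>Mc\<^esub> k = el (int (k * p ^ t)) 0" and z2_pow: "z2 [^]\<^bsub>Mc\<^esub> k = el 0 (k * p ^ t)" for k :: nat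
    by (simp_all add: z1_def z2_def el_pow_left el_pow_right)
  have cz: "central z1" "central z2" unfolding z1_def z2_def by (intro central_el[OF lev]; simp)+
  note [simp] = central_carrier[OF cz(1)] central_carrier[OF cz(2)]
  define Q where "Q e \<longleftrightarrow> \<rho> (z1 [^]\<^bsub>Mc\<^esub> (p ^ e)) = 1\<^sub>m d \<and> \<rho> (z2 [^]\<^bsub>Mc\<^esub> (p ^ e)) = 1\<^sub>m d" for e :: nat
  have z1c: "\<rho> (z1 [^]\<^bsub>Mc\<^esub> (p ^ c)) = 1\<^sub>m d" using lev by (simp add: z1_pow level_def flip: power_add)
  have z1c': "\<rho> (z1 [^]\<^bsub>Mc\<^esub> (p ^ (c - 1))) \<noteq> 1\<^sub>m d" if "t > 0"
  proof -
    have "c - 1 + t = c + (t - 1)" using that c by simp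
    hence "p ^ (c - 1) * p ^ t = p ^ (c + (t - 1))" by (simp flip: power_add)
    thus ?thesis using nlev[OF that] by (simp only: z1_pow level_def) simp
  qed
  have z2m: "\<rho> (z2 [^]\<^bsub>Mc\<^esub> (p ^ (m - t))) = 1\<^sub>m d"
    using ts s_le_m el_P by (simp add: z2_pow flip: power_add)
  have pow_mono: "\<rho> (z [^]\<^bsub>Mc\<^esub> (p ^ f)) = 1\<^sub>m d" if "z \<in> carrier Mc" "\<rho> (z [^]\<^bsub>Mc\<^esub> (p ^ f')) = 1\<^sub>m d" "f' \<le> f" for z and f f' :: nat
    using rep_pow_eq_one[OF that(1,2), of "p ^ (f - f')"] that(3) by (simp flip: power_add)
  have "Q (c + m)" unfolding Q_def using pow_mono[OF _ z1c, of "c + m"] pow_mono[OF _ z2m, of "c + m"] by simp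
  define e where "e = (LEAST e. Q e)"
  have Qe: "Q e" unfolding e_def by (rule LeastI) fact
  show ?thesis
  proof (cases "e = 0")
    case True
    hence one: "\<rho> z1 = 1\<^sub>m d" "\<rho> z2 = 1\<^sub>m d" using Qe by (simp_all add: Q_def)
    \<comment> \<open>For positive \<open>t\<close> minimality keeps a power of \<open>z1\<close>
      nontrivial; so \<open>t\<close> is 0 and \<open>z1\<close>, \<open>z2\<close> are the
      generators themselves.\<close>
    have "t = 0"
    proof (rule ccontr)
      assume "t \<noteq> 0"
      thus False using z1c' rep_pow_eq_one[of z1 1 "p ^ (c - 1)"] one by simp
    qed
    have "\<rho> g = 1\<^sub>m d" if gc: "g \<in> carrier Mc" for g
    proof -
      obtain x y :: nat where g: "g = el (int x) y" using gc by (elim carrier_eq_el)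
      have "\<rho> g = \<rho> (z1 [^]\<^bsub>Mc\<^esub> x) * \<rho> (z2 [^]\<^bsub>Mc\<^esub> y)"
        using \<open>t = 0\<close> by (simp add: g z1_pow z2_pow rep_el_mult)
      thus ?thesis using rep_pow_eq_one[of z1 1 x] rep_pow_eq_one[of z2 1 y] one by simp
    qed
    thus ?thesis by blast
  next
    case False
    hence e0: "e > 0" by simp
    have "\<not> Q (e - 1)" using not_less_Least[of "e - 1" Q] e0 unfolding e_def by simp
    have z1e: "\<rho> (z1 [^]\<^bsub>Mc\<^esub> (p ^ e)) = 1\<^sub>m d" and z2e: "\<rho> (z2 [^]\<^bsub>Mc\<^esub> (p ^ e)) = 1\<^sub>m d"
      using Qe by (simp_all add: Q_def)
    have pow_mod: "\<rho> (z [^]\<^bsub>Mc\<^esub> (k mod p ^ e)) = \<rho> (z [^]\<^bsub>Mc\<^esub> k)"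
      if "z \<in> carrier Mc" "\<rho> (z [^]\<^bsub>Mc\<^esub> (p ^ e)) = 1\<^sub>m d" for z and k :: nat
    proof -
      have "\<rho> (z [^]\<^bsub>Mc\<^esub> k) = \<rho> (z [^]\<^bsub>Mc\<^esub> (p ^ e * (k div p ^ e) + k mod p ^ e))" by simp
      also have "\<dots> = \<rho> (z [^]\<^bsub>Mc\<^esub> (k mod p ^ e))"
        using that by (simp only: rep_pow_add rep_pow_eq_one) (simp add: left_mult_one_mat[of _ d d])
      finally show ?thesis by simp
    qed
    define l where "l = e + t"
    have lp: "p ^ l = p ^ e * p ^ t" "p ^ (l - 1) = p ^ (e - 1) * p ^ t"
      using e0 by (simp_all add: l_def flip: power_add)
    show ?thesis
    proof (cases "\<rho> (z1 [^]\<^bsub>Mc\<^esub> (p ^ (e - 1))) = 1\<^sub>m d")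
      case nt: False
      have ord: "\<rho> (z1 [^]\<^bsub>Mc\<^esub> k) = 1\<^sub>m d \<longleftrightarrow> p ^ e dvd k" for k :: nat
        by (rule rep_pow_eq_one_iff[OF p _ z1e nt]) simp
      obtain j0 :: nat where "\<rho> z2 = \<rho> (z1 [^]\<^bsub>Mc\<^esub> j0)"
        using central_cyclic[OF p cz(2) cz(1) z2e z1e nt] by blast
      define j where "j = j0 mod p ^ e"
      have j: "\<rho> z2 = \<rho> (z1 [^]\<^bsub>Mc\<^esub> j)" unfolding j_def
        using pow_mod[OF _ z1e, of j0] \<open>\<rho> z2 = _\<close> by simp
      have "e \<le> c" using z1c p_gt_1 by (auto simp: ord dest: power_dvd_imp_le)
      \<comment> \<open>For positive \<open>t\<close> minimality gives \<open>z1\<close> the exact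
        order \<open>p ^ c\<close>, so \<open>l - c\<close> is \<open>t\<close>. For
        \<open>t = 0\<close> only \<open>l <= c\<close> is known, and the truncated difference is
        again \<open>t\<close>.\<close>
      have "e = c" if "t > 0"
      proof (rule ccontr)
        assume "e \<noteq> c"
        hence "\<rho> (z1 [^]\<^bsub>Mc\<^esub> (p ^ (c - 1))) = 1\<^sub>m d" using \<open>e \<le> c\<close> by (intro pow_mono[OF _ z1e]) auto
        thus False using z1c'[OF that] by simp
      qed
      hence lc: "l - c = t" "l - t = e" "l \<le> n" using \<open>e \<le> c\<close> ts by (cases "t = 0"; simp add: l_def n_def)+
      have "\<rho> (z1 [^]\<^bsub>Mc\<^esub> (j * p ^ (m - t))) = 1\<^sub>m d"
      proof -
        have "\<rho> (z2 [^]\<^bsub>Mc\<^esub> k) = \<rho> ((z1 [^]\<^bsub>Mc\<^esub> j) [^]\<^bsub>Mc\<^esub> k)" for k :: nat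
          using j by (induction k) (simp_all add: rep_mult)
        thus ?thesis using z2m by (simp add: nat_pow_pow)
      qed
      hence "p ^ e dvd j * p ^ (m - t)" by (simp only: ord)
      moreover have "j < p ^ e" unfolding j_def by (rule mod_less_divisor[OF p_pow_pos(2)])
      moreover have "0 < l" using e0 by (simp add: l_def)
      ultimately have "valid_a l j" unfolding valid_a_def lc using lc(3) by blast
      moreover have "\<rho> (el 0 (p ^ t)) = \<rho> (el (int (p ^ t * j)) 0)"
        using j by (simp only: z1_pow z2_def mult.commute[of "p ^ t" j])
      moreover have "\<rho> (el (int (p ^ l)) 0) = 1\<^sub>m d" using z1e by (simp only: z1_pow lp)
      moreover have "\<rho> (el (int (p ^ (l - 1))) 0) \<noteq> 1\<^sub>m d" using nt unfolding z1_pow lp .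
      ultimately have "valid_a l j" "rel_a l j d \<rho>" unfolding rel_a_def lc by blast+
      thus ?thesis by blast
    next
      case z1e': True
      hence nt: "\<rho> (z2 [^]\<^bsub>Mc\<^esub> (p ^ (e - 1))) \<noteq> 1\<^sub>m d" using \<open>\<not> Q (e - 1)\<close> by (simp add: Q_def)
      have ord: "\<rho> (z2 [^]\<^bsub>Mc\<^esub> k) = 1\<^sub>m d \<longleftrightarrow> p ^ e dvd k" for k :: nat
        by (rule rep_pow_eq_one_iff[OF p _ z2e nt]) simp
      obtain j0 :: nat where "\<rho> z1 = \<rho> (z2 [^]\<^bsub>Mc\<^esub> j0)"
        using central_cyclic[OF p cz(1) cz(2) z1e z2e nt] by blast
      define j where "j = j0 mod p ^ e"
      have j: "\<rho> z1 = \<rho> (z2 [^]\<^bsub>Mc\<^esub> j)" unfolding j_def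
        using pow_mod[OF _ z2e, of j0] \<open>\<rho> z1 = _\<close> by simp
      have ordz1: "\<rho> (z1 [^]\<^bsub>Mc\<^esub> k) = 1\<^sub>m d \<longleftrightarrow> p ^ e dvd j * k" for k :: nat
      proof -
        have "\<rho> (z1 [^]\<^bsub>Mc\<^esub> k) = \<rho> ((z2 [^]\<^bsub>Mc\<^esub> j) [^]\<^bsub>Mc\<^esub> k)"
          using j by (induction k) (simp_all add: rep_mult)
        thus ?thesis by (simp add: nat_pow_pow ord)
      qed
      have "e \<le> m - t" using z2m p_gt_1 by (auto simp: ord dest: power_dvd_imp_le)
      have "c < e \<and> \<not> p ^ e dvd j * p ^ (c - 1)" if "t > 0"
      proof
        show "\<not> p ^ e dvd j * p ^ (c - 1)" using z1c'[OF that] by (simp add: ordz1)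
        \<comment> \<open>\<open>z1\<close> has order exactly \<open>p ^ c\<close>, and this divides
          \<open>p ^ (e - 1)\<close> because ties went to the first family.\<close>
        show "c < e"
        proof (rule ccontr)
          assume "\<not> c < e"
          hence "\<rho> (z1 [^]\<^bsub>Mc\<^esub> (p ^ (c - 1))) = 1\<^sub>m d" by (intro pow_mono[OF _ z1e']) auto
          thus False using z1c'[OF that] by simp
        qed
      qed
      moreover have "p dvd j"
      proof -
        have "p ^ e dvd j * p ^ (e - 1)" using z1e' by (simp add: ordz1)
        also have "p ^ e = p * p ^ (e - 1)" using e0 by (simp flip: power_Suc)
        finally show ?thesis using p_gt_1 by simp
      qed
      moreover have "p ^ e dvd j * p ^ c" using z1c by (simp add: ordz1)
      moreover have "j < p ^ e" unfolding j_def by (rule mod_less_divisor[OF p_pow_pos(2)])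
      moreover have "l - t = e" "l \<le> m" "t < l" using \<open>e \<le> m - t\<close> e0 by (auto simp: l_def)
      ultimately have "valid_b l t j" using ts by (simp only: valid_b_def) simp
      moreover have "\<rho> (el (int (p ^ t)) 0) = \<rho> (el 0 (j * p ^ t))" using j by (simp only: z1_def z2_pow)
      moreover have "\<rho> (el 0 (p ^ l)) = 1\<^sub>m d" using z2e by (simp only: z2_pow lp)
      moreover have "\<rho> (el 0 (p ^ (l - 1))) \<noteq> 1\<^sub>m d" using nt unfolding z2_pow lp .
      ultimately have "valid_b l t j" "rel_b l t j d \<rho>" unfolding rel_b_def by blast+
      thus ?thesis by blast
    qed
  qed
qed

end

section \<open>Counting\<close>

lemma invertible_matD:
  fixes P :: "rat mat"
  assumes "invertible_mat P" "P \<in> carrier_mat d d"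
  obtains B where "B \<in> carrier_mat d d" "P * B = 1\<^sub>m d" "B * P = 1\<^sub>m d"
proof -
  obtain B where B: "P * B = 1\<^sub>m d" "B * P = 1\<^sub>m (dim_row B)"
    using assms by (auto simp: invertible_mat_def inverts_mat_def)
  have "dim_col (P * B) = d" "dim_col (B * P) = dim_row B" by (simp_all add: B)
  hence "B \<in> carrier_mat d d" using assms(2) by auto
  thus ?thesis using B that by auto
qed

lemma invertible_matI:
  fixes P :: "rat mat"
  assumes "P \<in> carrier_mat d d" "B \<in> carrier_mat d d" "P * B = 1\<^sub>m d" "B * P = 1\<^sub>m d"
  shows "invertible_mat P"
  unfolding invertible_mat_def inverts_mat_def square_mat.simps
  using carrier_matD[OF assms(1)] carrier_matD[OF assms(2)] assms(3,4) by metis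

lemma rep_equiv_refl:
  assumes "\<And>g. g \<in> G \<Longrightarrow> \<rho> g \<in> carrier_mat d d"
  shows "rep_equiv G d \<rho> \<rho>"
  unfolding rep_equiv_def
proof (intro bexI conjI ballI)
  show "invertible_mat (1\<^sub>m d :: rat mat)" by (rule invertible_matI[of _ d "1\<^sub>m d"]) auto
  show "1\<^sub>m d * \<rho> g = \<rho> g * 1\<^sub>m d" if "g \<in> G" for g using assms[OF that] by simp
qed simp

lemma rep_equiv_sym:
  assumes \<rho>: "\<And>g. g \<in> G \<Longrightarrow> \<rho> g \<in> carrier_mat d d" and \<sigma>: "\<And>g. g \<in> G \<Longrightarrow> \<sigma> g \<in> carrier_mat d d"
    and eq: "rep_equiv G d \<rho> \<sigma>"
  shows "rep_equiv G d \<sigma> \<rho>"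
proof -
  obtain P where P: "P \<in> carrier_mat d d" "invertible_mat P" and c: "\<And>g. g \<in> G \<Longrightarrow> P * \<rho> g = \<sigma> g * P"
    using eq by (auto simp: rep_equiv_def)
  obtain B where B: "B \<in> carrier_mat d d" "P * B = 1\<^sub>m d" "B * P = 1\<^sub>m d"
    using invertible_matD[OF P(2,1)] by blast
  have "B * \<sigma> g = \<rho> g * B" if g: "g \<in> G" for g
  proof -
    note [simp] = \<rho>[OF g] \<sigma>[OF g] P(1) B(1)
    have "B * \<sigma> g = B * (\<sigma> g * (P * B))" by (simp add: B(2) right_mult_one_mat[OF \<sigma>[OF g]])
    also have "\<dots> = B * ((\<sigma> g * P) * B)" by (simp add: assoc_mult_mat[of _ d d _ d _ d])
    also have "\<dots> = (B * P) * (\<rho> g * B)"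
      by (simp add: c[OF g, symmetric] assoc_mult_mat[of _ d d _ d _ d] mult_carrier_mat[of _ d d _ d])
    also have "\<dots> = \<rho> g * B" by (simp add: B(3) left_mult_one_mat[of _ d d] mult_carrier_mat[of _ d d _ d])
    finally show ?thesis .
  qed
  moreover have "invertible_mat B" by (rule invertible_matI[OF B(1) P(1) B(3,2)])
  ultimately show ?thesis using B(1) by (auto simp: rep_equiv_def)
qed

text \<open>The definition of \<open>rep_equiv\<close> does not force \<open>\<tau> g\<close> to have \<open>d\<close> columns; only its first \<open>d\<close> columns matter.\<close>

lemma rep_equiv_trans:
  assumes \<rho>: "\<And>g. g \<in> G \<Longrightarrow> \<rho> g \<in> carrier_mat d d" and \<sigma>: "\<And>g. g \<in> G \<Longrightarrow> \<sigma> g \<in> carrier_mat d d"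
    and "rep_equiv G d \<rho> \<sigma>" "rep_equiv G d \<sigma> \<tau>"
  shows "rep_equiv G d \<rho> \<tau>"
proof -
  obtain P where P: "P \<in> carrier_mat d d" "invertible_mat P" and c: "\<And>g. g \<in> G \<Longrightarrow> P * \<rho> g = \<sigma> g * P"
    using assms(3) by (auto simp: rep_equiv_def)
  obtain Q where Q: "Q \<in> carrier_mat d d" "invertible_mat Q" and c': "\<And>g. g \<in> G \<Longrightarrow> Q * \<sigma> g = \<tau> g * Q"
    using assms(4) by (auto simp: rep_equiv_def)
  obtain P' where P': "P' \<in> carrier_mat d d" "P * P' = 1\<^sub>m d" "P' * P = 1\<^sub>m d"
    using invertible_matD[OF P(2,1)] by blast
  obtain Q' where Q': "Q' \<in> carrier_mat d d" "Q * Q' = 1\<^sub>m d" "Q' * Q = 1\<^sub>m d"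
    using invertible_matD[OF Q(2,1)] by blast
  note [simp] = P(1) P'(1) Q(1) Q'(1)
  note assoc = assoc_mult_mat[of _ d d _ d _ d]
  have QP: "Q * P \<in> carrier_mat d d" by (rule mult_carrier_mat[OF Q(1) P(1)])
  have "(Q * P) * \<rho> g = \<tau> g * (Q * P)" if g: "g \<in> G" for g
  proof -
    define T where "T = mat d d (\<lambda>(i, j). row (\<tau> g) i $ j)"
    have T: "T \<in> carrier_mat d d" by (simp add: T_def)
    have "dim_row (Q * \<sigma> g) = dim_row (\<tau> g * Q)" using c'[OF g] by simp
    hence dim: "dim_row (\<tau> g) = d" using carrier_matD(1)[OF Q(1)] by simp
    have TM: "\<tau> g * M = T * M" if "M \<in> carrier_mat d d" for M
      using that dim by (intro eq_matI) (auto simp: T_def scalar_prod_def intro!: sum.cong)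
    note [simp] = \<rho>[OF g] \<sigma>[OF g] T
    have "(Q * P) * \<rho> g = Q * (\<sigma> g * P)" by (simp add: assoc c[OF g])
    also have "\<dots> = (T * Q) * P" by (simp add: assoc c'[OF g, symmetric] TM[symmetric])
    also have "\<dots> = T * (Q * P)" by (simp add: assoc)
    finally show ?thesis by (simp add: TM[OF QP])
  qed
  moreover have "invertible_mat (Q * P)"
  proof (rule invertible_matI[OF QP])
    show PQ': "P' * Q' \<in> carrier_mat d d" by (rule mult_carrier_mat[OF P'(1) Q'(1)])
    have "Q * P * (P' * Q') = Q * ((P * P') * Q')"
      using PQ' by (simp add: assoc)
    thus "Q * P * (P' * Q') = 1\<^sub>m d" by (simp add: P'(2) Q'(2) left_mult_one_mat[of _ d d])
    have "P' * Q' * (Q * P) = P' * ((Q' * Q) * P)"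
      using QP by (simp add: assoc)
    thus "P' * Q' * (Q * P) = 1\<^sub>m d" by (simp add: P'(3) Q'(3) left_mult_one_mat[of _ d d])
  qed
  ultimately show ?thesis using QP by (auto simp: rep_equiv_def)
qed

lemma rep_equiv_eqD:
  assumes \<rho>: "\<And>g. g \<in> G \<Longrightarrow> \<rho> g \<in> carrier_mat d d" and \<sigma>: "\<And>g. g \<in> G \<Longrightarrow> \<sigma> g \<in> carrier_mat d d"
    and eq: "rep_equiv G d \<rho> \<sigma>" and gh: "g \<in> G" "h \<in> G" "\<rho> g = \<rho> h"
  shows "\<sigma> g = \<sigma> h"
proof -
  obtain P where P: "P \<in> carrier_mat d d" "invertible_mat P" and c: "\<And>g. g \<in> G \<Longrightarrow> P * \<rho> g = \<sigma> g * P"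
    using eq by (auto simp: rep_equiv_def)
  obtain B where B: "B \<in> carrier_mat d d" "P * B = 1\<^sub>m d" "B * P = 1\<^sub>m d"
    using invertible_matD[OF P(2,1)] by blast
  have "\<sigma> g * (P * B) = \<sigma> h * (P * B)"
    using c[OF gh(1)] c[OF gh(2)] gh(3)
      assoc_mult_mat[OF \<sigma>[OF gh(1)] P(1) B(1)] assoc_mult_mat[OF \<sigma>[OF gh(2)] P(1) B(1)] by metis
  thus ?thesis using B(2) \<sigma>[OF gh(1)] \<sigma>[OF gh(2)] by simp
qed

lemma irred_rep_matD: "is_irred_rep G mul e d \<rho> \<Longrightarrow> g \<in> G \<Longrightarrow> \<rho> g \<in> carrier_mat d d"
  by (simp add: is_irred_rep_def is_rep_def)

text \<open>The quotient is by a relation on all matrix-valued functions, so its classes are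
  compared only at irreducible representations, where symmetry and transitivity are
  available.\<close>

lemma num_irred_reps_eq_card:
  assumes irr: "\<And>i. i \<in> I \<Longrightarrow> is_irred_rep G mul e d (F i)"
    and inj: "\<And>i j. i \<in> I \<Longrightarrow> j \<in> I \<Longrightarrow> rep_equiv G d (F i) (F j) \<Longrightarrow> i = j"
    and complete: "\<And>\<sigma>. is_irred_rep G mul e d \<sigma> \<Longrightarrow> \<exists>i\<in>I. rep_equiv G d (F i) \<sigma>"
  shows "num_irred_reps G mul e d = card I"
proof -
  define R where "R = {(\<rho>, \<sigma>). rep_equiv G d \<rho> \<sigma>}"
  define C where "C i = R `` {F i}" for i
  note mat = irred_rep_matD
  have class_eq: "R `` {x} = R `` {y}"
    if x: "is_irred_rep G mul e d x" and y: "is_irred_rep G mul e d y" and xy: "rep_equiv G d x y" for x y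
    using rep_equiv_trans[OF mat[OF x] mat[OF y] xy]
      rep_equiv_trans[OF mat[OF y] mat[OF x] rep_equiv_sym[OF mat[OF x] mat[OF y] xy]]
    by (auto simp: R_def)
  have "{\<rho>. is_irred_rep G mul e d \<rho>} // R = C ` I"
  proof safe
    fix S assume "S \<in> {\<rho>. is_irred_rep G mul e d \<rho>} // R"
    then obtain \<sigma> where \<sigma>: "is_irred_rep G mul e d \<sigma>" "S = R `` {\<sigma>}" by (auto simp: quotient_def)
    obtain i where i: "i \<in> I" "rep_equiv G d (F i) \<sigma>" using complete[OF \<sigma>(1)] by blast
    have "S = C i" using class_eq[OF irr[OF i(1)] \<sigma>(1) i(2)] \<sigma>(2) by (simp add: C_def)
    thus "S \<in> C ` I" using i by blast
  next
    fix i assume "i \<in> I"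
    thus "C i \<in> {\<rho>. is_irred_rep G mul e d \<rho>} // R" using irr by (auto simp: C_def quotient_def)
  qed
  moreover have "inj_on C I"
  proof (rule inj_onI)
    fix i j assume ij: "i \<in> I" "j \<in> I" "C i = C j"
    have "F j \<in> C j" using rep_equiv_refl[of G "F j" d] mat[OF irr[OF ij(2)]] by (simp add: C_def R_def)
    hence "rep_equiv G d (F i) (F j)" using ij(3) by (auto simp: C_def R_def)
    thus "i = j" using inj ij by blast
  qed
  ultimately show ?thesis by (simp add: num_irred_reps_def R_def card_image)
qed

lemma trivial_irred_degree:
  assumes irr: "is_irred_rep G mul e d \<rho>" and triv: "\<And>g. g \<in> G \<Longrightarrow> \<rho> g = 1\<^sub>m d"
  shows "d = 1"
proof -
  define W where "W = {v \<in> carrier_vec d. \<forall>i<d. i > 0 \<longrightarrow> v $ i = (0::rat)}"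
  have d: "d > 0" using irr by (simp add: is_irred_rep_def)
  have "is_subspace d W" by (auto simp: is_subspace_def W_def)
  moreover have "\<forall>g\<in>G. \<forall>v\<in>W. \<rho> g *\<^sub>v v \<in> W" using triv by (auto simp: W_def)
  ultimately have "W = {0\<^sub>v d} \<or> W = carrier_vec d" using irr by (auto simp: is_irred_rep_def)
  moreover have "unit_vec d 0 \<in> W" by (simp add: W_def)
  moreover have "unit_vec d 0 \<noteq> (0\<^sub>v d :: rat vec)" using d by simp
  ultimately have "W = carrier_vec d" by auto
  hence "unit_vec d (d - 1) \<in> W" by simp
  hence last: "\<forall>i<d. i > 0 \<longrightarrow> unit_vec d (d - 1) $ i = (0::rat)" unfolding W_def by blast
  show ?thesis
  proof (rule ccontr)
    assume "d \<noteq> 1"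
    hence "0 < d - 1" "d - 1 < d" using d by auto
    hence "unit_vec d (d - 1) $ (d - 1) = (0::rat)" using last by blast
    thus False using \<open>d - 1 < d\<close> by simp
  qed
qed

lemma trivial_irred: "is_irred_rep G mul e 1 (\<lambda>_. 1\<^sub>m 1)"
  unfolding is_irred_rep_def
proof (intro conjI allI impI)
  fix W assume W: "is_subspace 1 W \<and> (\<forall>g\<in>G. \<forall>v\<in>W. 1\<^sub>m 1 *\<^sub>v v \<in> W)"
  show "W = {0\<^sub>v 1} \<or> W = carrier_vec 1"
  proof (cases "W = {0\<^sub>v 1}")
    case False
    then obtain w where w: "w \<in> W" "w \<noteq> 0\<^sub>v 1" using W by (auto simp: is_subspace_def)
    have wc: "w \<in> carrier_vec 1" using W w by (auto simp: is_subspace_def)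
    have w0: "w $ 0 \<noteq> 0"
    proof
      assume "w $ 0 = 0"
      hence "w = 0\<^sub>v 1" using wc by (intro eq_vecI) auto
      thus False using w by simp
    qed
    have "v \<in> W" if v: "v \<in> carrier_vec 1" for v
    proof -
      have "(v $ 0 / w $ 0) \<cdot>\<^sub>v w \<in> W" using W w by (simp add: is_subspace_def)
      moreover have "(v $ 0 / w $ 0) \<cdot>\<^sub>v w = v" using v wc w0 by (intro eq_vecI) auto
      ultimately show ?thesis by simp
    qed
    thus ?thesis using W by (auto simp: is_subspace_def)
  qed simp
qed (auto simp: is_rep_def)

lemma card_multiples_below:
  assumes "D > 0"
  shows "card {j::nat. j < D * K \<and> D dvd j} = K"
proof -
  have "{j. j < D * K \<and> D dvd j} = (\<lambda>k. D * k) ` {..<K}" using assms by (auto elim!: dvdE)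
  moreover have "inj_on (\<lambda>k. D * k) {..<K}" using assms by (auto simp: inj_on_def)
  ultimately show ?thesis by (simp add: card_image)
qed

lemma card_multiples_prime_power:
  assumes "p > 0" "f \<le> e"
  shows "card {j::nat. j < p ^ e \<and> p ^ f dvd j} = p ^ (e - f)"
  using card_multiples_below[of "p ^ f" "p ^ (e - f)"] assms by (simp flip: power_add)

lemma power_dvd_mult_power_iff:
  fixes p j :: nat
  assumes "p > 0"
  shows "p ^ e dvd j * p ^ f \<longleftrightarrow> p ^ (e - f) dvd j"
proof (cases "f \<le> e")
  case True
  hence "p ^ e = p ^ f * p ^ (e - f)" by (simp flip: power_add)
  moreover have "j * p ^ f = p ^ f * j" by simp
  ultimately show ?thesis using assms by (simp only: nat_mult_dvd_cancel1 zero_less_power)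
next
  case False
  thus ?thesis by (simp add: le_imp_power_dvd)
qed

lemma (in irred_rep) rep_pow_diff:
  assumes g: "g \<in> carrier G" and ij: "i \<le> j" and eq: "\<rho> (g [^] (i::nat)) = \<rho> (g [^] (j::nat))"
  shows "\<rho> (g [^] (j - i)) = 1\<^sub>m d"
proof -
  have "g [^] (j - i) = inv (g [^] i) \<otimes> (g [^] i \<otimes> g [^] (j - i))"
    using g by (simp add: m_assoc[symmetric])
  also have "g [^] i \<otimes> g [^] (j - i) = g [^] j" using g ij by (simp add: nat_pow_mult)
  finally have "\<rho> (g [^] (j - i)) = \<rho> (inv (g [^] i)) * \<rho> (g [^] i)" using g eq by (simp add: rep_mult)
  also have "\<dots> = 1\<^sub>m d" using g by (simp add: rep_mult[symmetric])
  finally show ?thesis .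
qed

section \<open>Distinguishing the models by their relations\<close>

context metacyclic_rep
begin

text \<open>The order of \<open>a\<close> is exactly \<open>p ^ l\<close>, so the relation
  determines \<open>p ^ t * j\<close> modulo \<open>p ^ l\<close>, where \<open>t = l - c\<close>,
  and \<open>j\<close> modulo its bound.\<close>

lemma rel_a_unique:
  assumes v: "valid_a l j" "valid_a l j'" and rel: "rel_a l j d \<rho>" "rel_a l j' d \<rho>"
  shows "j = j'"
proof -
  have "j = j'" if v: "valid_a l j" "valid_a l j'" and rel: "rel_a l j d \<rho>" "rel_a l j' d \<rho>" and le: "j \<le> j'" for j j'
  proof -
    define t where "t = l - c"
    have g0: "el 1 0 [^]\<^bsub>Mc\<^esub> k = el (int k) 0" for k :: nat by (simp add: el_pow_left)
    have "\<rho> (el (int (p ^ t * j)) 0) = \<rho> (el (int (p ^ t * j')) 0)"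
      using rel unfolding rel_a_def t_def by metis
    hence "\<rho> (el 1 0 [^]\<^bsub>Mc\<^esub> (p ^ t * j' - p ^ t * j)) = 1\<^sub>m d"
      by (intro rep_pow_diff el_carrier mult_le_mono2 le) (simp only: g0)
    hence "p ^ l dvd p ^ t * j' - p ^ t * j"
      using rep_pow_eq_one_iff[OF p el_carrier, of 1 0 l] rel(1) unfolding g0 rel_a_def by blast
    moreover have "p ^ l = p ^ t * p ^ (l - t)" by (simp add: t_def flip: power_add)
    moreover have "p ^ t * j' - p ^ t * j = p ^ t * (j' - j)" by (simp add: diff_mult_distrib2)
    ultimately have "p ^ (l - t) dvd j' - j" by (simp only: nat_mult_dvd_cancel1[OF p_pow_pos(2)])
    moreover have "j' - j < p ^ (l - t)" using v by (auto simp: valid_a_def t_def)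
    ultimately have "j' - j = 0" by (metis dvd_imp_le gr0I leD)
    thus ?thesis using le by simp
  qed
  thus ?thesis using assms nat_le_linear by metis
qed

text \<open>\<open>t\<close> is the least level, which depends on the representation alone; then the
  order \<open>p ^ l\<close> of \<open>b\<close> determines \<open>j\<close> modulo
  \<open>p ^ (l - t)\<close>.\<close>

lemma rel_b_unique:
  assumes v: "valid_b l t j" "valid_b l t' j'" and rel: "rel_b l t j d \<rho>" "rel_b l t' j' d \<rho>"
  shows "t = t' \<and> j = j'"
proof -
  have le: "t' \<le> t" if v: "valid_b l t j" "valid_b l t' j'" and rel: "rel_b l t j d \<rho>" "rel_b l t' j' d \<rho>" for t t' j j'
  proof (rule ccontr)
    assume "\<not> t' \<le> t"
    hence "level (t' - 1)" using level_mono[OF rel_b_level[OF v(1) rel(1)], of "t' - 1"] by simp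
    thus False using rel_b_not_level[OF v(2) rel(2)] \<open>\<not> t' \<le> t\<close> by simp
  qed
  have t: "t' = t" using le[OF v rel] le[OF v(2,1) rel(2,1)] by simp
  have "j = j'" if v: "valid_b l t j" "valid_b l t j'" and rel: "rel_b l t j d \<rho>" "rel_b l t j' d \<rho>" and le: "j \<le> j'" for j j'
  proof -
    have g0: "el 0 1 [^]\<^bsub>Mc\<^esub> k = el 0 k" for k :: nat by (simp add: el_pow_right)
    have "t < l" using v by (simp add: valid_b_def)
    have "\<rho> (el 0 (j * p ^ t)) = \<rho> (el 0 (j' * p ^ t))" using rel unfolding rel_b_def by metis
    hence "\<rho> (el 0 1 [^]\<^bsub>Mc\<^esub> (j' * p ^ t - j * p ^ t)) = 1\<^sub>m d"
      by (intro rep_pow_diff el_carrier mult_le_mono1 le) (simp only: g0)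
    hence "p ^ l dvd j' * p ^ t - j * p ^ t" unfolding g0 by (simp only: rel_b_order[OF v(1) rel(1)])
    moreover have "p ^ l = p ^ t * p ^ (l - t)" using \<open>t < l\<close> by (simp flip: power_add)
    moreover have "j' * p ^ t - j * p ^ t = p ^ t * (j' - j)" by (metis diff_mult_distrib mult.commute)
    ultimately have "p ^ (l - t) dvd j' - j" by (simp only: nat_mult_dvd_cancel1[OF p_pow_pos(2)])
    moreover have "j' - j < p ^ (l - t)" using v by (auto simp: valid_b_def)
    ultimately have "j' - j = 0" by (metis dvd_imp_le gr0I leD)
    thus ?thesis using le by simp
  qed
  thus ?thesis using assms nat_le_linear unfolding t by metis
qed

text \<open>The element \<open>a ^ (p ^ (l - 1))\<close> decides: it is nontrivial in the first
  family and trivial in the second, by the last clause of \<open>valid_b\<close>.\<close>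

lemma rel_a_rel_b_disjoint:
  assumes "valid_b l t j'" "rel_b l t j' d \<rho>"
  shows "\<not> rel_a l j d \<rho>"
proof
  assume "rel_a l j d \<rho>"
  moreover have "t < l" using assms(1) by (simp add: valid_b_def)
  hence "l - 1 = (l - 1 - t) + t" by simp
  hence "\<rho> (el (int (p ^ (l - 1))) 0) = 1\<^sub>m d \<longleftrightarrow> p ^ (l - t) dvd j' * p ^ (l - 1 - t)"
    using rel_b_pow_eq_one_iff[OF assms] by metis
  ultimately have "\<not> p ^ (l - t) dvd j' * p ^ (l - 1 - t)" by (simp add: rel_a_def)
  moreover have "p ^ (l - t) dvd j' * p ^ (l - 1 - t)"
  proof (cases "t = 0")
    case True
    hence "p dvd j'" using assms(1) by (simp add: valid_b_def)
    hence "p * p ^ (l - 1) dvd j' * p ^ (l - 1)" by (simp add: mult_dvd_mono)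
    thus ?thesis using True \<open>t < l\<close> by (simp flip: power_Suc)
  next
    case False
    hence "p ^ (l - t) dvd j' * p ^ c" "c \<le> l - 1 - t" using assms(1) by (auto simp: valid_b_def)
    thus ?thesis by (meson dvd_trans le_imp_power_dvd mult_dvd_mono dvd_refl)
  qed
  ultimately show False by simp
qed

end

context metacyclic
begin

lemma rel_a_equiv:
  assumes \<rho>: "irred_rep Mc d \<rho>" and \<sigma>: "irred_rep Mc d \<sigma>"
    and eq: "rep_equiv (carrier Mc) d \<rho> \<sigma>" and rel: "rel_a l j d \<rho>"
  shows "rel_a l j d \<sigma>"
proof -
  interpret R: irred_rep Mc d \<rho> by fact
  interpret S: irred_rep Mc d \<sigma> by fact
  have eqD: "\<sigma> g = \<sigma> h" if "g \<in> carrier Mc" "h \<in> carrier Mc" "\<rho> g = \<rho> h" for g h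
    using rep_equiv_eqD[OF R.rep_carrier S.rep_carrier eq that] .
  have eqD': "\<rho> g = \<rho> h" if "g \<in> carrier Mc" "h \<in> carrier Mc" "\<sigma> g = \<sigma> h" for g h
    using rep_equiv_eqD[OF S.rep_carrier R.rep_carrier rep_equiv_sym[OF R.rep_carrier S.rep_carrier eq] that] .
  show ?thesis
    using rel eqD[OF el_carrier el_carrier] eqD[OF el_carrier one_closed] eqD'[OF el_carrier one_closed]
    unfolding rel_a_def R.rep_one S.rep_one by metis
qed

lemma rel_b_equiv:
  assumes \<rho>: "irred_rep Mc d \<rho>" and \<sigma>: "irred_rep Mc d \<sigma>"
    and eq: "rep_equiv (carrier Mc) d \<rho> \<sigma>" and rel: "rel_b l t j d \<rho>"
  shows "rel_b l t j d \<sigma>"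
proof -
  interpret R: irred_rep Mc d \<rho> by fact
  interpret S: irred_rep Mc d \<sigma> by fact
  have eqD: "\<sigma> g = \<sigma> h" if "g \<in> carrier Mc" "h \<in> carrier Mc" "\<rho> g = \<rho> h" for g h
    using rep_equiv_eqD[OF R.rep_carrier S.rep_carrier eq that] .
  have eqD': "\<rho> g = \<rho> h" if "g \<in> carrier Mc" "h \<in> carrier Mc" "\<sigma> g = \<sigma> h" for g h
    using rep_equiv_eqD[OF S.rep_carrier R.rep_carrier rep_equiv_sym[OF R.rep_carrier S.rep_carrier eq] that] .
  show ?thesis
    using rel eqD[OF el_carrier el_carrier] eqD[OF el_carrier one_closed] eqD'[OF el_carrier one_closed]
    unfolding rel_b_def R.rep_one S.rep_one by metis
qed

definition num_reps :: "nat \<Rightarrow> nat" where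
  "num_reps l = num_irred_reps (carrier Mc) (mult Mc) \<one>\<^bsub>Mc\<^esub> (totient (p ^ l))"

lemma p_ge_3: "p \<ge> 3"
proof -
  have "p \<noteq> 2" using odd by auto
  thus ?thesis using p_gt_1 by simp
qed

lemma totient_p: "l > 0 \<Longrightarrow> totient (p ^ l) = (p - 1) * p ^ (l - 1)"
  using totient_prime_power[OF p, of l] by (simp add: mult.commute)

lemma degree_inj:
  assumes "(p - 1) * p ^ (l - 1) = (p - 1) * p ^ (l' - 1)" "l > 0" "l' > 0"
  shows "l = l'"
proof -
  have "p ^ (l - 1) = p ^ (l' - 1)" using assms(1) p_gt_1 by simp
  hence "l - 1 = l' - 1" using p_gt_1 by (simp add: power_inject_exp)
  thus ?thesis using assms by simp
qed

text \<open>Leaves degree 1 to the trivial representation; this uses that \<open>p\<close> is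
  odd.\<close>

lemma degree_ge_2: "(p - 1) * p ^ (l - 1) \<ge> 2"
proof -
  have "2 * 1 \<le> (p - 1) * p ^ (l - 1)" using p_ge_3 p_pow_pos(2)[of "l - 1"] by (intro mult_le_mono) auto
  thus ?thesis by simp
qed

lemma irred_repI: "is_irred_rep (carrier Mc) (mult Mc) \<one>\<^bsub>Mc\<^esub> d \<sigma> \<Longrightarrow> metacyclic_rep p c r s m d \<sigma>"
  by unfold_locales (use finite_Mc in auto)

lemma irred_rep_cases:
  assumes \<sigma>: "is_irred_rep (carrier Mc) (mult Mc) \<one>\<^bsub>Mc\<^esub> d \<sigma>"
  obtains (trivial) "d = 1" "\<And>g. g \<in> carrier Mc \<Longrightarrow> \<sigma> g = 1\<^sub>m 1"
  | (a) l j where "valid_a l j" "d = (p - 1) * p ^ (l - 1)" "rep_equiv (carrier Mc) d (rep_a l j) \<sigma>"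
  | (b) l t j where "valid_b l t j" "d = (p - 1) * p ^ (l - 1)" "rep_equiv (carrier Mc) d (rep_b l t j) \<sigma>"
proof -
  interpret metacyclic_rep p c r s m d \<sigma> by (rule irred_repI[OF \<sigma>])
  from classify show ?thesis
  proof (elim disjE exE conjE)
    assume "\<forall>g\<in>carrier Mc. \<sigma> g = 1\<^sub>m d"
    thus ?thesis using trivial trivial_irred_degree[OF \<sigma>] by auto
  next
    fix l j assume "valid_a l j" "rel_a l j d \<sigma>"
    thus ?thesis using a equiv_rep_a by metis
  next
    fix l t j assume "valid_b l t j" "rel_b l t j d \<sigma>"
    thus ?thesis using b equiv_rep_b by metis
  qed
qed

lemma num_reps_0: "num_reps 0 = 1"
proof -
  have "num_irred_reps (carrier Mc) (mult Mc) \<one>\<^bsub>Mc\<^esub> 1 = card {()}"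
  proof (rule num_irred_reps_eq_card[where F = "\<lambda>_ _. 1\<^sub>m 1"])
    fix \<sigma> assume \<sigma>: "is_irred_rep (carrier Mc) (mult Mc) \<one>\<^bsub>Mc\<^esub> 1 \<sigma>"
    hence "\<sigma> g = 1\<^sub>m 1" if "g \<in> carrier Mc" for g
    proof (cases rule: irred_rep_cases)
      case trivial
      thus ?thesis using that by simp
    next
      case (a l j)
      have "(2::nat) \<le> 1" using degree_ge_2[of l] unfolding a(2)[symmetric] .
      thus ?thesis by simp
    next
      case (b l t j)
      have "(2::nat) \<le> 1" using degree_ge_2[of l] unfolding b(2)[symmetric] .
      thus ?thesis by simp
    qed
    hence "rep_equiv (carrier Mc) 1 (\<lambda>_. 1\<^sub>m 1) \<sigma>"
      using rep_equiv_refl[of "carrier Mc" "\<lambda>_. 1\<^sub>m 1" 1] by (simp add: rep_equiv_def)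
    thus "\<exists>i\<in>{()}. rep_equiv (carrier Mc) 1 (\<lambda>_. 1\<^sub>m 1) \<sigma>" by simp
  qed (rule trivial_irred, simp)
  thus ?thesis by (simp add: num_reps_def)
qed

lemma num_reps_eq_card:
  assumes l: "l > 0"
  shows "num_reps l = card {j. valid_a l j} + card {(t, j). valid_b l t j}"
proof -
  define d where "d = (p - 1) * p ^ (l - 1)"
  define I where "I = Inl ` {j. valid_a l j} \<union> Inr ` {(t, j). valid_b l t j}"
  define F where "F = case_sum (rep_a l) (\<lambda>(t, j). rep_b l t j)"
  have Fa: "irred_rep Mc d (rep_a l j)" "rel_a l j d (rep_a l j)" if "valid_a l j" for j
    using irred_rep_a[OF that] by (simp_all add: d_def)
  have Fb: "irred_rep Mc d (rep_b l t j)" "rel_b l t j d (rep_b l t j)" if "valid_b l t j" for t j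
    using irred_rep_b[OF that] by (simp_all add: d_def)
  have mr: "metacyclic_rep p c r s m d \<rho>" if "irred_rep Mc d \<rho>" for \<rho>
    using irred_repI irred_rep.irred[OF that] by blast
  have ir: "irred_rep Mc d (F i)" if "i \<in> I" for i using that Fa Fb by (auto simp: I_def F_def)
  have "num_irred_reps (carrier Mc) (mult Mc) \<one>\<^bsub>Mc\<^esub> d = card I"
  proof (rule num_irred_reps_eq_card)
    show "is_irred_rep (carrier Mc) (mult Mc) \<one>\<^bsub>Mc\<^esub> d (F i)" if "i \<in> I" for i
      using irred_rep.irred[OF ir[OF that]] .
  next
    fix i i' assume i: "i \<in> I" and i': "i' \<in> I" and eq: "rep_equiv (carrier Mc) d (F i) (F i')"
    note mr' = mr[OF ir[OF i']]
    have ea: "rel_a l j d (F i')" if "rel_a l j d (F i)" for j by (rule rel_a_equiv[OF ir[OF i] ir[OF i'] eq that])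
    have eb: "rel_b l t j d (F i')" if "rel_b l t j d (F i)" for t j by (rule rel_b_equiv[OF ir[OF i] ir[OF i'] eq that])
    consider (aa) j j' where "i = Inl j" "i' = Inl j'" "valid_a l j" "valid_a l j'"
      | (ab) j t' j' where "i = Inl j" "i' = Inr (t', j')" "valid_a l j" "valid_b l t' j'"
      | (ba) t j j' where "i = Inr (t, j)" "i' = Inl j'" "valid_b l t j" "valid_a l j'"
      | (bb) t j t' j' where "i = Inr (t, j)" "i' = Inr (t', j')" "valid_b l t j" "valid_b l t' j'"
      using i i' unfolding I_def by blast
    thus "i = i'"
    proof cases
      case aa
      have "rel_a l j d (F i')" "rel_a l j' d (F i')" using ea Fa(2) aa by (simp_all add: F_def)
      from metacyclic_rep.rel_a_unique[OF mr' aa(3,4) this] show ?thesis using aa by simp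
    next
      case ab
      have "rel_a l j d (F i')" "rel_b l t' j' d (F i')" using ea Fa(2) Fb(2) ab by (simp_all add: F_def)
      thus ?thesis using metacyclic_rep.rel_a_rel_b_disjoint[OF mr' ab(4)] by blast
    next
      case ba
      have "rel_a l j' d (F i')" "rel_b l t j d (F i')" using eb Fa(2) Fb(2) ba by (simp_all add: F_def)
      thus ?thesis using metacyclic_rep.rel_a_rel_b_disjoint[OF mr' ba(3)] by blast
    next
      case bb
      have "rel_b l t j d (F i')" "rel_b l t' j' d (F i')" using eb Fb(2) bb by (simp_all add: F_def)
      from metacyclic_rep.rel_b_unique[OF mr' bb(3,4) this] show ?thesis using bb by simp
    qed
  next
    fix \<sigma> assume "is_irred_rep (carrier Mc) (mult Mc) \<one>\<^bsub>Mc\<^esub> d \<sigma>"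
    thus "\<exists>i\<in>I. rep_equiv (carrier Mc) d (F i) \<sigma>"
    proof (cases rule: irred_rep_cases)
      case trivial
      moreover have "2 \<le> d" unfolding d_def by (rule degree_ge_2)
      ultimately show ?thesis by simp
    next
      case (a l' j)
      have "(p - 1) * p ^ (l' - 1) = (p - 1) * p ^ (l - 1)" using a(2) unfolding d_def by (rule sym)
      hence "l' = l" by (rule degree_inj) (use a(1) l in \<open>auto simp: valid_a_def\<close>)
      thus ?thesis using a by (intro bexI[of _ "Inl j"]) (auto simp: I_def F_def)
    next
      case (b l' t j)
      have "(p - 1) * p ^ (l' - 1) = (p - 1) * p ^ (l - 1)" using b(2) unfolding d_def by (rule sym)
      hence "l' = l" by (rule degree_inj) (use b(1) l in \<open>auto simp: valid_b_def\<close>)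
      thus ?thesis using b by (intro bexI[of _ "Inr (t, j)"]) (auto simp: I_def F_def)
    qed
  qed
  also have "card I = card {j. valid_a l j} + card {(t, j). valid_b l t j}"
  proof -
    have "finite {j. valid_a l j}" by (rule finite_subset[of _ "{..<p ^ (l - (l - c))}"]) (auto simp: valid_a_def)
    moreover have "{(t, j). valid_b l t j} \<subseteq> {..<l} \<times> {..<p ^ l}"
    proof safe
      fix t j assume v: "valid_b l t j"
      have "p ^ (l - t) \<le> p ^ l" using p_gt_1 by (intro power_increasing) auto
      thus "t < l" "j < p ^ l" using v by (auto simp: valid_b_def)
    qed
    hence "finite {(t, j). valid_b l t j}" by (rule finite_subset) simp
    ultimately show ?thesis unfolding I_def by (subst card_Un_disjoint) (auto simp: card_image)
  qed
  finally show ?thesis using l by (simp add: num_reps_def totient_p d_def)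
qed

section \<open>Counting the valid parameters\<close>

lemma card_valid_a:
  assumes "l > 0" "l \<le> n"
  shows "card {j. valid_a l j} = p ^ min (min l c) (m - (l - c))"
proof -
  define e f where "e = l - (l - c)" and "f = m - (l - c)"
  have p0: "p > 0" using p_gt_1 by simp
  have "{j. valid_a l j} = {j. j < p ^ e \<and> p ^ (e - f) dvd j}"
    using assms by (auto simp: valid_a_def e_def f_def power_dvd_mult_power_iff[OF p0])
  also have "card \<dots> = p ^ (e - (e - f))" by (rule card_multiples_prime_power[OF p0]) simp
  also have "e - (e - f) = min e f" by simp
  also have "e = min l c" by (simp add: e_def)
  finally show ?thesis by (simp add: f_def)
qed

lemma card_valid_b_0:
  assumes "l > 0" "l \<le> m"
  shows "card {j. valid_b l 0 j} = p ^ min c (l - 1)"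
proof -
  have p0: "p > 0" using p_gt_1 by simp
  \<comment> \<open>The lower bound 1 comes from the clause \<open>p dvd j\<close>.\<close>
  define f where "f = max (l - c) 1"
  have "p ^ (l - c) dvd j \<and> p dvd j \<longleftrightarrow> p ^ f dvd j" for j
  proof (cases "l - c = 0")
    case False
    hence "p dvd p ^ (l - c)" by (simp add: dvd_power)
    thus ?thesis using False by (auto simp: f_def max_def intro: dvd_trans)
  qed (simp add: f_def)
  hence "{j. valid_b l 0 j} = {j. j < p ^ l \<and> p ^ f dvd j}"
    using assms by (auto simp: valid_b_def power_dvd_mult_power_iff[OF p0])
  also have "card \<dots> = p ^ (l - f)"
    by (rule card_multiples_prime_power[OF p0]) (use assms in \<open>simp add: f_def\<close>)
  also have "l - f = min c (l - 1)" using assms c by (auto simp: f_def)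
  finally show ?thesis .
qed

text \<open>The two divisibility conditions fix the valuation of \<open>j\<close> as exactly
  \<open>l - t - c\<close>; below \<open>p ^ (l - t)\<close> this leaves
  \<open>p ^ c - p ^ (c - 1)\<close> values.\<close>

lemma card_valid_b_pos:
  assumes "0 < t" "t \<le> s" "l \<le> m"
  shows "card {j. valid_b l t j} = (if c < l - t then totient (p ^ c) else 0)"
proof (cases "c < l - t")
  case True
  have p0: "p > 0" using p_gt_1 by simp
  define e where "e = l - t"
  define A B where "A = {j. j < p ^ e \<and> p ^ (e - c) dvd j}" and "B = {j. j < p ^ e \<and> p ^ (e - (c - 1)) dvd j}"
  have "{j. valid_b l t j} = A - B"
    using assms True by (auto simp: valid_b_def power_dvd_mult_power_iff[OF p0] e_def A_def B_def)
  moreover have "p ^ (e - c) dvd p ^ (e - (c - 1))" by (rule le_imp_power_dvd) simp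
  hence "B \<subseteq> A" by (auto simp: A_def B_def intro: dvd_trans)
  moreover have "card A = p ^ (e - (e - c))" "card B = p ^ (e - (e - (c - 1)))"
    unfolding A_def B_def by (rule card_multiples_prime_power[OF p0]; simp)+
  hence "card A = p ^ c" "card B = p ^ (c - 1)" using True by (simp_all add: e_def)
  moreover have "finite B" by (simp add: B_def)
  moreover have "p ^ c - p ^ (c - 1) = totient (p ^ c)"
  proof -
    have "p ^ c - p ^ (c - 1) = p * p ^ (c - 1) - p ^ (c - 1)" using c by (simp flip: power_Suc)
    also have "\<dots> = (p - 1) * p ^ (c - 1)" by (simp add: diff_mult_distrib)
    finally show ?thesis by (simp only: totient_p[OF c])
  qed
  ultimately show ?thesis using True by (simp add: card_Diff_subset)
next
  case False
  thus ?thesis using assms by (simp add: valid_b_def)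
qed

lemma card_valid_b:
  assumes l: "l > 0" "l \<le> m"
  shows "card {(t, j). valid_b l t j} = p ^ min c (l - 1) + min s (l - 1 - c) * totient (p ^ c)"
proof -
  have fin: "finite {j. valid_b l t j}" for t
    by (rule finite_subset[of _ "{..<p ^ (l - t)}"]) (auto simp: valid_b_def)
  have "{(t, j). valid_b l t j} = (SIGMA t:{..s}. {j. valid_b l t j})" by (auto simp: valid_b_def)
  hence "card {(t, j). valid_b l t j} = (\<Sum>t\<le>s. card {j. valid_b l t j})"
    using fin by (simp add: card_SigmaI)
  also have "{..s} = insert 0 {1..s}" by auto
  also have "(\<Sum>t\<in>insert 0 {1..s}. card {j. valid_b l t j}) = p ^ min c (l - 1) + (\<Sum>t=1..s. card {j. valid_b l t j})"
    using l by (simp add: card_valid_b_0)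
  also have "(\<Sum>t=1..s. card {j. valid_b l t j}) = (\<Sum>t=1..s. if c < l - t then totient (p ^ c) else 0)"
    using l by (intro sum.cong) (auto simp: card_valid_b_pos)
  also have "\<dots> = (\<Sum>t\<in>{1..min s (l - 1 - c)}. totient (p ^ c))"
    by (rule sum.mono_neutral_cong_right) auto
  finally show ?thesis by simp
qed

text \<open>The first summand counts the models with \<open>a\<close> as the long cycle, the second
  those with \<open>b\<close>. In the latter, \<open>t = 0\<close> gives the power of
  \<open>p\<close> and every admissible positive \<open>t\<close> one totient.\<close>

lemma num_reps_formula:
  assumes l: "l > 0"
  shows "num_reps l = (if l \<le> n then p ^ min (min l c) (m - (l - c)) else 0) +
    (if l \<le> m then p ^ min c (l - 1) + min s (l - 1 - c) * totient (p ^ c) else 0)"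
proof -
  have "card {j. valid_a l j} = 0" if "\<not> l \<le> n" using that by (simp add: valid_a_def)
  moreover have "card {(t, j). valid_b l t j} = 0" if "\<not> l \<le> m" using that by (simp add: valid_b_def)
  ultimately show ?thesis using l by (simp add: num_reps_eq_card card_valid_a card_valid_b)
qed

end

theorem theorem5p2:
  fixes p n m s :: nat and r :: int and N :: "nat \<Rightarrow> nat"
  assumes "prime p" and "odd p" and "n \<ge> 2" and "m \<ge> 1"
    and "coprime r (int (p ^ n))"
    and "[r ^ (p ^ s) = 1] (mod int (p ^ n))"
    and "\<forall>k. 0 < k \<and> k < p ^ s \<longrightarrow> \<not> [r ^ k = 1] (mod int (p ^ n))"
    and "1 \<le> s" and "s \<le> min (n - 1) m"
    and N_def: "N \<equiv> (\<lambda>l. num_irred_reps (mc_carrier p n m) (mc_mult p n m r) mc_one (totient (p ^ l)))"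
  shows
   "(n - s \<ge> m \<longrightarrow>
       N 0 = 1 \<and>
       (\<forall>l. 1 \<le> l \<and> l \<le> m \<longrightarrow> N l = p ^ (l - 1) * (p + 1)) \<and>
       (\<forall>l. m < l \<and> l \<le> n - s \<longrightarrow> N l = p ^ m) \<and>
       (\<forall>t. 1 \<le> t \<and> t \<le> s \<longrightarrow> N (n - s + t) = p ^ (m - t)))
    \<and>
    (n - s < m \<longrightarrow>
       (let k = m - (n - s) in
        (k \<le> s \<longrightarrow>
           N 0 = 1 \<and>
           (\<forall>l. 1 \<le> l \<and> l \<le> n - s \<longrightarrow> N l = p ^ (l - 1) * (p + 1)) \<and>
           (\<forall>t. 1 \<le> t \<and> t \<le> k - 1 \<longrightarrow>
                N (n - s + t) = 2 * p ^ (n - s) + (t - 1) * totient (p ^ (n - s))) \<and>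
           N (n - s + k) = p ^ (n - s) + (k - 1) * totient (p ^ (n - s)) + p ^ (m - k) \<and>
           (\<forall>t. k + 1 \<le> t \<and> t \<le> s \<longrightarrow> N (n - s + t) = p ^ (m - t)))
        \<and>
        (k > s \<longrightarrow>
           N 0 = 1 \<and>
           (\<forall>l. 1 \<le> l \<and> l \<le> n - s \<longrightarrow> N l = p ^ (l - 1) * (p + 1)) \<and>
           (\<forall>t. 1 \<le> t \<and> t \<le> s \<longrightarrow>
                N (n - s + t) = 2 * p ^ (n - s) + (t - 1) * totient (p ^ (n - s))) \<and>
           (\<forall>l. n + 1 \<le> l \<and> l \<le> m \<longrightarrow>
                N l = p ^ (n - s) + s * totient (p ^ (n - s))))))"
proof -
  define c where "c = n - s"
  have s: "0 < s" "s < n" "s \<le> m" using assms by auto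
  interpret U: unit_order p c r
    unfolding c_def using assms s by (intro unit_order_of_order) auto
  interpret M: metacyclic p c r s m by unfold_locales (use s in auto)
  have n: "n = c + s" using s by (simp add: c_def)
  have Mn: "M.n = n" by (simp add: M.n_def n)
  have N: "N l = M.num_reps l" for l
    by (simp add: N_def M.num_reps_def M.Mc_def Mn)
  have N0: "N 0 = 1" by (simp add: N M.num_reps_0)
  have Nl: "N l = (if l \<le> c + s then p ^ min (min l c) (m - (l - c)) else 0) +
    (if l \<le> m then p ^ min c (l - 1) + min s (l - 1 - c) * totient (p ^ c) else 0)" if "l > 0" for l
    using M.num_reps_formula[OF that] by (simp add: N Mn n)
  \<comment> \<open>For \<open>l <= c\<close> the first family contributes \<open>p ^ l\<close> and
    the second \<open>p ^ (l - 1)\<close>.\<close>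
  have low: "N l = p ^ (l - 1) * (p + 1)" if "1 \<le> l" "l \<le> c" "l \<le> m" for l
  proof -
    have "p ^ l = p ^ (l - 1) * p" using that by (simp flip: power_Suc2)
    moreover have "min l c = l" "l - c = 0" "l - 1 - c = 0" "min c (l - 1) = l - 1" using that by auto
    ultimately show ?thesis using that by (simp add: Nl)
  qed
  \<comment> \<open>The second family occurs only for \<open>c + t <= m\<close>; its positive
    parameters then run from 1 to \<open>t - 1\<close>.\<close>
  have high: "N (c + t) = p ^ min c (m - t) + (if c + t \<le> m then p ^ c + (t - 1) * totient (p ^ c) else 0)"
    if "1 \<le> t" "t \<le> s" for t
  proof -
    have "min (c + t) c = c" "min c (c + t - 1) = c" "min s (c + t - 1 - c) = t - 1" using that by auto
    thus ?thesis using that by (simp add: Nl)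
  qed
  \<comment> \<open>Below \<open>m - c\<close> both families occur, and \<open>m - t\<close> does
    not cut the first one down.\<close>
  have mid: "N (c + t) = 2 * p ^ c + (t - 1) * totient (p ^ c)"
    if "1 \<le> t" "t \<le> s" "t \<le> m - c - 1" "c < m" for t
  proof -
    have "min c (m - t) = c" "c + t \<le> m" using that by auto
    thus ?thesis using high[OF that(1,2)] by simp
  qed
  show ?thesis
    unfolding c_def[symmetric] Let_def
  proof (intro conjI impI allI; (elim conjE)?)
    fix l assume "m \<le> c" "m < l" "l \<le> c"
    thus "N l = p ^ m" by (simp add: Nl)
  next
    fix t assume t: "m \<le> c" "1 \<le> t" "t \<le> s"
    hence "min c (m - t) = m - t" "\<not> c + t \<le> m" by auto
    thus "N (c + t) = p ^ (m - t)" using high[OF t(2,3)] by simp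
  next
    fix t assume "c < m" "m - c \<le> s" "1 \<le> t" "t \<le> m - c - 1"
    thus "N (c + t) = 2 * p ^ c + (t - 1) * totient (p ^ c)" by (intro mid) auto
  next
    assume k: "c < m" "m - c \<le> s"
    hence "1 \<le> m - c" "min c (m - (m - c)) = m - (m - c)" by auto
    thus "N (c + (m - c)) = p ^ c + (m - c - 1) * totient (p ^ c) + p ^ (m - (m - c))"
      using high[of "m - c"] k by simp
  next
    fix t assume t: "c < m" "m - c \<le> s" "m - c + 1 \<le> t" "t \<le> s"
    hence "1 \<le> t" "min c (m - t) = m - t" "\<not> c + t \<le> m" by auto
    thus "N (c + t) = p ^ (m - t)" using high[of t] t(4) by simp
  next
    fix t assume "c < m" "s < m - c" "1 \<le> t" "t \<le> s"
    thus "N (c + t) = 2 * p ^ c + (t - 1) * totient (p ^ c)" by (intro mid) auto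
  next
    fix l assume l: "c < m" "s < m - c" "n + 1 \<le> l" "l \<le> m"
    hence "l > 0" "\<not> l \<le> c + s" "min c (l - 1) = c" "min s (l - 1 - c) = s" by (auto simp: n)
    thus "N l = p ^ c + s * totient (p ^ c)" using l by (simp add: Nl)
  qed (use N0 low in auto)
qed

end
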